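(* Let $r\ge 3$, $k\ge 5$ be integers and let $\ell=\lfloor\frac{k-1}{2}\rfloor$. Then for all sufficiently large $n$ (in terms of $r,k$), \[ \mathrm{ex}_r(n,\mathcal C_k)=\binom{n}{r}-\binom{n-\ell}{r}+\begin{cases}0&\text{if } k\text{ is odd},\\ 1&\text{if }k\text{ is even,}\end{cases} \] and every $\mathcal C_k$-free $r$-graph on $[n]$ with this many edges is of the form $S_L^r(n)$ with $|L|=\ell$ if $k$ is odd, and of the form $S_L^r(n)$ with $|L|=\ell$ plus one further edge if $k$ is even. Also, for each $r\ge 3$ and all sufficiently large $n$, \[ \mathrm{ex}_r(n,\mathcal C_4)=\binom{n}{r}-\binom{n-1}{r}+\left\lfloor\frac{n-1}{r}\right\rfloor, \] and every $\mathcal C_4$-free $r$-graph on $[n]$ with this many edges is of the form $S_L^r(n)\cup F$ with $|L|=1$, where $F$ consists of $\lfloor\frac{n-1}{r}\rfloor$ pairwise disjoint $r$-subsets of $[n]\setminus L$.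
   Context: An $r$-graph is a (finite) family of $r$-element subsets (edges) of a finite vertex set. $[n]=\{1,\dots,n\}$. For a set $\mathcal F$ of $r$-graphs, an $r$-graph is $\mathcal F$-free if it contains no member of $\mathcal F$ as a (not necessarily induced) subgraph, up to isomorphism; $\mathrm{ex}_r(n,\mathcal F)$ is the maximum number of edges in an $\mathcal F$-free $r$-graph on $n$ vertices. A Berge $k$-cycle is a hypergraph consisting of $k$ distinct edges $e_0,\dots,e_{k-1}$ such that there exist $k$ distinct vertices $v_0,\dots,v_{k-1}$ with $v_i\in e_{i-1}\cap e_i$ for all $i$ (indices modulo $k$). A minimal $k$-cycle is a Berge $k$-cycle $\{e_0,\dots,e_{k-1}\}$ such that for distinct $i,j$, $e_i\cap e_j\ne\emptyset$ if and only if $|i-j|=1$ or $\{i,j\}=\{0,k-1\}$, and no vertex belongs to all edges. $\mathcal C_k$ denotes the family of all ($r$-uniform) minimal $k$-cycles. For $L\subset[n]$, $S_L^r(n)$ is the $r$-graph on $[n]$ consisting of all $r$-element subsets of $[n]$ that intersect $L$. *)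

theory Defs
  imports Complex_Main "HOL-Library.Ramsey"
begin

text \<open>
  \<open>nsets A r\<close> is the library's set of all \<open>r\<close>-element subsets of \<open>A\<close>.
  A hypergraph is given by its set of edges; where the vertex set matters it is a separate
  argument. The vertex set \<open>[n]\<close> is \<open>{1..n} :: nat set\<close>.
\<close>

definition r_graph :: "nat \<Rightarrow> 'a set \<Rightarrow> 'a set set \<Rightarrow> bool" where
  "r_graph r V H \<longleftrightarrow> finite V \<and> H \<subseteq> nsets V r"

definition contains_copy :: "'a set set \<Rightarrow> 'b set set \<Rightarrow> bool" where
  "contains_copy H G \<longleftrightarrow> (\<exists>\<phi>. inj_on \<phi> (\<Union>G) \<and> (\<forall>e\<in>G. \<phi> ` e \<in> H))"

definition family_free :: "'b set set set \<Rightarrow> 'a set set \<Rightarrow> bool" where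
  "family_free \<F> H \<longleftrightarrow> \<not> (\<exists>G\<in>\<F>. contains_copy H G)"

definition turan_number :: "nat \<Rightarrow> nat \<Rightarrow> 'b set set set \<Rightarrow> nat" where
  "turan_number r n \<F> = Max {card H | H. r_graph r {1..n} H \<and> family_free \<F> H}"

text \<open>
  Cycles are presented by an enumeration \<open>e\<close> of their edges, of which only the values at
  \<open>0, \<dots>, k - 1\<close> matter; \<open>(i + k - 1) mod k\<close> is the index \<open>i - 1\<close> modulo \<open>k\<close>.
\<close>

definition berge_cycle_enum :: "nat \<Rightarrow> (nat \<Rightarrow> 'a set) \<Rightarrow> bool" where
  "berge_cycle_enum k e \<longleftrightarrow> inj_on e {..<k} \<and>
     (\<exists>v. inj_on v {..<k} \<and> (\<forall>i<k. v i \<in> e ((i + k - 1) mod k) \<inter> e i))"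

definition minimal_cycle :: "nat \<Rightarrow> 'a set set \<Rightarrow> bool" where
  "minimal_cycle k G \<longleftrightarrow> (\<exists>e. G = e ` {..<k} \<and> berge_cycle_enum k e \<and>
     (\<forall>i<k. \<forall>j<k. i \<noteq> j \<longrightarrow>
        (e i \<inter> e j \<noteq> {} \<longleftrightarrow> \<bar>int i - int j\<bar> = 1 \<or> {i, j} = {0, k - 1})) \<and>
     (\<Inter>i<k. e i) = {})"

text \<open>
  The class of all \<open>r\<close>-uniform minimal \<open>k\<close>-cycles, represented up to isomorphism on vertices
  in \<open>nat\<close>; each cycle has no vertices besides those in its edges.
\<close>

definition minimal_cycles :: "nat \<Rightarrow> nat \<Rightarrow> nat set set set" where
  "minimal_cycles r k = {G. r_graph r (\<Union>G) G \<and> minimal_cycle k G}"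

definition S_graph :: "nat set \<Rightarrow> nat \<Rightarrow> nat \<Rightarrow> nat set set" where
  "S_graph L r n = {e \<in> nsets {1..n} r. e \<inter> L \<noteq> {}}"

end

theory Submission
  imports Defs
begin

text \<open>
Write \<open>l = (k - 1) div 2\<close>. In a minimal \<open>k\<close>-cycle with \<open>k \<ge> 4\<close> no vertex lies on three edges, so
\<open>l\<close> vertices meet at most \<open>2 l < k\<close> of its edges. Hence the star of an \<open>l\<close>-set \<open>L\<close>, together with one
edge for even \<open>k\<close> or with disjoint edges for \<open>k = 4\<close>, contains no such cycle
(\<open>extremal_example\<close>). The work is to show that for large \<open>n\<close> nothing else is as large.

Let \<open>H\<close> be cycle-free with at least as many edges as the star, and think of the edges as pairs of
an \<open>(r - 1)\<close>-set \<open>S\<close> and a ``colour'' \<open>x\<close> with \<open>insert x S \<in> H\<close>. Deleting repeatedly all edges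
through an \<open>(r - 1)\<close>-set with at most \<open>l\<close> colours (\<open>peel\<close>) leaves a hypergraph \<open>F\<close> in which every
\<open>(r - 1)\<close>-set of the shadow has at least \<open>l + 1\<close> colours. The main point is \<open>full_shadow_small\<close>: such
an \<open>F\<close> has a shadow of size \<open>o(n^(r-1))\<close>, hence \<open>o(n^(r-1))\<close> edges. So the deletions account for
nearly all edges, and as each \<open>(r - 1)\<close>-set pays for at most \<open>l\<close> of them, nearly every
\<open>(r - 1)\<close>-set has at least \<open>l\<close> colours in \<open>H\<close> (\<open>few_poor_tuples\<close>).

Cycles are found by a density argument. A dense family of \<open>(r - 1)\<close>-sets contains many complete
\<open>(r - 1)\<close>-partite boxes (\<open>box_count\<close>, by convexity). If every single colour is used by few sets only,
then a random box avoids all coincidences between colours of disjoint sets, and no colour is a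
vertex of the box (\<open>exists_good_box\<close>). Sets in the box whose intersections form a path or an even
cycle, each enlarged by one of its colours, are then a minimal path or cycle. Frequent colours
are handled by choosing a maximal set \<open>L\<close> of colours that is contained in the lists of many sets
(\<open>core_ring\<close>): relative to these sets, every colour outside \<open>L\<close> is rare, whereas a colour in \<open>L\<close>
may be used to close a path to a cycle of either parity.

The same dichotomy yields stability. Almost all \<open>(r - 1)\<close>-sets have a list of \<open>l\<close> colours. Rare
colours on a dense family always give a cycle, because a box consists almost surely of sets with
lists, so that one more such set can be used to close a path (\<open>core_box_closing\<close>). Hence some list
\<open>L\<close> occurs on a positive proportion of the sets. If many sets had another list, then a single colour
\<open>x\<close> outside \<open>L\<close> would be frequent; two sets with colour \<open>x\<close> can be joined through the sets with
list \<open>L\<close> by arbitrary connecting sets, and a case distinction on the lists of the two connecting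
sets always produces a cycle (\<open>exchange_box\<close>). This proves \<open>stability\<close>: all but
\<open>o(n^(r-1))\<close> edges of the star of \<open>L\<close> are in \<open>H\<close>.

Finally, stability is turned into an exact statement (\<open>exact_structure\<close>). Call a vertex bad if it
is in many missing edges of the star. Edges of \<open>H\<close> outside the star that contain good vertices can
be completed to cycles inside the star; this bounds the number of edges outside the star that
contain a bad vertex by \<open>O(z^(r-1))\<close>, where \<open>z\<close> is the number of bad vertices. But \<open>z\<close> bad vertices cost
at least a constant times \<open>z n^(r-2)\<close> missing edges, and \<open>z\<close> is at most a small multiple of \<open>n\<close>. So
there are no bad vertices, the star is contained in \<open>H\<close>, and the remaining edges are those that
are allowed.
\<close>

section \<open>Minimal cycles, cores and full hypergraphs\<close>

text \<open>
For \<open>k \<ge> 4\<close> the intersection pattern alone determines minimal cycles: distinctness of the edges,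
representatives of consecutive edges and the empty common intersection all follow from it.
\<close>

definition cyclic_pattern :: "nat \<Rightarrow> (nat \<Rightarrow> 'a set) \<Rightarrow> bool" where
  "cyclic_pattern k e \<longleftrightarrow>
     (\<forall>i j. i < j \<longrightarrow> j < k \<longrightarrow> (e i \<inter> e j \<noteq> {} \<longleftrightarrow> j = Suc i \<or> (i = 0 \<and> Suc j = k)))"

definition has_cycle :: "nat \<Rightarrow> 'a set set \<Rightarrow> bool" where
  "has_cycle k H \<longleftrightarrow> (\<exists>e. (\<forall>i<k. e i \<in> H) \<and> cyclic_pattern k e)"

lemma cyclic_patternI:
  assumes "\<And>i. Suc i < k \<Longrightarrow> e i \<inter> e (Suc i) \<noteq> {}" and "e 0 \<inter> e (k - 1) \<noteq> {}"
    and "\<And>i j. Suc i < j \<Longrightarrow> j < k \<Longrightarrow> \<not> (i = 0 \<and> Suc j = k) \<Longrightarrow> e i \<inter> e j = {}"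
  shows "cyclic_pattern k e"
  unfolding cyclic_pattern_def
proof (intro allI impI)
  fix i j assume ij: "i < j" "j < k"
  show "e i \<inter> e j \<noteq> {} \<longleftrightarrow> j = Suc i \<or> (i = 0 \<and> Suc j = k)"
    using assms(1)[of i] assms(2) assms(3)[of i j] ij
    by (metis Suc_lessI diff_Suc_1)
qed

lemma has_cycleI:
  assumes "\<And>i. i < k \<Longrightarrow> e i \<in> H"
    and "\<And>i. Suc i < k \<Longrightarrow> e i \<inter> e (Suc i) \<noteq> {}"
    and "e 0 \<inter> e (k - 1) \<noteq> {}"
    and "\<And>i j. Suc i < j \<Longrightarrow> j < k \<Longrightarrow> \<not> (i = 0 \<and> Suc j = k) \<Longrightarrow> e i \<inter> e j = {}"
  shows "has_cycle k H"
  unfolding has_cycle_def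
proof (intro exI conjI)
  show "cyclic_pattern k e" using assms(2-4) by (rule cyclic_patternI)
qed (use assms(1) in simp)

lemma has_cycle_mono: "has_cycle k H \<Longrightarrow> H \<subseteq> H' \<Longrightarrow> has_cycle k H'"
  unfolding has_cycle_def by blast

lemma pattern_sym:
  assumes "cyclic_pattern k e" "i < k" "j < k" "i \<noteq> j"
  shows "e i \<inter> e j \<noteq> {} \<longleftrightarrow> j = Suc i \<or> i = Suc j \<or> (i = 0 \<and> Suc j = k) \<or> (j = 0 \<and> Suc i = k)"
proof (cases "i < j")
  case True
  then show ?thesis using assms unfolding cyclic_pattern_def by auto
next
  case False
  then have "j < i" using assms by auto
  then show ?thesis using assms unfolding cyclic_pattern_def by (metis Int_commute not_less_eq order_less_asym' lessI)
qed

text \<open>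
Three distinct positions on a cycle of length at least four are never pairwise adjacent.
\<close>

lemma pattern_three:
  assumes "cyclic_pattern k e" "4 \<le> k" "a < k" "b < k" "c < k" "a \<noteq> b" "b \<noteq> c" "a \<noteq> c"
    and "x \<in> e a" "x \<in> e b" "x \<in> e c"
  shows False
proof -
  have "e a \<inter> e b \<noteq> {}" "e b \<inter> e c \<noteq> {}" "e a \<inter> e c \<noteq> {}" using assms by auto
  then show False
    using pattern_sym[OF assms(1), of a b] pattern_sym[OF assms(1), of b c] pattern_sym[OF assms(1), of a c]
      assms(2-8) by auto
qed

lemma minimal_cycle_pattern:
  assumes "minimal_cycle k G" "4 \<le> k"
  obtains e where "G = e ` {..<k}" "cyclic_pattern k e" "inj_on e {..<k}"
proof -
  obtain e where G: "G = e ` {..<k}" and b: "berge_cycle_enum k e" and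
    c: "\<forall>i<k. \<forall>j<k. i \<noteq> j \<longrightarrow>
        (e i \<inter> e j \<noteq> {} \<longleftrightarrow> \<bar>int i - int j\<bar> = 1 \<or> {i, j} = {0, k - 1})"
    using assms(1) unfolding minimal_cycle_def by blast
  have "cyclic_pattern k e"
    unfolding cyclic_pattern_def
  proof (intro allI impI)
    fix i j assume ij: "i < j" "j < k"
    then have "e i \<inter> e j \<noteq> {} \<longleftrightarrow> \<bar>int i - int j\<bar> = 1 \<or> {i, j} = {0, k - 1}"
      using c by auto
    also have "\<dots> \<longleftrightarrow> j = Suc i \<or> (i = 0 \<and> Suc j = k)"
      using ij by (auto simp: doubleton_eq_iff)
    finally show "e i \<inter> e j \<noteq> {} \<longleftrightarrow> j = Suc i \<or> (i = 0 \<and> Suc j = k)" .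
  qed
  then show thesis using that G b unfolding berge_cycle_enum_def by blast
qed

text \<open>
Equal edges would have the same neighbours, which is impossible on a cycle of length at least
four.
\<close>

lemma pattern_inj:
  assumes pat: "cyclic_pattern k e" and k: "4 \<le> k"
  shows "inj_on e {..<k}"
proof (rule inj_onI)
  fix i j assume ij: "i \<in> {..<k}" "j \<in> {..<k}" "e i = e j"
  show "i = j"
  proof (rule ccontr)
    assume ne: "i \<noteq> j"
    \<comment> \<open>the neighbours of \<open>i\<close> in the cyclic order are neighbours of \<open>j\<close>, too\<close>
    define p where "p = (if Suc i = k then 0 else Suc i)"
    define q where "q = (if i = 0 then k - 1 else i - 1)"
    have p: "p < k" "p \<noteq> i" "q < k" "q \<noteq> i" "p \<noteq> q" using k ij by (auto simp: p_def q_def)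
    have ip: "e i \<inter> e p \<noteq> {}" using pattern_sym[OF pat, of i p] p ij by (auto simp: p_def)
    have iq: "e i \<inter> e q \<noteq> {}" using pattern_sym[OF pat, of i q] p ij by (auto simp: q_def)
    show False
    proof (cases "j = p")
      case True
      then have "e q \<inter> e p \<noteq> {}" using iq ij by auto
      then show False using pattern_sym[OF pat, of q p] p k ij by (auto simp: p_def q_def split: if_splits)
    next
      case False
      then have jp: "e j \<inter> e p \<noteq> {}" using ip ij by auto
      have ij': "e i \<inter> e j \<noteq> {}" using ip ij by auto
      then show False
        using pattern_sym[OF pat, of i j] pattern_sym[OF pat, of j p] jp False p ij k ne
        by (auto simp: p_def split: if_splits)
    qed
  qed
qed

text \<open>
Any choice of a vertex in each intersection of consecutive edges gives distinct vertices, since a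
vertex chosen twice would lie on three edges.
\<close>

lemma pattern_minimal_cycle:
  assumes pat: "cyclic_pattern k e" and k: "4 \<le> k"
  shows "minimal_cycle k (e ` {..<k})"
proof -
  have inj: "inj_on e {..<k}" by (rule pattern_inj[OF pat k])
  define v where "v i = (SOME x. x \<in> e ((i + k - 1) mod k) \<inter> e i)" for i
  have v: "v i \<in> e ((i + k - 1) mod k) \<inter> e i" if "i < k" for i
  proof -
    have "e ((i + k - 1) mod k) \<inter> e i \<noteq> {}"
    proof (cases "i = 0")
      case True
      then show ?thesis using pat k unfolding cyclic_pattern_def by (auto simp: Int_commute)
    next
      case False
      then have "(i + k - 1) mod k = i - 1" using that
        by (metis Nat.add_diff_assoc2 One_nat_def Suc_leI less_imp_diff_less mod_add_self2 mod_less neq0_conv)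
      then show ?thesis using pat False that unfolding cyclic_pattern_def by auto
    qed
    then show ?thesis unfolding v_def by (meson ex_in_conv someI_ex)
  qed
  have pm: "(i + k - 1) mod k = (if i = 0 then k - 1 else i - 1)" if "i < k" for i
    using that k
    by (metis (no_types, lifting) Nat.add_diff_assoc2 One_nat_def Suc_leI add_0 add_gr_0 diff_less less_imp_diff_less mod_add_self2 mod_less neq0_conv zero_less_one)
  have injv: "inj_on v {..<k}"
  proof (rule inj_onI)
    fix i j assume ij: "i \<in> {..<k}" "j \<in> {..<k}" "v i = v j"
    show "i = j"
    proof (rule ccontr)
      assume ne: "i \<noteq> j"
      define p where "p = (if i = 0 then k - 1 else i - 1)"
      define q where "q = (if j = 0 then k - 1 else j - 1)"
      have a: "v i \<in> e i" "v i \<in> e p" using v[of i] ij pm[of i] by (auto simp: p_def)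
      have b: "v i \<in> e j" "v i \<in> e q" using v[of j] ij pm[of j] by (auto simp: q_def)
      have lt: "i < k" "j < k" "p < k" "q < k" "p \<noteq> i" "q \<noteq> j" using ij k by (auto simp: p_def q_def)
      show False
      proof (cases "p = j")
        case True
        then have "q \<noteq> i" using ij k unfolding p_def q_def by (auto split: if_splits)
        then show False using pattern_three[OF pat k, of i j q "v i"] a b lt ne by blast
      next
        case False
        then show False using pattern_three[OF pat k, of i j p "v i"] a b lt ne by blast
      qed
    qed
  qed
  show ?thesis unfolding minimal_cycle_def
  proof (intro exI conjI)
    show "berge_cycle_enum k e" unfolding berge_cycle_enum_def using inj injv v by auto
    show "\<forall>i<k. \<forall>j<k. i \<noteq> j \<longrightarrow> (e i \<inter> e j \<noteq> {} \<longleftrightarrow> \<bar>int i - int j\<bar> = 1 \<or> {i, j} = {0, k - 1})"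
    proof (intro allI impI)
      fix i j assume ij: "i < k" "j < k" "i \<noteq> j"
      have 1: "\<bar>int i - int j\<bar> = 1 \<longleftrightarrow> j = Suc i \<or> i = Suc j" by arith
      have "x = k - 1 \<longleftrightarrow> Suc x = k" for x using k by linarith
      then have 2: "{i, j} = {0, k - 1} \<longleftrightarrow> (i = 0 \<and> Suc j = k) \<or> (j = 0 \<and> Suc i = k)"
        unfolding doubleton_eq_iff by metis
      show "e i \<inter> e j \<noteq> {} \<longleftrightarrow> \<bar>int i - int j\<bar> = 1 \<or> {i, j} = {0, k - 1}"
        unfolding 1 2 pattern_sym[OF pat ij] by (rule iffI; elim disjE; simp)
    qed
    have "e 0 \<inter> e 2 = {}" using pattern_sym[OF pat, of 0 2] k by auto
    moreover have "(\<Inter>i<k. e i) \<subseteq> e 0 \<inter> e 2" using k by (auto intro!: INF_lower)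
    ultimately show "(\<Inter>i<k. e i) = {}" by blast
  qed simp
qed

lemma family_free_iff_no_cycle:
  assumes "r_graph r V H" "4 \<le> k"
  shows "family_free (minimal_cycles r k) (H :: nat set set) \<longleftrightarrow> \<not> has_cycle k H"
proof
  assume f: "family_free (minimal_cycles r k) H"
  show "\<not> has_cycle k H"
  proof
    assume "has_cycle k H"
    then obtain e where e: "\<forall>i<k. e i \<in> H" "cyclic_pattern k e" unfolding has_cycle_def by blast
    let ?G = "e ` {..<k}"
    have sub: "?G \<subseteq> H" using e by auto
    have fc: "finite x \<and> card x = r" if "x \<in> ?G" for x
      using sub assms(1) that unfolding r_graph_def nsets_def by blast
    then have "finite (\<Union>?G)" by blast
    moreover have "?G \<subseteq> nsets (\<Union>?G) r" unfolding nsets_def using fc by blast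
    ultimately have "r_graph r (\<Union>?G) ?G" unfolding r_graph_def by blast
    then have "?G \<in> minimal_cycles r k"
      using pattern_minimal_cycle[OF e(2) assms(2)] unfolding minimal_cycles_def by auto
    moreover have "contains_copy H ?G" unfolding contains_copy_def
      using sub by (intro exI[of _ id]) auto
    ultimately show False using f unfolding family_free_def by blast
  qed
next
  assume n: "\<not> has_cycle k H"
  show "family_free (minimal_cycles r k) H"
    unfolding family_free_def
  proof
    assume "\<exists>G\<in>minimal_cycles r k. contains_copy H G"
    then obtain G where mG: "G \<in> minimal_cycles r k" and cG: "contains_copy H G" by blast
    obtain \<phi> where G: "inj_on \<phi> (\<Union>G)" "\<forall>e\<in>G. \<phi> ` e \<in> H"
      using cG unfolding contains_copy_def by blast
    have min: "minimal_cycle k G" using mG unfolding minimal_cycles_def by blast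
    obtain e where e: "G = e ` {..<k}" "cyclic_pattern k e"
      using minimal_cycle_pattern[OF min assms(2)] by blast
    have "cyclic_pattern k (\<lambda>i. \<phi> ` e i)"
      unfolding cyclic_pattern_def
    proof (intro allI impI)
      fix i j assume ij: "i < j" "j < k"
      have "e i \<in> G" "e j \<in> G" using e(1) ij by auto
      then have "e i \<subseteq> \<Union>G" "e j \<subseteq> \<Union>G" by blast+
      then have "\<phi> ` e i \<inter> \<phi> ` e j = \<phi> ` (e i \<inter> e j)"
        by (rule inj_on_image_Int[OF G(1), symmetric])
      then show "(\<phi> ` e i \<inter> \<phi> ` e j \<noteq> {}) = (j = Suc i \<or> i = 0 \<and> Suc j = k)"
        using e(2) ij unfolding cyclic_pattern_def by auto
    qed
    then have "has_cycle k H" unfolding has_cycle_def using G(2) e(1)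
      by (intro exI[of _ "\<lambda>i. \<phi> ` e i"]) auto
    then show False using n by simp
  qed
qed

text \<open>
Every choice has to avoid a bounded number of vertices only, so the choices can be made one after
the other.
\<close>

lemma greedy_disjoint_choice:
  assumes "\<And>i U. i < N \<Longrightarrow> finite U \<Longrightarrow> card U \<le> c \<Longrightarrow>
             \<exists>R. finite R \<and> card R \<le> r \<and> R \<inter> U = {} \<and> P i R"
    and "finite U0" "card U0 + N * r \<le> c"
  shows "\<exists>R. \<forall>i<N. finite (R i) \<and> card (R i) \<le> r \<and> R i \<inter> U0 = {} \<and> P i (R i) \<and> (\<forall>j<i. R i \<inter> R j = {})"
  using assms
proof (induction N)
  case 0
  then show ?case by auto
next
  case (Suc N)
  have "\<exists>R. \<forall>i<N. finite (R i) \<and> card (R i) \<le> r \<and> R i \<inter> U0 = {} \<and> P i (R i) \<and> (\<forall>j<i. R i \<inter> R j = {})"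
    using Suc.prems by (intro Suc.IH) auto
  then obtain R where R: "\<forall>i<N. finite (R i) \<and> card (R i) \<le> r \<and> R i \<inter> U0 = {} \<and> P i (R i) \<and> (\<forall>j<i. R i \<inter> R j = {})"
    by blast
  let ?U = "U0 \<union> (\<Union>i<N. R i)"
  have "card (\<Union>i<N. R i) \<le> (\<Sum>i<N. card (R i))" by (rule card_UN_le) simp
  also have "\<dots> \<le> (\<Sum>i<N. r)" using R by (intro sum_mono) auto
  finally have "card ?U \<le> card U0 + N * r" using card_Un_le[of U0 "\<Union>i<N. R i"] by simp
  then have "card ?U \<le> c" using Suc.prems(3) by simp
  moreover have "finite ?U" using R Suc.prems by auto
  ultimately obtain T where T: "finite T \<and> card T \<le> r \<and> T \<inter> ?U = {} \<and> P N T"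
    using Suc.prems(1)[of N ?U] by blast
  show ?case
    apply (rule exI[of _ "R(N := T)"])
    using R T by (auto simp: less_Suc_eq)
qed

text \<open>
To find a cycle it suffices to find its \<open>core\<close>: small sets with the right intersection pattern,
each of which extends to an edge by new vertices that avoid any given bounded set.
\<close>

lemma expand_cores:
  assumes pat: "cyclic_pattern k core"
    and ext: "\<And>i U. i < k \<Longrightarrow> finite U \<Longrightarrow> card U \<le> c \<Longrightarrow>
             \<exists>R. finite R \<and> card R \<le> r \<and> R \<inter> U = {} \<and> core i \<union> R \<in> H"
    and core: "\<And>i. i < k \<Longrightarrow> finite (core i) \<and> card (core i) \<le> r"
    and c: "2 * r * k \<le> c"
  shows "has_cycle k H"
proof -
  let ?U = "\<Union>i<k. core i"
  have "card ?U \<le> (\<Sum>i<k. card (core i))" by (rule card_UN_le) simp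
  also have "\<dots> \<le> (\<Sum>i<k. r)" using core by (intro sum_mono) auto
  finally have "card ?U \<le> k * r" by simp
  moreover have "2 * r * k = k * r + k * r" by simp
  ultimately have "card ?U + k * r \<le> c" using c by linarith
  moreover have "finite ?U" using core by blast
  ultimately obtain R where R: "\<forall>i<k. finite (R i) \<and> card (R i) \<le> r \<and> R i \<inter> ?U = {} \<and> core i \<union> R i \<in> H \<and> (\<forall>j<i. R i \<inter> R j = {})"
    using greedy_disjoint_choice[of k c r "\<lambda>i R. core i \<union> R \<in> H" ?U, OF ext] by blast
  have "(core i \<union> R i) \<inter> (core j \<union> R j) = core i \<inter> core j" if "i < j" "j < k" for i j
  proof -
    have i: "i < k" using that by simp
    note Ri = R[THEN spec, THEN mp, OF i] and Rj = R[THEN spec, THEN mp, OF that(2)]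
    have "R j \<inter> R i = {}" using Rj that(1) by simp
    moreover have "core i \<subseteq> ?U" "core j \<subseteq> ?U" using that(2) i by blast+
    moreover have "R i \<inter> ?U = {}" "R j \<inter> ?U = {}" using Ri Rj by simp_all
    ultimately have d: "R i \<inter> R j = {}" "R i \<inter> core j = {}" "core i \<inter> R j = {}" by fast+
    show ?thesis unfolding Int_Un_distrib Int_Un_distrib2 d by simp
  qed
  then have "cyclic_pattern k (\<lambda>i. core i \<union> R i)"
    using pat unfolding cyclic_pattern_def by simp
  moreover have "\<forall>i<k. core i \<union> R i \<in> H" using R by simp
  ultimately show ?thesis unfolding has_cycle_def by (intro exI[of _ "\<lambda>i. core i \<union> R i"]) simp
qed

definition nbr :: "'a set set \<Rightarrow> 'a set \<Rightarrow> 'a set" where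
  "nbr H S = {v. v \<notin> S \<and> insert v S \<in> H}"

text \<open>
The minimum of the numbers of extensions, over all \<open>(r - 1)\<close>-sets that have an extension, is at
least \<open>d\<close>.
\<close>

definition full :: "nat \<Rightarrow> 'a set set \<Rightarrow> bool" where
  "full d H \<longleftrightarrow> (\<forall>e\<in>H. \<forall>v\<in>e. d \<le> card (nbr H (e - {v})))"

lemma nbr_mono: "H \<subseteq> H' \<Longrightarrow> nbr H S \<subseteq> nbr H' S"
  unfolding nbr_def by auto

lemma nbr_subset: "H \<subseteq> nsets V r \<Longrightarrow> nbr H S \<subseteq> V"
  unfolding nbr_def nsets_def by auto

lemma finite_nbr: "H \<subseteq> nsets V r \<Longrightarrow> finite V \<Longrightarrow> finite (nbr H S)"
  using nbr_subset finite_subset by metis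

text \<open>
Vertices of an edge outside \<open>C\<close> that lie in \<open>U\<close> are exchanged one at a time.
\<close>

lemma full_extend:
  assumes full: "full d H" and H: "H \<subseteq> nsets V r" "finite V"
    and e: "e \<in> H" "C \<subseteq> e" and U: "finite U" "card U < d"
  shows "\<exists>e'\<in>H. C \<subseteq> e' \<and> (e' - C) \<inter> U = {}"
  using e
proof (induction "card ((e - C) \<inter> U)" arbitrary: e rule: less_induct)
  case less
  show ?case
  proof (cases "(e - C) \<inter> U = {}")
    case True
    then show ?thesis using less.prems by blast
  next
    case False
    then obtain v where v: "v \<in> e" "v \<notin> C" "v \<in> U" by blast
    have "d \<le> card (nbr H (e - {v}))" using full less.prems v unfolding full_def by blast
    then have "\<not> nbr H (e - {v}) \<subseteq> U" using U card_mono[of U "nbr H (e - {v})"] by auto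
    then obtain w where w: "w \<in> nbr H (e - {v})" "w \<notin> U" by blast
    let ?e = "insert w (e - {v})"
    have "finite e" using less.prems H unfolding nsets_def by auto
    have "(?e - C) \<inter> U \<subseteq> (e - C) \<inter> U" "v \<in> (e - C) \<inter> U" "v \<notin> (?e - C) \<inter> U" using v w by auto
    then have "(?e - C) \<inter> U \<subset> (e - C) \<inter> U" by blast
    then have "card ((?e - C) \<inter> U) < card ((e - C) \<inter> U)"
      using U by (intro psubset_card_mono) auto
    moreover have "?e \<in> H" using w unfolding nbr_def by auto
    ultimately show ?thesis using less.hyps[of ?e] less.prems v by blast
  qed
qed

text \<open>
A cycle of pairs, each contained in an edge, is lengthened by replacing its last pair by two
pairs through a new vertex of an edge containing that pair; this uses \<open>r \<ge> 3\<close>.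
\<close>

lemma full_shadow_cycle:
  assumes full: "full d H" and H: "H \<subseteq> nsets V r" "finite V" and r: "3 \<le> r"
    and ne: "H \<noteq> {}" and j: "1 \<le> j" "Suc j < d"
  shows "\<exists>p. inj_on p {..j} \<and> (\<forall>i<j. \<exists>e\<in>H. {p i, p (Suc i)} \<subseteq> e) \<and> (\<exists>e\<in>H. {p j, p 0} \<subseteq> e)"
  using j
proof (induction j rule: nat_induct_at_least)
  case base
  obtain e where e: "e \<in> H" using ne by blast
  then have "card e = r" "finite e" using H unfolding nsets_def by auto
  then obtain a b where "a \<in> e" "b \<in> e" "a \<noteq> b"
    using r card_le_Suc0_iff_eq[of e] by auto
  then show ?case using e
    by (intro exI[of _ "\<lambda>i. if i = 0 then a else b"]) (auto simp: inj_on_def)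
next
  case (Suc j)
  obtain p where p: "inj_on p {..j}" "\<forall>i<j. \<exists>e\<in>H. {p i, p (Suc i)} \<subseteq> e" "\<exists>e\<in>H. {p j, p 0} \<subseteq> e"
    using Suc by auto
  obtain e where e: "e \<in> H" "{p j, p 0} \<subseteq> e" using p by blast
  have "card (p ` {..j}) < d" using card_image[OF p(1)] Suc.prems by simp
  then obtain e' where e': "e' \<in> H" "{p j, p 0} \<subseteq> e'" "(e' - {p j, p 0}) \<inter> p ` {..j} = {}"
    using full_extend[OF full H e, of "p ` {..j}"] by auto
  have "card e' = r" using e' H unfolding nsets_def by auto
  moreover have "card {p j, p 0} \<le> 2" by (simp add: card_insert_if)
  ultimately have "\<not> e' \<subseteq> {p j, p 0}" using r card_mono[of "{p j, p 0}" e'] by fastforce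
  then obtain w where w: "w \<in> e'" "w \<notin> {p j, p 0}" by blast
  then have "w \<notin> p ` {..j}" using e' by blast
  show ?case
  proof (intro exI conjI)
    show "inj_on (p(Suc j := w)) {..Suc j}"
      using p(1) \<open>w \<notin> p ` {..j}\<close> by (auto simp: inj_on_def atMost_Suc)
    show "\<forall>i<Suc j. \<exists>e\<in>H. {(p(Suc j := w)) i, (p(Suc j := w)) (Suc i)} \<subseteq> e"
      using p(2) e' w by (auto simp: less_Suc_eq)
    show "\<exists>e\<in>H. {(p(Suc j := w)) (Suc j), (p(Suc j := w)) 0} \<subseteq> e"
      using e' w by auto
  qed
qed

lemma full_has_cycle:
  assumes full: "full d H" and H: "H \<subseteq> nsets V r" "finite V" and r: "3 \<le> r" and k: "4 \<le> k"
    and ne: "H \<noteq> {}" and d: "2 * r * k < d"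
  shows "has_cycle k H"
proof -
  have "1 * k \<le> 2 * r * k" using r by (intro mult_le_mono) auto
  then have k1: "1 \<le> k - 1" "Suc (k - 1) < d" using k d by linarith+
  obtain p where p: "inj_on p {..k-1}" "\<forall>i<k-1. \<exists>e\<in>H. {p i, p (Suc i)} \<subseteq> e"
      "\<exists>e\<in>H. {p (k-1), p 0} \<subseteq> e"
    using full_shadow_cycle[OF full H r ne k1] by blast
  define core where "core i = {p i, p (if Suc i = k then 0 else Suc i)}" for i
  have pin: "p i = p j \<longleftrightarrow> i = j" if "i < k" "j < k" for i j
  proof -
    have "i \<in> {..k-1}" "j \<in> {..k-1}" using that by auto
    then show ?thesis using inj_on_eq_iff[OF p(1)] by blast
  qed
  have sub: "\<exists>e\<in>H. core i \<subseteq> e" if "i < k" for i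
    using p(2,3) that by (cases "Suc i = k") (auto simp: core_def)
  have "cyclic_pattern k core"
    unfolding cyclic_pattern_def
  proof (intro allI impI)
    fix i j assume ij: "i < j" "j < k"
    show "(core i \<inter> core j \<noteq> {}) = (j = Suc i \<or> i = 0 \<and> Suc j = k)"
      using ij pin[of i j] pin[of i "if Suc j = k then 0 else Suc j"] pin[of "Suc i" j]
        pin[of "Suc i" "if Suc j = k then 0 else Suc j"] k
      by (auto simp: core_def split: if_splits)
  qed
  moreover have "\<exists>R. finite R \<and> card R \<le> r \<and> R \<inter> U = {} \<and> core i \<union> R \<in> H"
    if iU: "i < k" "finite U" "card U \<le> 2 * r * k" for i U
  proof -
    obtain e where "e \<in> H" "core i \<subseteq> e" using sub iU by blast
    then obtain e' where e': "e' \<in> H" "core i \<subseteq> e'" "(e' - core i) \<inter> U = {}"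
      using full_extend[OF full H, of e "core i" U] iU d by auto
    have fe: "finite e'" "card e' = r" using e' H unfolding nsets_def by auto
    have "core i \<union> (e' - core i) = e'" using e' by blast
    then show ?thesis using e' fe by (intro exI[of _ "e' - core i"]) (auto intro: order_trans[OF card_mono[of e']])
  qed
  moreover have "finite (core i) \<and> card (core i) \<le> r" for i
    using r by (auto simp: core_def card_insert_if)
  ultimately show ?thesis by (rule expand_cores) auto
qed

text \<open>
While some \<open>(r - 1)\<close>-set has between \<open>1\<close> and \<open>t\<close> extensions, the edges through it are deleted. Every
\<open>(r - 1)\<close>-set is treated at most once, and it pays for at most \<open>t\<close> edges and for at most as many as
contain it.
\<close>

lemma peel:
  assumes "H \<subseteq> nsets V r" "finite V" "0 < r"
  shows "\<exists>F\<subseteq>H. full (Suc t) F \<and> card H \<le> card F + (\<Sum>S\<in>nsets V (r-1). min t (card (nbr H S)))"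
  using assms(1)
proof (induction "card H" arbitrary: H rule: less_induct)
  case less
  have finH: "finite H" using less.prems finite_imp_finite_nsets[OF assms(2)] finite_subset by metis
  have finN: "finite (nsets V (r-1))" using finite_imp_finite_nsets[OF assms(2)] .
  show ?case
  proof (cases "full (Suc t) H")
    case True
    then show ?thesis by (intro exI[of _ H]) auto
  next
    case False
    then obtain e v where e: "e \<in> H" "v \<in> e" "card (nbr H (e - {v})) \<le> t"
      unfolding full_def by (auto simp: not_less_eq_eq)
    define S where "S = e - {v}"
    have ee: "finite e" "card e = r" "e \<subseteq> V" using e less.prems unfolding nsets_def by auto
    have S: "S \<in> nsets V (r-1)" using ee e unfolding S_def nsets_def by auto
    define H' where "H' = H - (\<lambda>w. insert w S) ` nbr H S"
    have del: "(\<lambda>w. insert w S) ` nbr H S \<subseteq> H" unfolding nbr_def by auto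
    have eS: "v \<in> nbr H S" using e unfolding S_def nbr_def by (auto simp: insert_absorb)
    have fN: "finite (nbr H S)" using finite_nbr[OF less.prems assms(2)] .
    have "inj_on (\<lambda>w. insert w S) (nbr H S)" unfolding inj_on_def nbr_def by auto
    then have "card ((\<lambda>w. insert w S) ` nbr H S) = card (nbr H S)" by (rule card_image)
    then have cH: "card H = card H' + card (nbr H S)" unfolding H'_def
      using card_Diff_subset[OF finite_imageI[OF fN] del] card_mono[OF finH del] by simp
    have "card (nbr H S) > 0" using eS fN by (auto simp: card_gt_0_iff)
    then have "card H' < card H" using cH by simp
    moreover have sub: "H' \<subseteq> H" unfolding H'_def by auto
    ultimately obtain F where F: "F \<subseteq> H'" "full (Suc t) F"
      "card H' \<le> card F + (\<Sum>S\<in>nsets V (r-1). min t (card (nbr H' S)))"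
      using less.hyps[of H'] less.prems by blast
    have empty: "nbr H' S = {}" unfolding H'_def nbr_def by auto
    have "(\<Sum>T\<in>nsets V (r-1). min t (card (nbr H' T))) = (\<Sum>T\<in>nsets V (r-1) - {S}. min t (card (nbr H' T)))"
      using sum.remove[OF finN S, of "\<lambda>T. min t (card (nbr H' T))"] empty by simp
    also have "\<dots> \<le> (\<Sum>T\<in>nsets V (r-1) - {S}. min t (card (nbr H T)))"
      by (intro sum_mono min.mono card_mono finite_nbr[OF less.prems assms(2)] nbr_mono sub order_refl)
    finally have "(\<Sum>T\<in>nsets V (r-1). min t (card (nbr H' T))) + card (nbr H S)
        \<le> (\<Sum>T\<in>nsets V (r-1). min t (card (nbr H T)))"
      using sum.remove[OF finN S, of "\<lambda>T. min t (card (nbr H T))"] e(3) unfolding S_def by simp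
    then show ?thesis using F sub cH by (intro exI[of _ F]) auto
  qed
qed

lemma card_nsets: "finite A \<Longrightarrow> card (nsets A m) = card A choose m"
  unfolding nsets_def using n_subsets[of A m]
  by (metis (no_types, lifting) Collect_cong finite_subset)

text \<open>
A full hypergraph without a cycle is empty, so the peeling process deletes everything.
\<close>

lemma cycle_free_card_le_shadow:
  assumes "H \<subseteq> nsets V r" "finite V" "3 \<le> r" "4 \<le> k" "\<not> has_cycle k H"
  shows "card H \<le> (2*r*k) * card {S\<in>nsets V (r-1). nbr H S \<noteq> {}}"
proof -
  obtain F where F: "F \<subseteq> H" "full (Suc (2*r*k)) F"
     "card H \<le> card F + (\<Sum>S\<in>nsets V (r-1). min (2*r*k) (card (nbr H S)))"
    using peel[OF assms(1,2), of "2*r*k"] assms(3) by auto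
  have "F = {}"
    using full_has_cycle[OF F(2) _ assms(2,3,4)] F(1) assms has_cycle_mono by blast
  have fin: "finite (nsets V (r-1))" using finite_imp_finite_nsets[OF assms(2)] .
  have "(\<Sum>S\<in>nsets V (r-1). min (2*r*k) (card (nbr H S))) \<le> (\<Sum>S\<in>nsets V (r-1). if nbr H S \<noteq> {} then 2*r*k else 0)"
    by (intro sum_mono) auto
  also have "\<dots> = (2*r*k) * card {S\<in>nsets V (r-1). nbr H S \<noteq> {}}"
    using fin by (simp add: sum.If_cases Int_def)
  finally show ?thesis using F(3) \<open>F = {}\<close> by simp
qed

section \<open>Boxes in dense families of tuples\<close>

definition glue :: "'i set \<Rightarrow> ('i \<Rightarrow> 'a) \<Rightarrow> ('i \<Rightarrow> 'a) \<Rightarrow> 'i \<Rightarrow> 'a" where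
  "glue A q h = (\<lambda>x. if x \<in> A then q x else h x)"

lemma glue_in: "x \<in> A \<Longrightarrow> glue A q h x = q x" and glue_out: "x \<notin> A \<Longrightarrow> glue A q h x = h x"
  by (auto simp: glue_def)

lemma finite_filter: "finite A \<Longrightarrow> finite {x \<in> A. P x}"
  by simp

lemma card_PiE_split:
  assumes fin: "finite A" "finite B" "finite V" and dis: "A \<inter> B = {}"
  shows "card {p \<in> (A \<union> B) \<rightarrow>\<^sub>E V. Q p} = (\<Sum>h\<in>B \<rightarrow>\<^sub>E V. card {q \<in> A \<rightarrow>\<^sub>E V. Q (glue A q h)})"
proof -
  let ?S = "SIGMA h:B \<rightarrow>\<^sub>E V. {q \<in> A \<rightarrow>\<^sub>E V. Q (glue A q h)}"
  have glue_PiE: "glue A q h \<in> (A \<union> B) \<rightarrow>\<^sub>E V" if "q \<in> A \<rightarrow>\<^sub>E V" "h \<in> B \<rightarrow>\<^sub>E V" for q h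
    using that dis by (auto simp: glue_def PiE_iff extensional_def)
  have inv: "glue A (restrict p A) (restrict p B) = p" if "p \<in> (A \<union> B) \<rightarrow>\<^sub>E V" for p
    using that by (auto simp: glue_def PiE_iff extensional_def restrict_def fun_eq_iff)
  have rA: "restrict (glue A q h) A = q" if "q \<in> A \<rightarrow>\<^sub>E V" for q h
    using that by (auto simp: glue_def PiE_iff extensional_def restrict_def fun_eq_iff)
  have rB: "restrict (glue A q h) B = h" if "h \<in> B \<rightarrow>\<^sub>E V" for q h
    using that dis by (auto simp: glue_def PiE_iff extensional_def restrict_def fun_eq_iff)
  have "bij_betw (\<lambda>p. (restrict p B, restrict p A)) {p \<in> (A \<union> B) \<rightarrow>\<^sub>E V. Q p} ?S"
  proof (rule bij_betw_byWitness[where f' = "\<lambda>(h, q). glue A q h"])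
    show "\<forall>p\<in>{p \<in> (A \<union> B) \<rightarrow>\<^sub>E V. Q p}. (case (restrict p B, restrict p A) of (h, q) \<Rightarrow> glue A q h) = p"
      using inv by simp
    show "\<forall>x\<in>?S. (restrict (case x of (h, q) \<Rightarrow> glue A q h) B, restrict (case x of (h, q) \<Rightarrow> glue A q h) A) = x"
      using rA rB by (auto split: prod.splits)
    show "(\<lambda>p. (restrict p B, restrict p A)) ` {p \<in> (A \<union> B) \<rightarrow>\<^sub>E V. Q p} \<subseteq> ?S"
    proof (rule image_subsetI)
      fix p assume "p \<in> {p \<in> (A \<union> B) \<rightarrow>\<^sub>E V. Q p}"
      then have p: "p \<in> (A \<union> B) \<rightarrow>\<^sub>E V" "Q p" by auto
      have "restrict p A \<in> A \<rightarrow>\<^sub>E V" "restrict p B \<in> B \<rightarrow>\<^sub>E V" using p(1) by (auto simp: PiE_iff)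
      then show "(restrict p B, restrict p A) \<in> ?S" using inv[OF p(1)] p(2) by simp
    qed
    show "(\<lambda>(h, q). glue A q h) ` ?S \<subseteq> {p \<in> (A \<union> B) \<rightarrow>\<^sub>E V. Q p}"
      using glue_PiE by auto
  qed
  then have "card {p \<in> (A \<union> B) \<rightarrow>\<^sub>E V. Q p} = card ?S" by (rule bij_betw_same_card)
  also have "\<dots> = (\<Sum>h\<in>B \<rightarrow>\<^sub>E V. card {q \<in> A \<rightarrow>\<^sub>E V. Q (glue A q h)})"
    using fin by (intro card_SigmaI ballI finite_filter finite_PiE)
  finally show ?thesis .
qed

text \<open>
A bound for the bad choices on \<open>J\<close>, uniform in the choices elsewhere, bounds the bad choices on \<open>I\<close>.
\<close>

lemma card_PiE_le_fibrewise:
  fixes \<mu> :: real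
  assumes fin: "finite I" "finite V" "J \<subseteq> I"
    and fib: "\<And>h. h \<in> (I - J) \<rightarrow>\<^sub>E V \<Longrightarrow> real (card {q \<in> J \<rightarrow>\<^sub>E V. Q (glue J q h)}) \<le> \<mu> * real (card V) ^ card J"
  shows "real (card {p \<in> I \<rightarrow>\<^sub>E V. Q p}) \<le> \<mu> * real (card V) ^ card I"
proof -
  have fJ: "finite J" using fin finite_subset by blast
  have I: "J \<union> (I - J) = I" using fin by blast
  have "card {p \<in> I \<rightarrow>\<^sub>E V. Q p} = (\<Sum>h\<in>(I - J) \<rightarrow>\<^sub>E V. card {q \<in> J \<rightarrow>\<^sub>E V. Q (glue J q h)})"
    using card_PiE_split[of J "I - J" V Q] fin fJ unfolding I by simp
  then have "real (card {p \<in> I \<rightarrow>\<^sub>E V. Q p}) = (\<Sum>h\<in>(I - J) \<rightarrow>\<^sub>E V. real (card {q \<in> J \<rightarrow>\<^sub>E V. Q (glue J q h)}))"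
    by simp
  also have "\<dots> \<le> (\<Sum>h\<in>(I - J) \<rightarrow>\<^sub>E V. \<mu> * real (card V) ^ card J)" by (rule sum_mono[OF fib])
  also have "\<dots> = real (card V) ^ card (I - J) * (\<mu> * real (card V) ^ card J)"
    using fin by (simp add: card_funcsetE)
  also have "\<dots> = \<mu> * (real (card V) ^ (card J + card (I - J)))"
    by (simp add: power_add)
  also have "card J + card (I - J) = card I"
    using fin fJ card_Diff_subset[of J I] card_mono[of I J] by simp
  finally show ?thesis .
qed

lemma card_bad_vertex:
  assumes fin: "finite I" "finite V" "j \<in> I" "V \<noteq> {}"
    and bnd: "\<And>h. h \<in> (I - {j}) \<rightarrow>\<^sub>E V \<Longrightarrow> finite (\<Psi> h) \<and> card (\<Psi> h) \<le> m"
    and bad: "\<And>q h. h \<in> (I - {j}) \<rightarrow>\<^sub>E V \<Longrightarrow> Q (glue {j} q h) \<Longrightarrow> q j \<in> \<Psi> h"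
  shows "real (card {p \<in> I \<rightarrow>\<^sub>E V. Q p}) \<le> (real m / real (card V)) * real (card V) ^ card I"
proof (rule card_PiE_le_fibrewise)
  fix h assume h: "h \<in> (I - {j}) \<rightarrow>\<^sub>E V"
  have "inj_on (\<lambda>q. q j) {q \<in> {j} \<rightarrow>\<^sub>E V. Q (glue {j} q h)}"
    by (rule inj_onI) (auto simp: PiE_iff extensional_def fun_eq_iff, metis)
  moreover have "(\<lambda>q. q j) ` {q \<in> {j} \<rightarrow>\<^sub>E V. Q (glue {j} q h)} \<subseteq> \<Psi> h" using bad[OF h] by auto
  ultimately have "card {q \<in> {j} \<rightarrow>\<^sub>E V. Q (glue {j} q h)} \<le> card (\<Psi> h)"
    using bnd[OF h] by (meson card_inj_on_le)
  then have "card {q \<in> {j} \<rightarrow>\<^sub>E V. Q (glue {j} q h)} \<le> m" using bnd[OF h] by linarith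
  then show "real (card {q \<in> {j} \<rightarrow>\<^sub>E V. Q (glue {j} q h)}) \<le> real m / real (card V) * real (card V) ^ card {j}"
    using fin by (simp add: card_eq_0_iff)
qed (use fin in auto)

lemma card_tuples_onto:
  assumes "finite D" "card D = s" "finite B" "\<And>S. S \<in> B \<Longrightarrow> finite S \<and> card S = s"
  shows "card {h \<in> D \<rightarrow>\<^sub>E V. h ` D \<in> B} \<le> s ^ s * card B"
proof -
  have "{h \<in> D \<rightarrow>\<^sub>E V. h ` D \<in> B} \<subseteq> (\<Union>S\<in>B. D \<rightarrow>\<^sub>E S)"
  proof
    fix h assume "h \<in> {h \<in> D \<rightarrow>\<^sub>E V. h ` D \<in> B}"
    then have "h ` D \<in> B" "h \<in> D \<rightarrow>\<^sub>E (h ` D)" by (auto simp: PiE_iff)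
    then show "h \<in> (\<Union>S\<in>B. D \<rightarrow>\<^sub>E S)" by blast
  qed
  moreover have "finite (\<Union>S\<in>B. D \<rightarrow>\<^sub>E S)" using assms by (auto intro!: finite_PiE)
  ultimately have "card {h \<in> D \<rightarrow>\<^sub>E V. h ` D \<in> B} \<le> card (\<Union>S\<in>B. D \<rightarrow>\<^sub>E S)" by (rule card_mono[rotated])
  also have "\<dots> \<le> (\<Sum>S\<in>B. card (D \<rightarrow>\<^sub>E S))" using assms by (intro card_UN_le)
  also have "\<dots> = (\<Sum>S\<in>B. s ^ s)" using assms by (intro sum.cong refl) (simp add: card_funcsetE)
  finally show ?thesis by (simp add: mult.commute)
qed

lemma card_bad_tuple:
  fixes \<mu> :: real
  assumes fin: "finite I" "finite V" "D \<subseteq> I" "card D = s"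
    and bnd: "\<And>h. h \<in> (I - D) \<rightarrow>\<^sub>E V \<Longrightarrow> \<Psi> h \<subseteq> nsets V s \<and> real (card (\<Psi> h)) \<le> \<mu> * real (card V) ^ s"
    and bad: "\<And>q h. h \<in> (I - D) \<rightarrow>\<^sub>E V \<Longrightarrow> Q (glue D q h) \<Longrightarrow> q ` D \<in> \<Psi> h"
  shows "real (card {p \<in> I \<rightarrow>\<^sub>E V. Q p}) \<le> (real (s ^ s) * \<mu>) * real (card V) ^ card I"
proof (rule card_PiE_le_fibrewise)
  fix h assume h: "h \<in> (I - D) \<rightarrow>\<^sub>E V"
  have fD: "finite D" using fin finite_subset by blast
  have f\<Psi>: "finite (\<Psi> h)" using bnd[OF h] finite_imp_finite_nsets[OF fin(2)] finite_subset by metis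
  have "{q \<in> D \<rightarrow>\<^sub>E V. Q (glue D q h)} \<subseteq> {q \<in> D \<rightarrow>\<^sub>E V. q ` D \<in> \<Psi> h}" using bad[OF h] by auto
  moreover have "finite {q \<in> D \<rightarrow>\<^sub>E V. q ` D \<in> \<Psi> h}" using fD fin by (intro finite_filter finite_PiE)
  ultimately have "card {q \<in> D \<rightarrow>\<^sub>E V. Q (glue D q h)} \<le> card {q \<in> D \<rightarrow>\<^sub>E V. q ` D \<in> \<Psi> h}"
    by (rule card_mono[rotated])
  also have "\<dots> \<le> s ^ s * card (\<Psi> h)"
    using bnd[OF h] by (intro card_tuples_onto fD fin f\<Psi>) (auto simp: nsets_def)
  finally have "real (card {q \<in> D \<rightarrow>\<^sub>E V. Q (glue D q h)}) \<le> real (s ^ s) * real (card (\<Psi> h))"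
    by (simp only: of_nat_mult[symmetric] of_nat_le_iff)
  also have "\<dots> \<le> real (s ^ s) * (\<mu> * real (card V) ^ s)" using bnd[OF h] by (intro mult_left_mono) auto
  finally show "real (card {q \<in> D \<rightarrow>\<^sub>E V. Q (glue D q h)}) \<le> real (s ^ s) * \<mu> * real (card V) ^ card D"
    using fin by simp
qed (use fin in auto)

text \<open>
The graph of the power function lies above its tangents; summing over the tangent at the mean
gives the power mean inequality.
\<close>

lemma power_tangent:
  fixes x m :: real
  assumes "0 \<le> x" "0 \<le> m"
  shows "m ^ Suc q + real (Suc q) * m ^ q * (x - m) \<le> x ^ Suc q"
proof (induction q)
  case 0 then show ?case by simp
next
  case (Suc q)
  have "0 \<le> real (Suc q) * m ^ q * ((x - m) * (x - m))" using assms by simp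
  then have "m ^ Suc (Suc q) + real (Suc (Suc q)) * m ^ Suc q * (x - m)
      \<le> x * (m ^ Suc q + real (Suc q) * m ^ q * (x - m))"
    by (simp add: algebra_simps)
  also have "\<dots> \<le> x * x ^ Suc q" using Suc assms by (intro mult_left_mono) auto
  finally show ?case by simp
qed

lemma power_mean_le:
  fixes f :: "'b \<Rightarrow> real"
  assumes "finite A" "A \<noteq> {}" "\<And>x. x \<in> A \<Longrightarrow> 0 \<le> f x"
  shows "real (card A) * ((\<Sum>x\<in>A. f x) / real (card A)) ^ q \<le> (\<Sum>x\<in>A. f x ^ q)"
proof (cases q)
  case 0 then show ?thesis by simp
next
  case (Suc p)
  let ?m = "(\<Sum>x\<in>A. f x) / real (card A)"
  have c: "real (card A) > 0" using assms by (simp add: card_gt_0_iff)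
  have m: "0 \<le> ?m" using assms by (simp add: sum_nonneg)
  have "real (card A) * ?m ^ q = (\<Sum>x\<in>A. ?m ^ q) + real q * ?m ^ p * ((\<Sum>x\<in>A. f x) - real (card A) * ?m)"
    using c by simp
  also have "\<dots> = (\<Sum>x\<in>A. ?m ^ Suc p + real (Suc p) * ?m ^ p * (f x - ?m))"
    unfolding Suc by (simp add: sum.distrib sum_subtractf sum_distrib_left[symmetric] sum_distrib_right[symmetric])
  also have "\<dots> \<le> (\<Sum>x\<in>A. f x ^ Suc p)" using assms m by (intro sum_mono power_tangent) auto
  finally show ?thesis unfolding Suc .
qed

lemma sum_card_swap:
  assumes "finite P" "finite W"
  shows "(\<Sum>h\<in>P. card {w \<in> W. R w h}) = (\<Sum>w\<in>W. card {h \<in> P. R w h})"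
proof -
  have "(\<Sum>h\<in>P. card {w \<in> W. R w h}) = (\<Sum>h\<in>P. \<Sum>w\<in>W. if R w h then 1 else 0)"
    using assms by (simp add: sum.If_cases Int_def)
  also have "\<dots> = (\<Sum>w\<in>W. \<Sum>h\<in>P. if R w h then 1 else 0)" by (rule sum.swap)
  also have "\<dots> = (\<Sum>w\<in>W. card {h \<in> P. R w h})"
    using assms by (simp add: sum.If_cases Int_def)
  finally show ?thesis .
qed

definition cell :: "(nat \<times> nat \<Rightarrow> 'a) \<Rightarrow> (nat \<Rightarrow> nat) \<Rightarrow> nat \<Rightarrow> 'a list" where
  "cell p g \<sigma> = map (\<lambda>i. p (i, g i)) [0..<\<sigma>]"

text \<open>
The number of \<open>t\<close>-fold boxes in a family of \<open>\<sigma>\<close>-tuples is at least what one expects in a random family of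
the same density. The induction on \<open>\<sigma>\<close> uses convexity twice: once for the number of ways to extend a
shorter tuple by \<open>t\<close> last entries, and once for the densities of the families \<open>Gh h\<close> of those shorter
tuples that all entries of \<open>h\<close> extend.
\<close>

lemma box_count:
  assumes V: "finite V" "V \<noteq> {}" and G: "G \<subseteq> {w. length w = \<sigma> \<and> set w \<subseteq> V}"
  shows "(real (card G) / real (card V) ^ \<sigma>) ^ (t ^ \<sigma>) * real (card V) ^ (\<sigma> * t)
     \<le> real (card {p \<in> ({..<\<sigma>} \<times> {..<t}) \<rightarrow>\<^sub>E V. \<forall>g. (\<forall>i<\<sigma>. g i < t) \<longrightarrow> cell p g \<sigma> \<in> G})"
  using G
proof (induction \<sigma> arbitrary: G)
  case 0
  then have "G = {} \<or> G = {[]}" by auto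
  then show ?case by (auto simp: cell_def)
next
  case (Suc \<sigma>)
  let ?n = "real (card V)"
  let ?A = "{..<\<sigma>} \<times> {..<t}" and ?B = "{\<sigma>} \<times> {..<t}"
  let ?W = "{w. length w = \<sigma> \<and> set w \<subseteq> V}"
  let ?D = "\<lambda>w. {v \<in> V. w @ [v] \<in> G}"
  define Gh where "Gh h = {w \<in> ?W. \<forall>j<t. w @ [h (\<sigma>, j)] \<in> G}" for h :: "nat \<times> nat \<Rightarrow> 'a"
  have n: "?n > 0" using V by (simp add: card_gt_0_iff)
  have W: "?W = {xs. set xs \<subseteq> V \<and> length xs = \<sigma>}" by auto
  have finW: "finite ?W" unfolding W using V by (intro finite_lists_length_eq)
  have cardW: "card ?W = card V ^ \<sigma>" unfolding W using V by (intro card_lists_length_eq)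
  have "replicate \<sigma> (SOME v. v \<in> V) \<in> ?W" using V some_in_eq by (auto simp: set_replicate_conv_if)
  then have neW: "?W \<noteq> {}" by blast
  have finP: "finite (?B \<rightarrow>\<^sub>E V)" using V by (intro finite_PiE) auto
  have cardP: "card (?B \<rightarrow>\<^sub>E V) = card V ^ t" using V by (simp add: card_funcsetE card_cartesian_product)
  have neP: "?B \<rightarrow>\<^sub>E V \<noteq> {}" using V by (simp add: PiE_eq_empty_iff)
  have AB: "?A \<union> ?B = {..<Suc \<sigma>} \<times> {..<t}" by auto
  have dW: "(\<Sum>w\<in>?W. card (?D w)) = card G"
  proof -
    have "bij_betw (\<lambda>(w, v). w @ [v]) (SIGMA w:?W. ?D w) G"
      unfolding bij_betw_def
    proof
      show "inj_on (\<lambda>(w, v). w @ [v]) (SIGMA w:?W. ?D w)" by (auto simp: inj_on_def)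
      show "(\<lambda>(w, v). w @ [v]) ` (SIGMA w:?W. ?D w) = G"
      proof
        show "G \<subseteq> (\<lambda>(w, v). w @ [v]) ` (SIGMA w:?W. ?D w)"
        proof
          fix x assume x: "x \<in> G"
          then have "length x = Suc \<sigma>" "set x \<subseteq> V" using Suc.prems by auto
          then obtain w v where wv: "x = w @ [v]" "length w = \<sigma>"
            by (metis length_Suc_conv_rev)
          then have "(w, v) \<in> (SIGMA w:?W. ?D w)" using x \<open>set x \<subseteq> V\<close> by auto
          then show "x \<in> (\<lambda>(w, v). w @ [v]) ` (SIGMA w:?W. ?D w)" using wv(1) by force
        qed
      qed auto
    qed
    then have "card (SIGMA w:?W. ?D w) = card G" by (rule bij_betw_same_card)
    then show ?thesis using card_SigmaI[OF finW, of ?D] V by simp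
  qed
  have sumG: "(\<Sum>h\<in>?B \<rightarrow>\<^sub>E V. card (Gh h)) = (\<Sum>w\<in>?W. card (?D w) ^ t)"
  proof -
    have "(\<Sum>h\<in>?B \<rightarrow>\<^sub>E V. card (Gh h)) = (\<Sum>w\<in>?W. card {h \<in> ?B \<rightarrow>\<^sub>E V. \<forall>j<t. w @ [h (\<sigma>, j)] \<in> G})"
      unfolding Gh_def by (rule sum_card_swap[OF finP finW])
    also have "\<dots> = (\<Sum>w\<in>?W. card (?D w) ^ t)"
    proof (rule sum.cong[OF refl])
      fix w assume "w \<in> ?W"
      have "{h \<in> ?B \<rightarrow>\<^sub>E V. \<forall>j<t. w @ [h (\<sigma>, j)] \<in> G} = ?B \<rightarrow>\<^sub>E ?D w"
      proof (rule set_eqI)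
        fix h :: "nat \<times> nat \<Rightarrow> 'a"
        have B: "(\<forall>x\<in>?B. P (h x)) \<longleftrightarrow> (\<forall>j<t. P (h (\<sigma>, j)))" for P by blast
        show "h \<in> {h \<in> ?B \<rightarrow>\<^sub>E V. \<forall>j<t. w @ [h (\<sigma>, j)] \<in> G} \<longleftrightarrow> h \<in> ?B \<rightarrow>\<^sub>E ?D w"
          unfolding mem_Collect_eq PiE_iff B[of "\<lambda>x. x \<in> V"] B[of "\<lambda>x. x \<in> ?D w"] by blast
      qed
      then show "card {h \<in> ?B \<rightarrow>\<^sub>E V. \<forall>j<t. w @ [h (\<sigma>, j)] \<in> G} = card (?D w) ^ t"
        using card_funcsetE[of ?B "?D w"] by (simp add: card_cartesian_product)
    qed
    finally show ?thesis .
  qed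
  have "?n ^ \<sigma> * (real (card G) / ?n ^ \<sigma>) ^ t \<le> (\<Sum>w\<in>?W. real (card (?D w)) ^ t)"
    using power_mean_le[OF finW neW, of "\<lambda>w. real (card (?D w))" t] cardW dW
    by (simp flip: of_nat_sum)
  also have "\<dots> = (\<Sum>h\<in>?B \<rightarrow>\<^sub>E V. real (card (Gh h)))"
    using sumG by (simp flip: of_nat_sum of_nat_power)
  finally have s1: "?n ^ \<sigma> * (real (card G) / ?n ^ \<sigma>) ^ t \<le> (\<Sum>h\<in>?B \<rightarrow>\<^sub>E V. real (card (Gh h)))" .
  \<comment> \<open>the mean density of the families \<open>Gh h\<close>\<close>
  let ?x = "(\<Sum>h\<in>?B \<rightarrow>\<^sub>E V. real (card (Gh h)) / ?n ^ \<sigma>) / ?n ^ t"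
  have "(real (card G) / ?n ^ Suc \<sigma>) ^ t = (real (card G) / ?n ^ \<sigma>) ^ t / ?n ^ t"
    by (simp add: power_divide power_mult_distrib field_simps)
  also have "\<dots> \<le> ?x"
    using s1 n by (simp add: divide_right_mono sum_divide_distrib[symmetric] field_simps)
  finally have s2: "(real (card G) / ?n ^ Suc \<sigma>) ^ t \<le> ?x" .
  have "(real (card G) / ?n ^ Suc \<sigma>) ^ (t ^ Suc \<sigma>) = ((real (card G) / ?n ^ Suc \<sigma>) ^ t) ^ (t ^ \<sigma>)"
    by (simp add: power_mult)
  also have "\<dots> \<le> ?x ^ (t ^ \<sigma>)" using s2 by (intro power_mono) auto
  finally have "?n ^ t * (real (card G) / ?n ^ Suc \<sigma>) ^ (t ^ Suc \<sigma>) \<le> ?n ^ t * ?x ^ (t ^ \<sigma>)"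
    using n by (intro mult_left_mono) auto
  also have "\<dots> \<le> (\<Sum>h\<in>?B \<rightarrow>\<^sub>E V. (real (card (Gh h)) / ?n ^ \<sigma>) ^ (t ^ \<sigma>))"
    using power_mean_le[OF finP neP, of "\<lambda>h. real (card (Gh h)) / ?n ^ \<sigma>" "t ^ \<sigma>"] cardP by simp
  finally have s3: "?n ^ t * (real (card G) / ?n ^ Suc \<sigma>) ^ (t ^ Suc \<sigma>)
     \<le> (\<Sum>h\<in>?B \<rightarrow>\<^sub>E V. (real (card (Gh h)) / ?n ^ \<sigma>) ^ (t ^ \<sigma>))" .
  let ?Q = "\<lambda>p. \<forall>g. (\<forall>i<Suc \<sigma>. g i < t) \<longrightarrow> cell p g (Suc \<sigma>) \<in> G"
  have fibre: "(real (card (Gh h)) / ?n ^ \<sigma>) ^ (t ^ \<sigma>) * ?n ^ (\<sigma> * t)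
      \<le> real (card {q \<in> ?A \<rightarrow>\<^sub>E V. ?Q (glue ?A q h)})" for h
  proof -
    have "{q \<in> ?A \<rightarrow>\<^sub>E V. \<forall>g. (\<forall>i<\<sigma>. g i < t) \<longrightarrow> cell q g \<sigma> \<in> Gh h} \<subseteq> {q \<in> ?A \<rightarrow>\<^sub>E V. ?Q (glue ?A q h)}"
    proof clarify
      fix q g assume q: "\<forall>g. (\<forall>i<\<sigma>. g i < t) \<longrightarrow> cell q g \<sigma> \<in> Gh h" and g: "\<forall>i<Suc \<sigma>. g i < t"
      have "cell (glue ?A q h) g (Suc \<sigma>) = cell q g \<sigma> @ [h (\<sigma>, g \<sigma>)]"
        using g by (auto simp: cell_def glue_def)
      moreover have "cell q g \<sigma> \<in> Gh h" "g \<sigma> < t" using q g by auto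
      ultimately show "cell (glue ?A q h) g (Suc \<sigma>) \<in> G" unfolding Gh_def by auto
    qed
    then have "card {q \<in> ?A \<rightarrow>\<^sub>E V. \<forall>g. (\<forall>i<\<sigma>. g i < t) \<longrightarrow> cell q g \<sigma> \<in> Gh h} \<le> card {q \<in> ?A \<rightarrow>\<^sub>E V. ?Q (glue ?A q h)}"
      using V by (intro card_mono finite_subset[OF _ finite_PiE[of ?A "\<lambda>_. V"]]) auto
    moreover have "Gh h \<subseteq> ?W" unfolding Gh_def by auto
    ultimately show ?thesis using Suc.IH[of "Gh h"] by linarith
  qed
  have "(real (card G) / ?n ^ Suc \<sigma>) ^ (t ^ Suc \<sigma>) * ?n ^ (Suc \<sigma> * t)
      = (?n ^ t * (real (card G) / ?n ^ Suc \<sigma>) ^ (t ^ Suc \<sigma>)) * ?n ^ (\<sigma> * t)"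
    by (simp add: power_add)
  also have "\<dots> \<le> (\<Sum>h\<in>?B \<rightarrow>\<^sub>E V. (real (card (Gh h)) / ?n ^ \<sigma>) ^ (t ^ \<sigma>)) * ?n ^ (\<sigma> * t)"
    using s3 n by (intro mult_right_mono) auto
  also have "\<dots> = (\<Sum>h\<in>?B \<rightarrow>\<^sub>E V. (real (card (Gh h)) / ?n ^ \<sigma>) ^ (t ^ \<sigma>) * ?n ^ (\<sigma> * t))"
    by (rule sum_distrib_right)
  also have "\<dots> \<le> (\<Sum>h\<in>?B \<rightarrow>\<^sub>E V. real (card {q \<in> ?A \<rightarrow>\<^sub>E V. ?Q (glue ?A q h)}))"
    by (rule sum_mono[OF fibre])
  also have "\<dots> = real (card {p \<in> (?A \<union> ?B) \<rightarrow>\<^sub>E V. ?Q p})"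
  proof -
    have "card {p \<in> (?A \<union> ?B) \<rightarrow>\<^sub>E V. ?Q p} = (\<Sum>h\<in>?B \<rightarrow>\<^sub>E V. card {q \<in> ?A \<rightarrow>\<^sub>E V. ?Q (glue ?A q h)})"
      by (rule card_PiE_split) (use V in auto)
    then show ?thesis by (simp only: of_nat_sum)
  qed
  finally show ?case unfolding AB .
qed

lemma card_UN_bound:
  assumes "finite K" "\<And>x. x \<in> K \<Longrightarrow> real (card (B x)) \<le> b"
  shows "real (card (\<Union>x\<in>K. B x)) \<le> real (card K) * b"
proof -
  have "real (card (\<Union>x\<in>K. B x)) \<le> real (\<Sum>x\<in>K. card (B x))"
    using card_UN_le[OF assms(1), of B] by (simp only: of_nat_le_iff)
  also have "\<dots> \<le> (\<Sum>x\<in>K. b)" unfolding of_nat_sum using assms by (intro sum_mono) auto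
  finally show ?thesis by simp
qed

text \<open>
\<open>X\<close> is a family of sets that contains almost all \<open>s\<close>-sets, \<open>Col\<close> assigns to an \<open>s\<close>-set its colours, and \<open>A\<close>
assigns to it those colours that are rare.
\<close>

definition good_box :: "nat \<Rightarrow> 'i set \<Rightarrow> 'a set set \<Rightarrow> ('a set \<Rightarrow> 'a set) \<Rightarrow> ('a set \<Rightarrow> 'a set) \<Rightarrow> 'a set \<Rightarrow> ('i \<Rightarrow> 'a) \<Rightarrow> bool" where
  "good_box s I X Col A Y p \<longleftrightarrow> inj_on p I \<and> p ` I \<inter> Y = {} \<and>
     (\<forall>S\<in>nsets (p ` I) s. S \<in> X \<and> Col S \<inter> p ` I = {} \<and>
        (\<forall>S'\<in>nsets (p ` I) s. S \<inter> S' = {} \<longrightarrow> Col S \<inter> A S' = {}))"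

text \<open>
A map that violates one of the conditions satisfies one of boundedly many events: two entries
agree, an entry is in \<open>Y\<close> or is a colour of a tuple of other entries, a tuple is not in \<open>X\<close>, or two
disjoint tuples share a rare colour. The first three fix a vertex up to \<open>m\<close> possibilities and have
density \<open>O(1/n)\<close>; the others confine a tuple to a family of density \<open>O(\<epsilon>)\<close>.
\<close>

lemma card_not_good_box:
  fixes \<epsilon> :: real and I :: "'i set" and V :: "'a set"
  assumes fin: "finite I" "finite V" "V \<noteq> {}" and \<epsilon>: "0 \<le> \<epsilon>"
    and X: "real (card (nsets V s - X)) \<le> \<epsilon> * real (card V) ^ s"
    and Col: "\<And>S. S \<in> nsets V s \<Longrightarrow> finite (Col S) \<and> card (Col S) \<le> m \<and> Col S \<inter> S = {}"
    and A: "\<And>c. real (card {S \<in> nsets V s. c \<in> A S}) \<le> \<epsilon> * real (card V) ^ s"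
    and Y: "finite Y" "card Y \<le> m"
  defines "a \<equiv> real (card I)" and "c \<equiv> real (card (nsets I s))"
  shows "real (card {p \<in> I \<rightarrow>\<^sub>E V. \<not> good_box s I X Col A Y p})
    \<le> ((a * a + a * m + c * a * m) / real (card V) + (c * s ^ s + c * c * (s ^ s * m)) * \<epsilon>) * real (card V) ^ card I"
proof -
  let ?n = "real (card V)" let ?N = "?n ^ card I" let ?D = "nsets I s"
  have n: "?n > 0" using fin by (simp add: card_gt_0_iff)
  have finD: "finite ?D" using finite_imp_finite_nsets[OF fin(1)] .
  have D: "D \<subseteq> I" "finite D" "card D = s" if "D \<in> ?D" for D using that unfolding nsets_def by auto
  have img: "glue D' q h ` D = h ` D" if "D \<inter> D' = {}" for D D' and q h :: "'i \<Rightarrow> 'a"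
    using that by (intro image_cong refl glue_out) auto
  have img': "glue D q h ` D = q ` D" for D and q h :: "'i \<Rightarrow> 'a"
    by (intro image_cong refl glue_in)
  define E1 where "E1 = (\<lambda>(i, j). {p \<in> I \<rightarrow>\<^sub>E V. i \<noteq> j \<and> p i = p j})"
  define E2 where "E2 = (\<lambda>j. {p \<in> I \<rightarrow>\<^sub>E V. p j \<in> Y})"
  define E3 where "E3 = (\<lambda>D. {p \<in> I \<rightarrow>\<^sub>E V. p ` D \<in> nsets V s - X})"
  define E4 where "E4 = (\<lambda>(D, j). {p \<in> I \<rightarrow>\<^sub>E V. j \<notin> D \<and> p ` D \<in> nsets V s \<and> p j \<in> Col (p ` D)})"
  define E5 where "E5 = (\<lambda>(D, D'). {p \<in> I \<rightarrow>\<^sub>E V. D \<inter> D' = {} \<and> p ` D \<in> nsets V s \<and> p ` D' \<in> nsets V s \<and> Col (p ` D) \<inter> A (p ` D') \<noteq> {}})"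
  have b1: "real (card (E1 x)) \<le> 1 / ?n * ?N" if x: "x \<in> I \<times> I" for x
  proof -
    obtain i j where ij: "x = (i, j)" "i \<in> I" "j \<in> I" using x by blast
    have "real (card {p \<in> I \<rightarrow>\<^sub>E V. i \<noteq> j \<and> p i = p j}) \<le> real 1 / ?n * ?N"
    proof (rule card_bad_vertex[where \<Psi> = "\<lambda>h. {h i}"])
      fix q h assume g: "i \<noteq> j \<and> glue {j} q h i = glue {j} q h j"
      then show "q j \<in> {h i}" by (auto simp: glue_def)
    qed (use fin ij in auto)
    then show ?thesis unfolding E1_def ij by simp
  qed
  have b2: "real (card (E2 j)) \<le> m / ?n * ?N" if "j \<in> I" for j
    unfolding E2_def
  proof (rule card_bad_vertex[where \<Psi> = "\<lambda>h. Y"])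
    show "q j \<in> Y" if "glue {j} q h j \<in> Y" for q h using that by (simp add: glue_in)
  qed (use fin Y that in auto)
  have b3: "real (card (E3 D)) \<le> real (s ^ s) * \<epsilon> * ?N" if "D \<in> ?D" for D
    unfolding E3_def
  proof (rule card_bad_tuple[where \<Psi> = "\<lambda>h. nsets V s - X"])
    show "q ` D \<in> nsets V s - X" if "glue D q h ` D \<in> nsets V s - X" for q h
      using that unfolding img' .
  qed (use fin D[OF that] X in auto)
  have b4: "real (card (E4 x)) \<le> m / ?n * ?N" if x: "x \<in> ?D \<times> I" for x
  proof -
    obtain D j where Dj: "x = (D, j)" "D \<in> ?D" "j \<in> I" using x by blast
    have "real (card {p \<in> I \<rightarrow>\<^sub>E V. j \<notin> D \<and> p ` D \<in> nsets V s \<and> p j \<in> Col (p ` D)}) \<le> m / ?n * ?N"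
    proof (rule card_bad_vertex[where \<Psi> = "\<lambda>h. if h ` D \<in> nsets V s then Col (h ` D) else {}"])
      show "finite (if h ` D \<in> nsets V s then Col (h ` D) else {}) \<and>
            card (if h ` D \<in> nsets V s then Col (h ` D) else {}) \<le> m" for h
        using Col[of "h ` D"] by simp
      fix q h assume g: "j \<notin> D \<and> glue {j} q h ` D \<in> nsets V s \<and> glue {j} q h j \<in> Col (glue {j} q h ` D)"
      then have 1: "glue {j} q h ` D = h ` D" by (intro img) auto
      show "q j \<in> (if h ` D \<in> nsets V s then Col (h ` D) else {})"
        using g unfolding 1 by (simp add: glue_in)
    qed (use fin Dj in auto)
    then show ?thesis unfolding E4_def Dj by simp
  qed
  have b5: "real (card (E5 x)) \<le> real (s ^ s) * (m * \<epsilon>) * ?N" if x: "x \<in> ?D \<times> ?D" for x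
  proof -
    obtain D D' where DD: "x = (D, D')" "D \<in> ?D" "D' \<in> ?D" using x by blast
    have "real (card {p \<in> I \<rightarrow>\<^sub>E V. D \<inter> D' = {} \<and> p ` D \<in> nsets V s \<and> p ` D' \<in> nsets V s \<and> Col (p ` D) \<inter> A (p ` D') \<noteq> {}})
        \<le> real (s ^ s) * (m * \<epsilon>) * ?N"
    proof (rule card_bad_tuple[where \<Psi> = "\<lambda>h. if h ` D \<in> nsets V s then (\<Union>c\<in>Col (h ` D). {S \<in> nsets V s. c \<in> A S}) else {}"])
      fix h :: "'i \<Rightarrow> 'a"
      show "(if h ` D \<in> nsets V s then (\<Union>c\<in>Col (h ` D). {S \<in> nsets V s. c \<in> A S}) else {}) \<subseteq> nsets V s \<and>
        real (card (if h ` D \<in> nsets V s then (\<Union>c\<in>Col (h ` D). {S \<in> nsets V s. c \<in> A S}) else {})) \<le> m * \<epsilon> * ?n ^ s"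
      proof (cases "h ` D \<in> nsets V s")
        case True
        have "real (card (\<Union>c\<in>Col (h ` D). {S \<in> nsets V s. c \<in> A S})) \<le> real (card (Col (h ` D))) * (\<epsilon> * ?n ^ s)"
          using Col[OF True] A by (intro card_UN_bound) auto
        also have "\<dots> \<le> m * (\<epsilon> * ?n ^ s)" using Col[OF True] \<epsilon> n by (intro mult_right_mono) auto
        finally have "real (card (\<Union>c\<in>Col (h ` D). {S \<in> nsets V s. c \<in> A S})) \<le> m * \<epsilon> * ?n ^ s" by simp
        moreover have "(\<Union>c\<in>Col (h ` D). {S \<in> nsets V s. c \<in> A S}) \<subseteq> nsets V s" by blast
        ultimately show ?thesis using True by simp
      next
        case False then show ?thesis using \<epsilon> by simp
      qed
    next
      fix q h assume g: "D \<inter> D' = {} \<and> glue D' q h ` D \<in> nsets V s \<and> glue D' q h ` D' \<in> nsets V s \<and> Col (glue D' q h ` D) \<inter> A (glue D' q h ` D') \<noteq> {}"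
      then have 1: "glue D' q h ` D = h ` D" by (intro img) auto
      show "q ` D' \<in> (if h ` D \<in> nsets V s then (\<Union>c\<in>Col (h ` D). {S \<in> nsets V s. c \<in> A S}) else {})"
        using g unfolding 1 img' by auto
    qed (use fin D[OF DD(3)] in auto)
    then show ?thesis unfolding E5_def DD by simp
  qed
  have u1: "real (card (\<Union>x\<in>I \<times> I. E1 x)) \<le> a * a * (1 / ?n * ?N)"
    using card_UN_bound[of "I \<times> I" E1, OF _ b1] fin by (simp add: card_cartesian_product a_def)
  have u2: "real (card (\<Union>x\<in>I. E2 x)) \<le> a * (m / ?n * ?N)"
    using card_UN_bound[of "I" E2, OF _ b2] fin by (simp add: a_def)
  have u3: "real (card (\<Union>x\<in>?D. E3 x)) \<le> c * (real (s ^ s) * \<epsilon> * ?N)"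
    using card_UN_bound[of ?D E3, OF _ b3] finD by (simp add: c_def)
  have u4: "real (card (\<Union>x\<in>?D \<times> I. E4 x)) \<le> c * a * (m / ?n * ?N)"
    using card_UN_bound[of "?D \<times> I" E4, OF _ b4] fin finD by (simp add: card_cartesian_product a_def c_def)
  have u5: "real (card (\<Union>x\<in>?D \<times> ?D. E5 x)) \<le> c * c * (real (s ^ s) * (m * \<epsilon>) * ?N)"
    using card_UN_bound[of "?D \<times> ?D" E5, OF _ b5] finD by (simp add: card_cartesian_product c_def)
  let ?U = "(\<Union>x\<in>I \<times> I. E1 x) \<union> ((\<Union>x\<in>I. E2 x) \<union> ((\<Union>x\<in>?D. E3 x) \<union> ((\<Union>x\<in>?D \<times> I. E4 x) \<union> (\<Union>x\<in>?D \<times> ?D. E5 x))))"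
  have finO: "finite (I \<rightarrow>\<^sub>E V)" using fin by (auto intro: finite_PiE)
  have "?U \<subseteq> I \<rightarrow>\<^sub>E V" unfolding E1_def E2_def E3_def E4_def E5_def by auto
  then have finU: "finite ?U" by (rule finite_subset) (rule finO)
  have sub: "{p \<in> I \<rightarrow>\<^sub>E V. \<not> good_box s I X Col A Y p} \<subseteq> ?U"
  proof (rule subsetI, rule ccontr)
    fix p assume p: "p \<in> {p \<in> I \<rightarrow>\<^sub>E V. \<not> good_box s I X Col A Y p}" and nU: "p \<notin> ?U"
    have pP: "p \<in> I \<rightarrow>\<^sub>E V" using p by simp
    then have pV: "p ` I \<subseteq> V" by auto
    have inj: "inj_on p I"
    proof (rule inj_onI, rule ccontr)
      fix x y assume xy: "x \<in> I" "y \<in> I" "p x = p y" "x \<noteq> y"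
      then have "p \<in> E1 (x, y)" using pP by (simp add: E1_def)
      then show False using nU xy by blast
    qed
    have cov: "\<exists>D\<in>?D. S = p ` D \<and> D \<subseteq> I" if "S \<in> nsets (p ` I) s" for S
    proof -
      have S: "S \<subseteq> p ` I" "card S = s" using that unfolding nsets_def by auto
      obtain D where D: "D \<subseteq> I" "S = p ` D" using S(1) subset_imageE by metis
      moreover have "card D = s" using card_image[OF inj_on_subset[OF inj D(1)]] D S by simp
      moreover have "finite D" using D fin finite_subset by blast
      ultimately show ?thesis unfolding nsets_def by blast
    qed
    have inV: "S \<in> nsets V s" if "S \<in> nsets (p ` I) s" for S
      using that nsets_mono[OF pV] by blast
    have "good_box s I X Col A Y p"
      unfolding good_box_def
    proof (intro conjI ballI impI inj)
      show "p ` I \<inter> Y = {}"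
      proof (rule ccontr)
        assume "p ` I \<inter> Y \<noteq> {}"
        then obtain j where "j \<in> I" "p j \<in> Y" by blast
        then have "p \<in> E2 j" using pP by (simp add: E2_def)
        then show False using nU \<open>j \<in> I\<close> by blast
      qed
      fix S assume S: "S \<in> nsets (p ` I) s"
      obtain D where D: "D \<in> ?D" "S = p ` D" "D \<subseteq> I" using cov[OF S] by blast
      show "S \<in> X"
      proof (rule ccontr)
        assume "S \<notin> X"
        then have "p \<in> E3 D" using pP inV[OF S] D by (simp add: E3_def)
        then show False using nU D by blast
      qed
      show "Col S \<inter> p ` I = {}"
      proof (rule ccontr)
        assume "Col S \<inter> p ` I \<noteq> {}"
        then obtain j where j: "j \<in> I" "p j \<in> Col S" by blast
        then have "j \<notin> D" using Col[OF inV[OF S]] D by blast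
        then have "p \<in> E4 (D, j)" using pP inV[OF S] D j by (simp add: E4_def)
        then show False using nU D j by blast
      qed
      fix S' assume S': "S' \<in> nsets (p ` I) s" and dis: "S \<inter> S' = {}"
      obtain D' where D': "D' \<in> ?D" "S' = p ` D'" "D' \<subseteq> I" using cov[OF S'] by blast
      show "Col S \<inter> A S' = {}"
      proof (rule ccontr)
        assume "Col S \<inter> A S' \<noteq> {}"
        moreover have "D \<inter> D' = {}" using dis D D' by blast
        ultimately have "p \<in> E5 (D, D')" using pP inV[OF S] inV[OF S'] D D' by (simp add: E5_def)
        then show False using nU D D' by blast
      qed
    qed
    then show False using p by simp
  qed
  have "real (card {p \<in> I \<rightarrow>\<^sub>E V. \<not> good_box s I X Col A Y p}) \<le> real (card ?U)"
    using card_mono[OF finU sub] by simp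
  also have "\<dots> \<le> real (card (\<Union>x\<in>I \<times> I. E1 x)) + (real (card (\<Union>x\<in>I. E2 x)) + (real (card (\<Union>x\<in>?D. E3 x)) +
      (real (card (\<Union>x\<in>?D \<times> I. E4 x)) + real (card (\<Union>x\<in>?D \<times> ?D. E5 x)))))"
    unfolding of_nat_add[symmetric] of_nat_le_iff
    by (meson card_Un_le order_trans add_left_mono)
  also have "\<dots> \<le> a * a * (1 / ?n * ?N) + (a * (m / ?n * ?N) + (c * (real (s ^ s) * \<epsilon> * ?N) + (c * a * (m / ?n * ?N) + c * c * (real (s ^ s) * (m * \<epsilon>) * ?N))))"
    using u1 u2 u3 u4 u5 by (intro add_mono) auto
  also have "\<dots> = ((a * a + a * m + c * a * m) / ?n + (c * s ^ s + c * c * (s ^ s * m)) * \<epsilon>) * ?N"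
    by (simp add: algebra_simps add_divide_distrib)
  finally show ?thesis .
qed

definition box_hypotheses where
  "box_hypotheses s \<sigma> m (\<delta>::real) \<epsilon> n0 (V :: 'a set) G X Col A Y \<longleftrightarrow>
     finite V \<and> n0 \<le> card V \<and>
     G \<subseteq> {w. length w = \<sigma> \<and> set w \<subseteq> V} \<and> \<delta> * real (card V) ^ \<sigma> \<le> real (card G) \<and>
     real (card (nsets V s - X)) \<le> \<epsilon> * real (card V) ^ s \<and>
     (\<forall>S\<in>nsets V s. finite (Col S) \<and> card (Col S) \<le> m \<and> Col S \<inter> S = ({} :: 'a set)) \<and>
     (\<forall>c :: 'a. real (card {S \<in> nsets V s. c \<in> A S}) \<le> \<epsilon> * real (card V) ^ s) \<and>
     finite (Y :: 'a set) \<and> card Y \<le> m"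

text \<open>
Boxes have a positive density that depends on \<open>\<delta>\<close> only, and bad maps have density \<open>O(1/n + \<epsilon>)\<close>.
\<close>

lemma exists_good_box:
  fixes s \<sigma> t m :: nat and \<delta> :: real
  assumes \<delta>: "0 < \<delta>"
  shows "\<exists>\<epsilon>>0. \<exists>n0. \<forall>(V :: 'a set) G X Col A Y. box_hypotheses s \<sigma> m \<delta> \<epsilon> n0 V G X Col A Y \<longrightarrow>
     (\<exists>p. p ` ({..<\<sigma>} \<times> {..<t}) \<subseteq> V \<and> good_box s ({..<\<sigma>} \<times> {..<t}) X Col A Y p \<and>
        (\<forall>g. (\<forall>i<\<sigma>. g i < t) \<longrightarrow> cell p g \<sigma> \<in> G))"
proof -
  let ?I = "{..<\<sigma>} \<times> {..<t}"
  define \<beta> where "\<beta> = \<delta> ^ (t ^ \<sigma>)"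
  define a where "a = real (card ?I)"
  define c where "c = real (card (nsets ?I s))"
  define c1 where "c1 = a * a + a * m + c * a * m"
  define c2 where "c2 = c * s ^ s + c * c * (s ^ s * m)"
  have pos: "0 < \<beta>" "0 \<le> c1" "0 \<le> c2" using \<delta> by (auto simp: \<beta>_def c1_def c2_def a_def c_def)
  define \<epsilon> where "\<epsilon> = \<beta> / (4 * (c2 + 1))"
  have \<epsilon>: "0 < \<epsilon>" "c2 * \<epsilon> \<le> \<beta> / 4" using pos by (auto simp: \<epsilon>_def field_simps)
  obtain n0 :: nat where n0: "4 * c1 / \<beta> < real n0" using reals_Archimedean2 by blast
  show ?thesis
  proof (intro exI[of _ \<epsilon>] conjI \<epsilon>(1) exI[of _ n0] allI impI)
    fix V Y :: "'a set" and G X and Col A :: "'a set \<Rightarrow> 'a set"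
    assume "box_hypotheses s \<sigma> m \<delta> \<epsilon> n0 V G X Col A Y"
    then have V: "finite V" "n0 \<le> card V" and G: "G \<subseteq> {w. length w = \<sigma> \<and> set w \<subseteq> V}" "\<delta> * real (card V) ^ \<sigma> \<le> real (card G)"
      and X: "real (card (nsets V s - X)) \<le> \<epsilon> * real (card V) ^ s"
      and Col: "\<forall>S\<in>nsets V s. finite (Col S) \<and> card (Col S) \<le> m \<and> Col S \<inter> S = {}"
      and A: "\<forall>c. real (card {S \<in> nsets V s. c \<in> A S}) \<le> \<epsilon> * real (card V) ^ s"
      and Y: "finite Y \<and> card Y \<le> m"
      unfolding box_hypotheses_def by blast+
    let ?n = "real (card V)"
    have "0 \<le> 4 * c1 / \<beta>" using pos by simp
    then have "0 < real n0" using n0 by linarith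
    then have n: "0 < ?n" "4 * c1 / \<beta> < ?n" using n0 V(2) by linarith+
    then have ne: "V \<noteq> {}" by auto
    let ?P = "{p \<in> ?I \<rightarrow>\<^sub>E V. \<forall>g. (\<forall>i<\<sigma>. g i < t) \<longrightarrow> cell p g \<sigma> \<in> G}"
    let ?B = "{p \<in> ?I \<rightarrow>\<^sub>E V. \<not> good_box s ?I X Col A Y p}"
    have cI: "card ?I = \<sigma> * t" by (simp add: card_cartesian_product)
    have "\<delta> \<le> real (card G) / ?n ^ \<sigma>" using G(2) n by (simp add: field_simps)
    then have "\<beta> \<le> (real (card G) / ?n ^ \<sigma>) ^ (t ^ \<sigma>)" unfolding \<beta>_def using \<delta> by (intro power_mono) auto
    then have "\<beta> * ?n ^ (\<sigma> * t) \<le> (real (card G) / ?n ^ \<sigma>) ^ (t ^ \<sigma>) * ?n ^ (\<sigma> * t)"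
      by (intro mult_right_mono) auto
    also have "\<dots> \<le> real (card ?P)" by (rule box_count[OF V(1) ne G(1)])
    finally have P: "\<beta> * ?n ^ (\<sigma> * t) \<le> real (card ?P)" .
    have "real (card ?B) \<le> (c1 / ?n + c2 * \<epsilon>) * ?n ^ card ?I"
      unfolding c1_def c2_def a_def c_def
      using Col A Y X \<epsilon> V ne by (intro card_not_good_box) auto
    also have "\<dots> \<le> (\<beta> / 4 + \<beta> / 4) * ?n ^ (\<sigma> * t)"
    proof -
      have "c1 / ?n \<le> \<beta> / 4" using n pos by (simp add: field_simps)
      then show ?thesis unfolding cI using \<epsilon>(2) by (intro mult_right_mono add_mono) auto
    qed
    also have "\<dots> < \<beta> * ?n ^ (\<sigma> * t)" using pos n by simp
    finally have "real (card ?B) < real (card ?P)" using P by linarith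
    then have less: "card ?B < card ?P" by (simp only: of_nat_less_iff)
    have finB: "finite ?B" using V(1) by (intro finite_filter finite_PiE) auto
    have "\<not> ?P \<subseteq> ?B"
    proof
      assume "?P \<subseteq> ?B"
      then have "card ?P \<le> card ?B" by (rule card_mono[OF finB])
      then show False using less by linarith
    qed
    then obtain p where p: "p \<in> ?P" "p \<notin> ?B" by blast
    then have "p ` ?I \<subseteq> V" by auto
    then show "\<exists>p. p ` ?I \<subseteq> V \<and> good_box s ?I X Col A Y p \<and> (\<forall>g. (\<forall>i<\<sigma>. g i < t) \<longrightarrow> cell p g \<sigma> \<in> G)"
      using p by blast
  qed
qed

section \<open>Rings of cells with rare colours\<close>

text \<open>
Sets of size \<open>s\<close> that are arranged in a cycle of length \<open>K\<close>, where consecutive sets \<open>f (q - 1)\<close>, \<open>f q\<close> share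
exactly the vertex \<open>v q\<close>.
\<close>

definition cell_ring :: "nat \<Rightarrow> nat \<Rightarrow> (nat \<Rightarrow> 'a set) \<Rightarrow> (nat \<Rightarrow> 'a) \<Rightarrow> bool" where
  "cell_ring K s f v \<longleftrightarrow> (\<forall>q<K. finite (f q) \<and> card (f q) = s) \<and>
     (\<forall>q q'. q < q' \<longrightarrow> q' < K \<longrightarrow>
        f q \<inter> f q' = (if q' = Suc q then {v q'} else if q = 0 \<and> Suc q' = K then {v 0} else {}))"

text \<open>
The column, in row \<open>i\<close>, of the vertex that the cell number \<open>q\<close> uses. Rows \<open>0\<close> and \<open>1\<close> alternately provide the
links between consecutive cells; in the other rows the cells have columns of their own.
\<close>

definition ring_pos :: "nat \<Rightarrow> nat \<Rightarrow> nat \<Rightarrow> nat" where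
  "ring_pos \<kappa> q i = (if i = 0 then q div 2 else if i = 1 then (Suc q div 2) mod \<kappa> else q)"

definition ring_link :: "nat \<Rightarrow> nat \<times> nat" where
  "ring_link q = (if even q then 1 else 0, q div 2)"

lemma ring_pos_eq_iff:
  assumes "q < q'" "q' < 2 * \<kappa>"
  shows "ring_pos \<kappa> q i = ring_pos \<kappa> q' i \<longleftrightarrow>
     (i = 0 \<and> even q \<and> q' = Suc q) \<or> (i = 1 \<and> (odd q \<and> q' = Suc q \<or> q = 0 \<and> Suc q' = 2 * \<kappa>))"
proof -
  have m: "x mod \<kappa> = (if x = \<kappa> then 0 else x)" if "x \<le> \<kappa>" for x using that by auto
  have le: "Suc q div 2 \<le> \<kappa>" "Suc q' div 2 \<le> \<kappa>" using assms by linarith+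
  consider "i = 0" | "i = 1" | "2 \<le> i" by linarith
  then show ?thesis
  proof cases
    case 1
    have "q div 2 = q' div 2 \<longleftrightarrow> even q \<and> q' = Suc q" using assms(1) by presburger
    then show ?thesis using 1 by (simp add: ring_pos_def)
  next
    case 2
    have "((if Suc q div 2 = \<kappa> then 0 else Suc q div 2) = (if Suc q' div 2 = \<kappa> then 0 else Suc q' div 2))
       \<longleftrightarrow> (odd q \<and> q' = Suc q \<or> q = 0 \<and> Suc q' = 2 * \<kappa>)"
    proof -
      obtain a b where ab: "q = 2 * a \<or> q = 2 * a + 1" "q' = 2 * b \<or> q' = 2 * b + 1"
        by (meson oddE evenE)
      have "Suc (2 * x) div 2 = x" "Suc (2 * x + 1) div 2 = Suc x" for x :: nat by auto
      then show ?thesis using ab assms by (elim disjE; simp; linarith?; presburger?)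
    qed
    then show ?thesis using 2 unfolding ring_pos_def m[OF le(1)] m[OF le(2)] by simp
  next
    case 3
    then show ?thesis using assms(1) by (simp add: ring_pos_def)
  qed
qed

lemma ring_pos_less: "q < 2 * \<kappa> \<Longrightarrow> ring_pos \<kappa> q i < 2 * \<kappa>"
  by (auto simp: ring_pos_def less_mult_imp_div_less mult.commute intro: order.strict_trans2[OF mod_less_divisor])

text \<open>
A box contains rings of cells of even length only, as two of its rows alternate in linking them.
\<close>

lemma cell_ring_of_box:
  assumes inj: "inj_on p ({..<s} \<times> {..<t})" and s: "2 \<le> s" and K: "2 * \<kappa> \<le> t" "2 \<le> \<kappa>"
  shows "cell_ring (2 * \<kappa>) s (\<lambda>q. p ` (\<lambda>i. (i, ring_pos \<kappa> q i)) ` {..<s}) (\<lambda>q. p (ring_link q))"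
  unfolding cell_ring_def
proof (intro conjI allI impI)
  let ?pos = "\<lambda>q. (\<lambda>i. (i, ring_pos \<kappa> q i)) ` {..<s}"
  have sub: "?pos q \<subseteq> {..<s} \<times> {..<t}" if "q < 2 * \<kappa>" for q
    using ring_pos_less[OF that] K(1) by (auto intro: less_le_trans)
  fix q assume q: "q < 2 * \<kappa>"
  have "inj_on (\<lambda>i. (i, ring_pos \<kappa> q i)) {..<s}" by (auto simp: inj_on_def)
  then have "card (?pos q) = s" by (simp add: card_image)
  then show "card (p ` ?pos q) = s" using card_image[OF inj_on_subset[OF inj sub[OF q]]] by simp
  show "finite (p ` ?pos q)" by simp
next
  let ?pos = "\<lambda>q. (\<lambda>i. (i, ring_pos \<kappa> q i)) ` {..<s}"
  have sub: "?pos q \<subseteq> {..<s} \<times> {..<t}" if "q < 2 * \<kappa>" for q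
    using ring_pos_less[OF that] K(1) by (auto intro: less_le_trans)
  fix q q' assume q: "q < q'" "q' < 2 * \<kappa>"
  have "p ` ?pos q \<inter> p ` ?pos q' = p ` (?pos q \<inter> ?pos q')"
    using q by (intro inj_on_image_Int[OF inj, symmetric] sub) auto
  also have "?pos q \<inter> ?pos q' = (\<lambda>i. (i, ring_pos \<kappa> q' i)) ` {i. i < s \<and> ring_pos \<kappa> q i = ring_pos \<kappa> q' i}"
    by auto
  also have "{i. i < s \<and> ring_pos \<kappa> q i = ring_pos \<kappa> q' i} =
     (if q' = Suc q then {if even q then 0 else 1} else if q = 0 \<and> Suc q' = 2 * \<kappa> then {1} else {})"
    unfolding ring_pos_eq_iff[OF q] using s q K(2) by auto
  also have "(\<lambda>i. (i, ring_pos \<kappa> q' i)) ` \<dots> =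
     (if q' = Suc q then {ring_link q'} else if q = 0 \<and> Suc q' = 2 * \<kappa> then {ring_link 0} else {})"
  proof -
    have e0: "ring_pos \<kappa> q' 1 = 0" if "Suc q' = 2 * \<kappa>" using that by (simp add: ring_pos_def)
    have "Suc q' div 2 < \<kappa>" if "even q'" using that q by presburger
    then have "(Suc q' div 2) mod \<kappa> = q' div 2" if "even q'" using that by simp
    then show ?thesis using e0 by (auto simp: ring_link_def ring_pos_def)
  qed
  finally show "p ` ?pos q \<inter> p ` ?pos q' = (if q' = Suc q then {p (ring_link q')} else if q = 0 \<and> Suc q' = 2 * \<kappa> then {p (ring_link 0)} else {})"
    by auto
qed

lemma cell_ring_inter:
  assumes "cell_ring K s f v"
  shows "Suc q < K \<Longrightarrow> f q \<inter> f (Suc q) = {v (Suc q)}"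
    and "3 \<le> K \<Longrightarrow> f 0 \<inter> f (K - 1) = {v 0}"
    and "Suc q < q' \<Longrightarrow> q' < K \<Longrightarrow> \<not> (q = 0 \<and> Suc q' = K) \<Longrightarrow> f q \<inter> f q' = {}"
proof -
  have i: "f q \<inter> f q' = (if q' = Suc q then {v q'} else if q = 0 \<and> Suc q' = K then {v 0} else {})"
    if "q < q'" "q' < K" for q q' using assms that unfolding cell_ring_def by simp
  show "Suc q < K \<Longrightarrow> f q \<inter> f (Suc q) = {v (Suc q)}" using i[of q "Suc q"] by simp
  show "3 \<le> K \<Longrightarrow> f 0 \<inter> f (K - 1) = {v 0}" 
  proof -
    assume "3 \<le> K"
    then have "0 < K - 1" "K - 1 < K" "K - 1 \<noteq> Suc 0" "Suc (K - 1) = K" by linarith+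
    then show ?thesis using i[of 0 "K - 1"] by simp
  qed
  show "Suc q < q' \<Longrightarrow> q' < K \<Longrightarrow> \<not> (q = 0 \<and> Suc q' = K) \<Longrightarrow> f q \<inter> f q' = {}" using i[of q q'] by simp
qed

text \<open>
Cells that are enlarged by one colour each form a cycle; adjacent cells may be linked either by a
vertex or by a common colour.
\<close>

lemma has_cycle_coloured:
  assumes edge: "\<And>q. q < k \<Longrightarrow> insert (col q) (f q) \<in> H"
    and off: "\<And>q q'. q < k \<Longrightarrow> q' < k \<Longrightarrow> col q \<notin> f q'"
    and con: "\<And>q. Suc q < k \<Longrightarrow> f q \<inter> f (Suc q) \<noteq> {} \<or> col q = col (Suc q)"
    and clo: "f 0 \<inter> f (k - 1) \<noteq> {} \<or> col 0 = col (k - 1)"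
    and non: "\<And>q q'. Suc q < q' \<Longrightarrow> q' < k \<Longrightarrow> \<not> (q = 0 \<and> Suc q' = k) \<Longrightarrow> f q \<inter> f q' = {} \<and> col q \<noteq> col q'"
  shows "has_cycle k H"
proof (rule has_cycleI[where e = "\<lambda>q. insert (col q) (f q)"])
  fix q q' assume q: "Suc q < q'" "q' < k" "\<not> (q = 0 \<and> Suc q' = k)"
  then have "q < k" by linarith
  then show "insert (col q) (f q) \<inter> insert (col q') (f q') = {}"
    using non[OF q] off[of q q'] off[of q' q] q(2) by auto
qed (use edge con clo in auto)

lemma card_distinct_tuples:
  assumes "finite V" "D \<subseteq> nsets V s"
  shows "card D \<le> card {w. distinct w \<and> length w = s \<and> set w \<in> D}"
    and "{w. distinct w \<and> length w = s \<and> set w \<in> D} \<subseteq> {w. length w = s \<and> set w \<subseteq> V}"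
proof -
  let ?G = "{w. distinct w \<and> length w = s \<and> set w \<in> D}"
  show sub: "?G \<subseteq> {w. length w = s \<and> set w \<subseteq> V}" using assms unfolding nsets_def by auto
  have "finite {w. set w \<subseteq> V \<and> length w = s}" by (rule finite_lists_length_eq[OF assms(1)])
  moreover have "{w. length w = s \<and> set w \<subseteq> V} = {w. set w \<subseteq> V \<and> length w = s}" by auto
  ultimately have fin: "finite ?G" using sub finite_subset by (metis (no_types, lifting))
  have "D \<subseteq> set ` ?G"
  proof
    fix S assume S: "S \<in> D"
    then have "finite S" "card S = s" using assms unfolding nsets_def by auto
    then obtain w where "set w = S" "distinct w" using finite_distinct_list by blast
    then have "w \<in> ?G" using S \<open>card S = s\<close> distinct_card by fastforce
    then show "S \<in> set ` ?G" using \<open>set w = S\<close> by blast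
  qed
  then show "card D \<le> card ?G" using fin surj_card_le by blast
qed

text \<open>
Colours are added to \<open>L\<close> as long as the next density threshold can be met.
\<close>

lemma popular_core:
  fixes \<gamma> :: "nat \<Rightarrow> real"
  assumes A: "\<And>S. S \<in> D \<Longrightarrow> finite (A S) \<and> card (A S) = q"
    and \<gamma>: "\<And>j. 0 < \<gamma> j" and N: "0 < N" and D: "\<gamma> 0 * N \<le> real (card D)"
  shows "\<exists>L. finite L \<and> card L \<le> q \<and> \<gamma> (card L) * N \<le> real (card {S \<in> D. L \<subseteq> A S}) \<and>
     (card L = q \<or> (\<forall>c. c \<notin> L \<longrightarrow> real (card {S \<in> D. insert c L \<subseteq> A S}) < \<gamma> (Suc (card L)) * N))"
proof (rule ccontr)
  assume no: "\<not> ?thesis"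
  have le: "card L \<le> q" if L: "finite L" "\<gamma> (card L) * N \<le> real (card {S \<in> D. L \<subseteq> A S})" for L
  proof -
    have "0 < \<gamma> (card L) * N" using \<gamma> N by simp
    then have "{S \<in> D. L \<subseteq> A S} \<noteq> {}" using L(2) by (metis card.empty of_nat_0 not_le)
    then obtain S where "S \<in> D" "L \<subseteq> A S" by blast
    then show ?thesis using A[of S] card_mono[of "A S" L] by simp
  qed
  have "\<exists>L. finite L \<and> card L = j \<and> \<gamma> j * N \<le> real (card {S \<in> D. L \<subseteq> A S})" for j
  proof (induction j)
    case 0
    then show ?case using D by (intro exI[of _ "{}"]) auto
  next
    case (Suc j)
    then obtain L where L: "finite L" "card L = j" "\<gamma> j * N \<le> real (card {S \<in> D. L \<subseteq> A S})" by blast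
    then have "card L \<le> q" using le by blast
    then obtain c where c: "c \<notin> L" "\<gamma> (Suc j) * N \<le> real (card {S \<in> D. insert c L \<subseteq> A S})"
    proof -
      have "\<not> (card L = q \<or> (\<forall>c. c \<notin> L \<longrightarrow> real (card {S \<in> D. insert c L \<subseteq> A S}) < \<gamma> (Suc (card L)) * N))"
        using no L \<open>card L \<le> q\<close> by blast
      then show ?thesis using that L(2) by (auto simp: not_less)
    qed
    then show ?case using L by (intro exI[of _ "insert c L"]) auto
  qed
  from this[of "Suc q"] obtain L where "finite L" "card L = Suc q" "\<gamma> (Suc q) * N \<le> real (card {S \<in> D. L \<subseteq> A S})" by blast
  then show False using le[of L] by simp
qed


lemma box_functions:
  "\<exists>E N0. \<forall>\<delta>>0. 0 < E \<delta> \<and> (\<forall>(V :: 'a set) G X Col A Y. box_hypotheses s \<sigma> m \<delta> (E \<delta>) (N0 \<delta>) V G X Col A Y \<longrightarrow>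
     (\<exists>p. p ` ({..<\<sigma>} \<times> {..<t}) \<subseteq> V \<and> good_box s ({..<\<sigma>} \<times> {..<t}) X Col A Y p \<and>
        (\<forall>g. (\<forall>i<\<sigma>. g i < t) \<longrightarrow> cell p g \<sigma> \<in> G)))"
    (is "\<exists>E N0. \<forall>\<delta>>0. 0 < E \<delta> \<and> ?Q \<delta> (E \<delta>) (N0 \<delta>)")
proof -
  have "\<forall>\<delta>. \<exists>\<epsilon> n0. 0 < \<delta> \<longrightarrow> 0 < \<epsilon> \<and> ?Q \<delta> \<epsilon> n0"
  proof
    fix \<delta> :: real
    show "\<exists>\<epsilon> n0. 0 < \<delta> \<longrightarrow> 0 < \<epsilon> \<and> ?Q \<delta> \<epsilon> n0"
    proof (cases "0 < \<delta>")
      case True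
      from exists_good_box[OF True, where s=s and \<sigma>=\<sigma> and m=m and t=t]
      obtain \<epsilon> n0 where "0 < \<epsilon> \<and> ?Q \<delta> \<epsilon> n0" by (elim exE conjE) (rule that, rule conjI)
      then show ?thesis by (intro exI impI)
    qed simp
  qed
  from choice[OF this] obtain E where "\<forall>\<delta>. \<exists>n0. 0 < \<delta> \<longrightarrow> 0 < E \<delta> \<and> ?Q \<delta> (E \<delta>) n0" ..
  from choice[OF this] obtain N0 where "\<forall>\<delta>. 0 < \<delta> \<longrightarrow> 0 < E \<delta> \<and> ?Q \<delta> (E \<delta>) (N0 \<delta>)" ..
  then show ?thesis by (intro exI)
qed

definition core_hypotheses where
  "core_hypotheses s q m (\<delta>::real) \<epsilon> n0 (V :: 'a set) D X Col (A :: 'a set \<Rightarrow> 'a set) \<longleftrightarrow>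
     finite V \<and> n0 \<le> card V \<and> D \<subseteq> nsets V s \<and> \<delta> * real (card V) ^ s \<le> real (card D) \<and>
     (\<forall>S\<in>D. finite (A S) \<and> card (A S) = q) \<and>
     real (card (nsets V s - X)) \<le> \<epsilon> * real (card V) ^ s \<and>
     (\<forall>S\<in>nsets V s. finite (Col S) \<and> card (Col S) \<le> m \<and> Col S \<inter> S = ({} :: 'a set))"

text \<open>
The set \<open>L\<close> is contained in the lists of all cells. Colours in \<open>L\<close> are frequent; unless \<open>L\<close> exhausts the lists,
the other colours of a cell do not occur on cells that are disjoint from it.
\<close>

definition core_box where
  "core_box s q T (V :: 'a set) D X Col A L P \<longleftrightarrow>
     finite L \<and> card L \<le> q \<and> P \<subseteq> V \<and> P \<inter> L = {} \<and>
     (\<forall>S\<in>nsets P s. S \<in> X \<and> Col S \<inter> P = {} \<and>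
        (\<forall>S'\<in>nsets P s. S \<inter> S' = {} \<longrightarrow> S' \<in> D \<longrightarrow> L \<subseteq> A S' \<longrightarrow> card L < q \<longrightarrow> Col S \<inter> (A S' - L) = {})) \<and>
     (\<forall>\<kappa>. 2 \<le> \<kappa> \<longrightarrow> 2 * \<kappa> \<le> T \<longrightarrow>
        (\<exists>f v. cell_ring (2 * \<kappa>) s f v \<and> (\<forall>i<2 * \<kappa>. f i \<in> D \<and> L \<subseteq> A (f i) \<and> f i \<subseteq> P)))"

lemma core_boxD:
  assumes "core_box s q T V D X Col A L P"
  shows "finite L" "card L \<le> q" "P \<subseteq> V" "P \<inter> L = {}"
    and "S \<in> nsets P s \<Longrightarrow> S \<in> X"
    and "S \<in> nsets P s \<Longrightarrow> Col S \<inter> P = {}"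
    and "S \<in> nsets P s \<Longrightarrow> S' \<in> nsets P s \<Longrightarrow> S \<inter> S' = {} \<Longrightarrow> S' \<in> D \<Longrightarrow> L \<subseteq> A S' \<Longrightarrow> card L < q \<Longrightarrow>
       Col S \<inter> (A S' - L) = {}"
    and "2 \<le> \<kappa> \<Longrightarrow> 2 * \<kappa> \<le> T \<Longrightarrow> \<exists>f v. cell_ring (2 * \<kappa>) s f v \<and> (\<forall>i<2 * \<kappa>. f i \<in> D \<and> L \<subseteq> A (f i) \<and> f i \<subseteq> P)"
proof -
  note b = assms[unfolded core_box_def]
  show "finite L" "card L \<le> q" "P \<subseteq> V" "P \<inter> L = {}" by (rule b[THEN conjunct1], rule b[THEN conjunct2, THEN conjunct1], rule b[THEN conjunct2, THEN conjunct2, THEN conjunct1], rule b[THEN conjunct2, THEN conjunct2, THEN conjunct2, THEN conjunct1])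
  have c: "\<forall>S\<in>nsets P s. S \<in> X \<and> Col S \<inter> P = {} \<and>
        (\<forall>S'\<in>nsets P s. S \<inter> S' = {} \<longrightarrow> S' \<in> D \<longrightarrow> L \<subseteq> A S' \<longrightarrow> card L < q \<longrightarrow> Col S \<inter> (A S' - L) = {})"
    by (rule b[THEN conjunct2, THEN conjunct2, THEN conjunct2, THEN conjunct2, THEN conjunct1])
  have r: "\<forall>\<kappa>. 2 \<le> \<kappa> \<longrightarrow> 2 * \<kappa> \<le> T \<longrightarrow>
        (\<exists>f v. cell_ring (2 * \<kappa>) s f v \<and> (\<forall>i<2 * \<kappa>. f i \<in> D \<and> L \<subseteq> A (f i) \<and> f i \<subseteq> P))"
    by (rule b[THEN conjunct2, THEN conjunct2, THEN conjunct2, THEN conjunct2, THEN conjunct2])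
  show "S \<in> nsets P s \<Longrightarrow> S \<in> X" "S \<in> nsets P s \<Longrightarrow> Col S \<inter> P = {}"
    using c by blast+
  show "S \<in> nsets P s \<Longrightarrow> S' \<in> nsets P s \<Longrightarrow> S \<inter> S' = {} \<Longrightarrow> S' \<in> D \<Longrightarrow> L \<subseteq> A S' \<Longrightarrow> card L < q \<Longrightarrow>
       Col S \<inter> (A S' - L) = {}"
    by (rule c[THEN bspec, THEN conjunct2, THEN conjunct2, THEN bspec, THEN mp, THEN mp, THEN mp, THEN mp])
  show "2 \<le> \<kappa> \<Longrightarrow> 2 * \<kappa> \<le> T \<Longrightarrow> \<exists>f v. cell_ring (2 * \<kappa>) s f v \<and> (\<forall>i<2 * \<kappa>. f i \<in> D \<and> L \<subseteq> A (f i) \<and> f i \<subseteq> P)"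
    by (rule r[THEN spec, THEN mp, THEN mp])
qed

text \<open>
The thresholds \<open>\<gamma> j\<close> decrease so fast that a colour that misses \<open>\<gamma> (Suc j)\<close> is rare with respect to a
family of density \<open>\<gamma> j\<close>. The result does not depend on the number of frequent colours, which cannot be
bounded in terms of \<open>\<delta>\<close> in advance.
\<close>

lemma core_ring:
  fixes s q T m :: nat and \<delta> :: real
  assumes s: "2 \<le> s" and \<delta>: "0 < \<delta>" and qm: "q \<le> m"
  shows "\<exists>\<gamma>>0. \<exists>\<epsilon>>0. \<exists>n0. \<forall>(V :: 'a set) D X Col A. core_hypotheses s q m \<delta> \<epsilon> n0 V D X Col A \<longrightarrow>
     (\<exists>L P. \<gamma> * real (card V) ^ s \<le> real (card {S \<in> D. L \<subseteq> A S}) \<and> core_box s q T V D X Col A L P)"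
proof -
  let ?I = "{..<s} \<times> {..<T}"
  obtain E and N0 :: "real \<Rightarrow> nat" where EN: "\<forall>\<delta>>0. 0 < E \<delta> \<and> (\<forall>(V :: 'a set) G X Col A Y. box_hypotheses s s m \<delta> (E \<delta>) (N0 \<delta>) V G X Col A Y \<longrightarrow>
     (\<exists>p. p ` ?I \<subseteq> V \<and> good_box s ?I X Col A Y p \<and>
        (\<forall>g. (\<forall>i<s. g i < T) \<longrightarrow> cell p g s \<in> G)))"
    using box_functions[where 'a='a, of s s m T] by blast
  define \<gamma> where "\<gamma> j = (E ^^ j) \<delta>" for j
  have \<gamma>0: "\<gamma> 0 = \<delta>" and \<gamma>S: "\<gamma> (Suc j) = E (\<gamma> j)" for j by (simp_all add: \<gamma>_def)
  have \<gamma>pos: "0 < \<gamma> j" for j by (induction j) (use \<delta> EN in \<open>simp_all add: \<gamma>0 \<gamma>S\<close>)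
  define g where "g = Min (\<gamma> ` {..q})"
  define \<epsilon> where "\<epsilon> = Min ((\<lambda>j. E (\<gamma> j)) ` {..q})"
  define n0 where "n0 = Suc (Max ((\<lambda>j. N0 (\<gamma> j)) ` {..q}))"
  have g: "0 < g" "\<And>j. j \<le> q \<Longrightarrow> g \<le> \<gamma> j" unfolding g_def using \<gamma>pos by (auto intro: Min_le)
  have \<epsilon>: "0 < \<epsilon>" "\<And>j. j \<le> q \<Longrightarrow> \<epsilon> \<le> E (\<gamma> j)" unfolding \<epsilon>_def using \<gamma>pos EN by (auto intro: Min_le)
  have n0: "N0 (\<gamma> j) \<le> n0" if "j \<le> q" for j
  proof -
    have "N0 (\<gamma> j) \<le> Max ((\<lambda>j. N0 (\<gamma> j)) ` {..q})" using that by (intro Max_ge) auto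
    then show ?thesis unfolding n0_def by simp
  qed
  show ?thesis
  proof (rule exI[of _ g], rule conjI[OF g(1)], rule exI[of _ \<epsilon>], rule conjI[OF \<epsilon>(1)], rule exI[of _ n0], intro allI impI)
    fix V :: "'a set" and D X and Col A :: "'a set \<Rightarrow> 'a set"
    assume "core_hypotheses s q m \<delta> \<epsilon> n0 V D X Col A"
    then have V: "finite V" "n0 \<le> card V" and D: "D \<subseteq> nsets V s" "\<delta> * real (card V) ^ s \<le> real (card D)"
      and A: "\<forall>S\<in>D. finite (A S) \<and> card (A S) = q"
      and X: "real (card (nsets V s - X)) \<le> \<epsilon> * real (card V) ^ s"
      and Col: "\<forall>S\<in>nsets V s. finite (Col S) \<and> card (Col S) \<le> m \<and> Col S \<inter> S = {}"
      unfolding core_hypotheses_def by blast+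
    let ?N = "real (card V) ^ s"
    have finD: "finite D" using D(1) finite_imp_finite_nsets[OF V(1)] finite_subset by metis
    have N: "0 < ?N" using V n0_def by simp
    obtain L where L: "finite L" "card L \<le> q" "\<gamma> (card L) * ?N \<le> real (card {S \<in> D. L \<subseteq> A S})"
      "card L = q \<or> (\<forall>c. c \<notin> L \<longrightarrow> real (card {S \<in> D. insert c L \<subseteq> A S}) < \<gamma> (Suc (card L)) * ?N)"
      using popular_core[of D A q \<gamma> ?N] A \<gamma>pos N D(2) \<gamma>0 by auto
    let ?j = "card L"
    define DL where "DL = {S \<in> D. L \<subseteq> A S}"
    define G where "G = {w. distinct w \<and> length w = s \<and> set w \<in> DL}"
    \<comment> \<open>only the colours outside \<open>L\<close> are rare, and only on the sets in \<open>DL\<close>\<close>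
    define A' where "A' S = (if ?j < q \<and> S \<in> DL then A S - L else {})" for S
    have DL: "DL \<subseteq> nsets V s" using D(1) unfolding DL_def by blast
    have sp: "0 \<le> E (\<gamma> ?j) * ?N" using EN \<gamma>pos[of ?j] N by (simp add: less_imp_le)
    have light: "real (card {S \<in> nsets V s. c \<in> A' S}) \<le> E (\<gamma> ?j) * ?N" for c
    proof (cases "?j < q \<and> c \<notin> L")
      case True
      have "{S \<in> nsets V s. c \<in> A' S} \<subseteq> {S \<in> D. insert c L \<subseteq> A S}"
        unfolding A'_def DL_def by (auto split: if_splits)
      then have "card {S \<in> nsets V s. c \<in> A' S} \<le> card {S \<in> D. insert c L \<subseteq> A S}"
        using finD by (intro card_mono finite_filter)
      moreover have "real (card {S \<in> D. insert c L \<subseteq> A S}) < E (\<gamma> ?j) * ?N"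
        using L(4) True \<gamma>S[of ?j] by auto
      ultimately show ?thesis by linarith
    next
      case False
      then have "{S \<in> nsets V s. c \<in> A' S} = {}" unfolding A'_def by auto
      then show ?thesis using sp by (simp only: card.empty of_nat_0)
    qed
    have "box_hypotheses s s m (\<gamma> ?j) (E (\<gamma> ?j)) (N0 (\<gamma> ?j)) V G X Col A' L"
      unfolding box_hypotheses_def
    proof (intro conjI)
      show "N0 (\<gamma> ?j) \<le> card V" using n0[OF L(2)] V(2) by linarith
      show "G \<subseteq> {w. length w = s \<and> set w \<subseteq> V}" unfolding G_def by (rule card_distinct_tuples(2)[OF V(1) DL])
      have "card DL \<le> card G" unfolding G_def by (rule card_distinct_tuples(1)[OF V(1) DL])
      then show "\<gamma> ?j * ?N \<le> real (card G)" using L(3) unfolding DL_def by linarith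
      have "\<epsilon> * ?N \<le> E (\<gamma> ?j) * ?N" using \<epsilon>(2)[OF L(2)] N by (intro mult_right_mono) auto
      then show "real (card (nsets V s - X)) \<le> E (\<gamma> ?j) * ?N" using X by linarith
      show "\<forall>c. real (card {S \<in> nsets V s. c \<in> A' S}) \<le> E (\<gamma> ?j) * ?N" using light by blast
      show "card L \<le> m" using L(2) qm by linarith
    qed (use V Col L in blast)+
    then obtain p where p: "p ` ?I \<subseteq> V" "good_box s ?I X Col A' L p" "\<forall>g. (\<forall>i<s. g i < T) \<longrightarrow> cell p g s \<in> G"
      using EN \<gamma>pos[of ?j] by blast
    let ?P = "p ` ?I"
    have gb: "inj_on p ?I" "?P \<inter> L = {}" "\<forall>S\<in>nsets ?P s. S \<in> X \<and> Col S \<inter> ?P = {} \<and>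
        (\<forall>S'\<in>nsets ?P s. S \<inter> S' = {} \<longrightarrow> Col S \<inter> A' S' = {})"
      using p(2) unfolding good_box_def by blast+
    have ring: "\<exists>f v. cell_ring (2 * \<kappa>) s f v \<and> (\<forall>i<2 * \<kappa>. f i \<in> D \<and> L \<subseteq> A (f i) \<and> f i \<subseteq> ?P)"
      if \<kappa>2: "2 \<le> \<kappa>" and \<kappa>: "2 * \<kappa> \<le> T" for \<kappa>
    proof (intro exI conjI)
      let ?f = "\<lambda>q. p ` (\<lambda>i. (i, ring_pos \<kappa> q i)) ` {..<s}"
      show "cell_ring (2 * \<kappa>) s ?f (\<lambda>q. p (ring_link q))" by (rule cell_ring_of_box[OF gb(1) s \<kappa> \<kappa>2])
      show "\<forall>i<2 * \<kappa>. ?f i \<in> D \<and> L \<subseteq> A (?f i) \<and> ?f i \<subseteq> ?P"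
      proof (intro allI impI)
        fix i assume i: "i < 2 * \<kappa>"
        have lt: "ring_pos \<kappa> i x < T" for x using ring_pos_less[OF i, of x] \<kappa> by linarith
        then have "cell p (ring_pos \<kappa> i) s \<in> G" using p(3) by blast
        moreover have "set (cell p (ring_pos \<kappa> i) s) = ?f i" unfolding cell_def by auto
        ultimately have "?f i \<in> DL" unfolding G_def by simp
        moreover have "?f i \<subseteq> ?P" using lt by auto
        ultimately show "?f i \<in> D \<and> L \<subseteq> A (?f i) \<and> ?f i \<subseteq> ?P" unfolding DL_def by blast
      qed
    qed
    have "g * ?N \<le> \<gamma> ?j * ?N" using g(2)[OF L(2)] N by (intro mult_right_mono) auto
    then have dense: "g * ?N \<le> real (card {S \<in> D. L \<subseteq> A S})" using L(3) by linarith
    have col: "\<forall>S\<in>nsets ?P s. S \<in> X \<and> Col S \<inter> ?P = {} \<and>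
           (\<forall>S'\<in>nsets ?P s. S \<inter> S' = {} \<longrightarrow> S' \<in> D \<longrightarrow> L \<subseteq> A S' \<longrightarrow> card L < q \<longrightarrow> Col S \<inter> (A S' - L) = {})"
    proof (intro ballI conjI impI)
      fix S assume S: "S \<in> nsets ?P s"
      show "S \<in> X" "Col S \<inter> ?P = {}" using gb(3) S by blast+
      fix S' assume S': "S' \<in> nsets ?P s" "S \<inter> S' = {}" "S' \<in> D" "L \<subseteq> A S'" "card L < q"
      have "Col S \<inter> A' S' = {}" using gb(3) S S'(1,2) by blast
      moreover have "A' S' = A S' - L" unfolding A'_def DL_def using S' by simp
      ultimately show "Col S \<inter> (A S' - L) = {}" by simp
    qed
    have "core_box s q T V D X Col A L ?P" unfolding core_box_def
      by (intro conjI L(1,2) p(1) gb(2) col allI impI ring)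
    then show "\<exists>L P. g * ?N \<le> real (card {S \<in> D. L \<subseteq> A S}) \<and> core_box s q T V D X Col A L P"
      using dense by (intro exI conjI)
  qed
qed

section \<open>Full hypergraphs have small shadows\<close>

text \<open>
The first and the last cell of a path are linked by a common colour, so any length is possible.
\<close>

lemma ring_jump_cycle:
  assumes ring: "cell_ring K s f v" and k: "4 \<le> k" "k < K"
    and F: "\<And>q. q < k \<Longrightarrow> insert (col q) (f q) \<in> F"
    and off: "\<And>q q'. q < k \<Longrightarrow> q' < k \<Longrightarrow> col q \<notin> f q'"
    and ends: "col 0 = col (k - 1)"
    and non: "\<And>q q'. Suc q < q' \<Longrightarrow> q' < k \<Longrightarrow> \<not> (q = 0 \<and> Suc q' = k) \<Longrightarrow> col q \<noteq> col q'"
  shows "has_cycle k F"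
proof (rule has_cycle_coloured[where f = f and col = col])
  fix q assume "Suc q < k"
  then have "f q \<inter> f (Suc q) = {v (Suc q)}" using cell_ring_inter(1)[OF ring, of q] k by simp
  then show "f q \<inter> f (Suc q) \<noteq> {} \<or> col q = col (Suc q)" by simp
next
  fix q q' assume q: "Suc q < q'" "q' < k" "\<not> (q = 0 \<and> Suc q' = k)"
  have "f q \<inter> f q' = {}" using q k by (intro cell_ring_inter(3)[OF ring]) auto
  then show "f q \<inter> f q' = {} \<and> col q \<noteq> col q'" using non[OF q] by simp
qed (use F off ends in auto)

lemma ring_cycle:
  assumes ring: "cell_ring k s f v" and k: "4 \<le> k"
    and F: "\<And>q. q < k \<Longrightarrow> insert (col q) (f q) \<in> F"
    and off: "\<And>q q'. q < k \<Longrightarrow> q' < k \<Longrightarrow> col q \<notin> f q'"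
    and non: "\<And>q q'. Suc q < q' \<Longrightarrow> q' < k \<Longrightarrow> \<not> (q = 0 \<and> Suc q' = k) \<Longrightarrow> col q \<noteq> col q'"
  shows "has_cycle k F"
proof (rule has_cycle_coloured[where f = f and col = col])
  fix q assume "Suc q < k"
  then have "f q \<inter> f (Suc q) = {v (Suc q)}" using cell_ring_inter(1)[OF ring, of q] k by simp
  then show "f q \<inter> f (Suc q) \<noteq> {} \<or> col q = col (Suc q)" by simp
next
  show "f 0 \<inter> f (k - 1) \<noteq> {} \<or> col 0 = col (k - 1)" using cell_ring_inter(2)[OF ring] k by simp
next
  fix q q' assume q: "Suc q < q'" "q' < k" "\<not> (q = 0 \<and> Suc q' = k)"
  have "f q \<inter> f q' = {}" using q k by (intro cell_ring_inter(3)[OF ring]) auto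
  then show "f q \<inter> f q' = {} \<and> col q \<noteq> col q'" using non[OF q] by simp
qed (use F off in auto)

text \<open>
The cell \<open>f 0\<close> with its colour \<open>x\<close> is replaced by two edges through \<open>x\<close>, one for each of its two links. In each of
them the other link has been exchanged for a new vertex, so that a ring of even length \<open>K\<close> yields a
cycle of odd length \<open>Suc K\<close>.
\<close>

lemma ring_odd_cycle:
  assumes ring: "cell_ring K s f v" and K: "4 \<le> K"
    and e1: "insert w1 (insert x (f 0) - {v 1}) \<in> F" and e2: "insert w2 (insert x (f 0) - {v 0}) \<in> F"
    and F: "\<And>q. 0 < q \<Longrightarrow> q < K \<Longrightarrow> insert (y q) (f q) \<in> F"
    and offx: "\<And>q. q < K \<Longrightarrow> x \<notin> f q" and offw: "\<And>q. q < K \<Longrightarrow> w1 \<notin> f q" "\<And>q. q < K \<Longrightarrow> w2 \<notin> f q"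
    and offy: "\<And>q q'. 0 < q \<Longrightarrow> q < K \<Longrightarrow> q' < K \<Longrightarrow> y q \<notin> f q'"
    and y1: "\<And>q. 0 < q \<Longrightarrow> q < K - 1 \<Longrightarrow> y q \<noteq> x \<and> y q \<noteq> w1"
    and y2: "\<And>q. 1 < q \<Longrightarrow> q < K \<Longrightarrow> y q \<noteq> x \<and> y q \<noteq> w2"
    and non: "\<And>q q'. 0 < q \<Longrightarrow> Suc q < q' \<Longrightarrow> q' < K \<Longrightarrow> y q \<noteq> y q'"
  shows "has_cycle (Suc K) F"
proof -
  have i01: "f 0 \<inter> f 1 = {v 1}" using cell_ring_inter(1)[OF ring, of 0] K by simp
  have i0l: "f 0 \<inter> f (K - 1) = {v 0}" using cell_ring_inter(2)[OF ring] K by simp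
  have dis: "f q \<inter> f q' = {}" if "Suc q < q'" "q' < K" "\<not> (q = 0 \<and> Suc q' = K)" for q q'
    using cell_ring_inter(3)[OF ring that] .
  have "v 1 \<in> f 0 \<inter> f 1" "v 0 \<in> f 0 \<inter> f (K - 1)" unfolding i01 i0l by simp_all
  then have mem: "v 0 \<in> f 0" "v 1 \<in> f 0" "v 1 \<in> f 1" "v 0 \<in> f (K - 1)" by simp_all
  have v01: "v 0 \<noteq> v 1"
  proof
    assume "v 0 = v 1"
    then have "v 1 \<in> f 1 \<inter> f (K - 1)" using mem(3,4) by simp
    moreover have "f 1 \<inter> f (K - 1) = {}" using K by (intro dis) auto
    ultimately show False by blast
  qed
  define E where "E i = (if i = 0 then insert w1 (insert x (f 0) - {v 1}) else
     if i = 1 then insert w2 (insert x (f 0) - {v 0}) else insert (y (i - 1)) (f (i - 1)))" for i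
  show ?thesis
  proof (rule has_cycleI[where e = E])
    show "E i \<in> F" if i: "i < Suc K" for i
    proof -
      consider "i = 0" | "i = 1" | "0 < i - 1" "i - 1 < K" using i by linarith
      then show ?thesis
      proof cases
        case 3
        then have "E i = insert (y (i - 1)) (f (i - 1))" unfolding E_def by auto
        then show ?thesis using F[OF 3] by simp
      qed (use e1 e2 in \<open>simp_all add: E_def\<close>)
    qed
    show "E i \<inter> E (Suc i) \<noteq> {}" if "Suc i < Suc K" for i
    proof -
      consider "i = 0" | "i = 1" | "2 \<le> i" by linarith
      then show ?thesis
      proof cases
        case 1
        have "x \<in> insert w1 (insert x (f 0) - {v 1}) \<inter> insert w2 (insert x (f 0) - {v 0})"
          using offx[of 0] K mem by auto
        then show ?thesis using 1 unfolding E_def by auto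
      next
        case 2
        have "E 1 = insert w2 (insert x (f 0) - {v 0})" "E 2 = insert (y 1) (f 1)" unfolding E_def by auto
        then have "v 1 \<in> E 1" "v 1 \<in> E 2" using mem v01 by auto
        then show ?thesis unfolding 2 by (auto simp: numeral_2_eq_2)
      next
        case 3
        have "f (i - 1) \<inter> f (Suc (i - 1)) = {v (Suc (i - 1))}"
          using 3 that by (intro cell_ring_inter(1)[OF ring]) auto
        moreover have "Suc (i - 1) = i" using 3 by simp
        ultimately have "v i \<in> f (i - 1)" "v i \<in> f i" by auto
        moreover have "E i = insert (y (i - 1)) (f (i - 1))" "E (Suc i) = insert (y i) (f i)"
          using 3 unfolding E_def by auto
        ultimately show ?thesis by blast
      qed
    qed
    have "v 0 \<in> E 0 \<inter> E K" using mem v01 K unfolding E_def by auto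
    then show "E 0 \<inter> E (Suc K - 1) \<noteq> {}" by auto
    show "E i \<inter> E j = {}" if ij: "Suc i < j" "j < Suc K" "\<not> (i = 0 \<and> Suc j = Suc K)" for i j
    proof -
      have j: "2 \<le> j" "j - 1 < K" "0 < j - 1" using ij by linarith+
      have Ej: "E j = insert (y (j - 1)) (f (j - 1))" using j unfolding E_def by auto
      consider "i = 0" | "i = 1" | "2 \<le> i" by linarith
      then show ?thesis
      proof cases
        case 1
        have jK: "j - 1 < K - 1" using ij 1 by linarith
        have "f 0 \<inter> f (j - 1) \<subseteq> {v 1}"
        proof (cases "j - 1 = 1")
          case False
          then have "f 0 \<inter> f (j - 1) = {}" using j jK by (intro dis) auto
          then show ?thesis by simp
        qed (use i01 in simp)
        moreover have "y (j - 1) \<noteq> x \<and> y (j - 1) \<noteq> w1" using y1 j jK by blast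
        moreover have "y (j - 1) \<notin> f 0" using offy[of "j - 1" 0] j K by simp
        moreover have "x \<notin> f (j - 1)" "w1 \<notin> f (j - 1)" using offx offw j by blast+
        moreover have "E 0 = insert w1 (insert x (f 0) - {v 1})" unfolding E_def by simp
        ultimately show ?thesis unfolding 1 Ej by auto
      next
        case 2
        have j1: "1 < j - 1" using ij 2 by linarith
        have "f 0 \<inter> f (j - 1) \<subseteq> {v 0}"
        proof (cases "j - 1 = K - 1")
          case False
          then have "f 0 \<inter> f (j - 1) = {}" using j j1 by (intro dis) auto
          then show ?thesis by simp
        qed (use i0l in simp)
        moreover have "y (j - 1) \<noteq> x \<and> y (j - 1) \<noteq> w2" using y2 j j1 by blast
        moreover have "y (j - 1) \<notin> f 0" using offy[of "j - 1" 0] j K by simp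
        moreover have "x \<notin> f (j - 1)" "w2 \<notin> f (j - 1)" using offx offw j by blast+
        moreover have "E 1 = insert w2 (insert x (f 0) - {v 0})" unfolding E_def by simp
        ultimately show ?thesis unfolding 2 Ej by auto
      next
        case 3
        have Ei: "E i = insert (y (i - 1)) (f (i - 1))" using 3 unfolding E_def by auto
        have "f (i - 1) \<inter> f (j - 1) = {}" using 3 ij j by (intro dis) auto
        moreover have "y (i - 1) \<noteq> y (j - 1)" using 3 ij j by (intro non) auto
        moreover have "y (i - 1) \<notin> f (j - 1)" "y (j - 1) \<notin> f (i - 1)" 
        proof -
          have "0 < i - 1" "i - 1 < K" using 3 ij by linarith+
          then show "y (i - 1) \<notin> f (j - 1)" "y (j - 1) \<notin> f (i - 1)" using offy j by blast+
        qed
        ultimately show ?thesis unfolding Ei Ej by auto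
      qed
    qed
  qed
qed

text \<open>
Suppose that the shadow is dense, choose a list of \<open>l + 1\<close> colours for each of its sets, and take a core \<open>L\<close> of these
lists. If \<open>L\<close> is nonempty, a colour in \<open>L\<close> closes a path of cells whose interior is coloured by rare colours or, if
\<open>L\<close> is a full list, by the other \<open>l\<close> elements of \<open>L\<close>, each used for two consecutive cells. If \<open>L\<close> is empty, all
colours are rare; then an even ring is a cycle for even \<open>k\<close>. For odd \<open>k\<close> one cell is split in two by means
of the fullness of \<open>F\<close>, and \<open>l + 1 \<ge> 3\<close> colours suffice to avoid the two edges that arise.
\<close>

lemma full_shadow_small:
  fixes \<delta> :: real
  assumes r: "3 \<le> r" and k: "4 \<le> k" and l: "l = (k - 1) div 2" and \<delta>: "0 < \<delta>"
  shows "\<exists>n0. \<forall>(V :: 'a set) F. finite V \<longrightarrow> n0 \<le> card V \<longrightarrow> F \<subseteq> nsets V r \<longrightarrow> full (Suc l) F \<longrightarrow> \<not> has_cycle k F \<longrightarrow>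
     real (card {S \<in> nsets V (r - 1). nbr F S \<noteq> {}}) \<le> \<delta> * real (card V) ^ (r - 1)"
proof -
  define s where "s = r - 1"
  define q where "q = Suc l"
  define m where "m = q + q * s"
  have s: "2 \<le> s" using r by (simp add: s_def)
  have l1: "1 \<le> l" using k l by linarith
  have kl: "k \<le> 2 * l + 2" "odd k \<Longrightarrow> k = 2 * l + 1" "even k \<Longrightarrow> k = 2 * l + 2" using k l by presburger+
  have qm: "q \<le> m" by (simp add: m_def)
  from core_ring[OF s \<delta> qm, of "2 * k", where 'a = 'a]
  obtain \<gamma> \<epsilon> n0 where pos: "0 < \<gamma>" "0 < \<epsilon>" and core: "\<forall>(V :: 'a set) D X Col A. core_hypotheses s q m \<delta> \<epsilon> n0 V D X Col A \<longrightarrow>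
     (\<exists>L P. \<gamma> * real (card V) ^ s \<le> real (card {S \<in> D. L \<subseteq> A S}) \<and> core_box s q (2 * k) V D X Col A L P)"
    by (elim exE conjE) (rule that)
  show ?thesis
  proof (rule exI[of _ n0], intro allI impI, rule ccontr)
    fix V :: "'a set" and F
    assume V: "finite V" "n0 \<le> card V" and F: "F \<subseteq> nsets V r" and full: "full (Suc l) F" and free: "\<not> has_cycle k F"
      and big: "\<not> real (card {S \<in> nsets V (r - 1). nbr F S \<noteq> {}}) \<le> \<delta> * real (card V) ^ (r - 1)"
    define D where "D = {S \<in> nsets V s. nbr F S \<noteq> {}}"
    have nb: "finite (nbr F S)" for S by (rule finite_nbr[OF F V(1)])
    have nq: "q \<le> card (nbr F S)" if S: "S \<in> D" for S
    proof -
      obtain x where x: "x \<notin> S" "insert x S \<in> F" using S unfolding D_def nbr_def by blast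
      then have "Suc l \<le> card (nbr F (insert x S - {x}))" using full unfolding full_def by blast
      then show ?thesis using x unfolding q_def by simp
    qed
    define A where "A S = (SOME B. B \<subseteq> nbr F S \<and> card B = q)" for S
    have A: "A S \<subseteq> nbr F S \<and> card (A S) = q" if "S \<in> D" for S
    proof -
      have "\<exists>B. B \<subseteq> nbr F S \<and> card B = q" using obtain_subset_with_card_n[OF nq[OF that]] by blast
      then show ?thesis unfolding A_def by (rule someI_ex)
    qed
    have Afin: "finite (A S)" if "S \<in> D" for S using A[OF that] nb finite_subset by blast
    have Aedge: "insert x S \<in> F \<and> x \<notin> S" if "S \<in> D" "x \<in> A S" for S x
      using A[OF that(1)] that(2) unfolding nbr_def by blast
    \<comment> \<open>\<open>W S x b\<close> is a vertex that can replace \<open>b\<close> in the edge \<open>insert x S\<close>\<close>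
    define W where "W S x b = (SOME w. w \<notin> insert x S \<and> insert w (insert x S - {b}) \<in> F)" for S x b
    have W: "W S x b \<notin> insert x S \<and> insert (W S x b) (insert x S - {b}) \<in> F"
      if S: "S \<in> D" "x \<in> A S" "b \<in> S" for S x b
    proof -
      have "Suc l \<le> card (nbr F (insert x S - {b}))"
        using full Aedge[OF S(1,2)] S(3) unfolding full_def by blast
      then have "\<not> nbr F (insert x S - {b}) \<subseteq> {b}"
        using l1 card_mono[of "{b}" "nbr F (insert x S - {b})"] by auto
      then obtain w where "w \<in> nbr F (insert x S - {b})" "w \<noteq> b" by blast
      then have "w \<notin> insert x S \<and> insert w (insert x S - {b}) \<in> F" unfolding nbr_def by blast
      then show ?thesis unfolding W_def by (rule someI)
    qed
    define Col where "Col S = (if S \<in> D then A S \<union> (\<lambda>(x, b). W S x b) ` (A S \<times> S) else {})" for S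
    have Col: "finite (Col S) \<and> card (Col S) \<le> m \<and> Col S \<inter> S = {}" for S
    proof (cases "S \<in> D")
      case True
      have fS: "finite S" "card S = s" using True unfolding D_def nsets_def by auto
      have "card ((\<lambda>(x, b). W S x b) ` (A S \<times> S)) \<le> card (A S \<times> S)"
        using Afin[OF True] fS by (intro card_image_le) auto
      also have "\<dots> = q * s" using A[OF True] fS by (simp add: card_cartesian_product)
      finally have "card (Col S) \<le> m"
        using card_Un_le[of "A S" "(\<lambda>(x, b). W S x b) ` (A S \<times> S)"] A[OF True] True
        unfolding Col_def m_def by simp
      moreover have "finite (Col S)" using Afin[OF True] fS True unfolding Col_def by simp
      moreover have "Col S \<inter> S = {}"
      proof -
        have "A S \<inter> S = {}" using Aedge[OF True] by blast
        moreover have "W S x b \<notin> S" if "x \<in> A S" "b \<in> S" for x b using W[OF True that] by blast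
        ultimately show ?thesis using True unfolding Col_def by auto
      qed
      ultimately show ?thesis by blast
    qed (simp add: Col_def)
    have "D \<subseteq> nsets V s" unfolding D_def by blast
    moreover have "\<delta> * real (card V) ^ s \<le> real (card D)" using big unfolding D_def s_def by linarith
    moreover have "\<forall>S\<in>D. finite (A S) \<and> card (A S) = q" using A Afin by blast
    moreover have "real (card (nsets V s - UNIV)) \<le> \<epsilon> * real (card V) ^ s" using pos by simp
    moreover have "\<forall>S\<in>nsets V s. finite (Col S) \<and> card (Col S) \<le> m \<and> Col S \<inter> S = {}" using Col by blast
    ultimately have "core_hypotheses s q m \<delta> \<epsilon> n0 V D UNIV Col A"
      unfolding core_hypotheses_def using V by (intro conjI)
    then obtain L P where box: "core_box s q (2 * k) V D UNIV Col A L P" using core by blast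
    note L = core_boxD(1,2,4)[OF box] and colP = core_boxD(6)[OF box] and light = core_boxD(7)[OF box]
    have ringex: "\<exists>f v. cell_ring (2 * \<kappa>) s f v \<and> (\<forall>i<2 * \<kappa>. f i \<in> D \<and> L \<subseteq> A (f i) \<and> f i \<subseteq> P)"
      if "2 \<le> \<kappa>" "\<kappa> \<le> k" for \<kappa>
      using that by (intro core_boxD(8)[OF box]) auto
    have inP: "S \<in> nsets P s" if "S \<in> D" "S \<subseteq> P" for S using that unfolding D_def nsets_def by blast
    have ACol: "A S \<subseteq> Col S" if "S \<in> D" for S using that unfolding Col_def by simp
    have "has_cycle k F"
    proof (cases "L = {}")
      case True
      have lt: "card L < q" using True unfolding q_def by simp
      show ?thesis
      proof (cases "even k")
        case ev: True
        then have k2: "2 * (k div 2) = k" by simp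
        obtain f v where ring: "cell_ring k s f v" and f: "\<And>i. i < k \<Longrightarrow> f i \<in> D \<and> f i \<subseteq> P"
        proof -
          have "2 \<le> k div 2" "k div 2 \<le> k" using k by linarith+
          from ringex[OF this] show ?thesis unfolding k2 using that by blast
        qed
        have "\<exists>y. y \<in> A (f i)" if "i < k" for i
        proof -
          have "A (f i) \<noteq> {}" using A[of "f i"] f[OF that] unfolding q_def by auto
          then show ?thesis by blast
        qed
        then obtain y where y: "\<And>i. i < k \<Longrightarrow> y i \<in> A (f i)" by metis
        show ?thesis
        proof (rule ring_cycle[OF ring k, of y])
          show "insert (y i) (f i) \<in> F" if "i < k" for i using Aedge f y that by blast
          show "y i \<notin> f j" if "i < k" "j < k" for i j
            using colP[OF inP, of "f i"] ACol[of "f i"] f[OF that(1)] f[OF that(2)] y[OF that(1)] by blast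
          show "y i \<noteq> y j" if ij: "Suc i < j" "j < k" "\<not> (i = 0 \<and> Suc j = k)" for i j
          proof -
            have i: "i < k" using ij by simp
            have "Col (f i) \<inter> (A (f j) - L) = {}"
              using f[OF i] f[OF ij(2)] True lt by (intro light inP cell_ring_inter(3)[OF ring ij]) auto
            moreover have "y i \<in> Col (f i)" using y[OF i] ACol[of "f i"] f[OF i] by blast
            ultimately show ?thesis using y[OF ij(2)] True by (metis disjoint_iff Diff_empty)
          qed
        qed
      next
        case False
        have kK: "k = Suc (2 * l)" "2 \<le> l" using kl(2)[OF False] k by linarith+
        let ?K = "2 * l"
        obtain f v where ring: "cell_ring ?K s f v" and f: "\<And>i. i < ?K \<Longrightarrow> f i \<in> D \<and> f i \<subseteq> P"
          using ringex[of l] kK by auto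
        have K4: "4 \<le> ?K" using kK by simp
        have D0: "f 0 \<in> D" "f 0 \<subseteq> P" using f[of 0] K4 by auto
        have "f 0 \<inter> f 1 = {v 1}" using cell_ring_inter(1)[OF ring, of 0] K4 by simp
        moreover have "f 0 \<inter> f (?K - 1) = {v 0}" using cell_ring_inter(2)[OF ring] K4 by simp
        ultimately have v: "v 0 \<in> f 0" "v 1 \<in> f 0" by blast+
        have "A (f 0) \<noteq> {}" using A[OF D0(1)] unfolding q_def by auto
        then obtain x where x: "x \<in> A (f 0)" by blast
        define w1 where "w1 = W (f 0) x (v 1)"
        define w2 where "w2 = W (f 0) x (v 0)"
        have w: "w1 \<in> Col (f 0)" "w2 \<in> Col (f 0)" "x \<in> Col (f 0)"
          using D0 x v unfolding Col_def w1_def w2_def by auto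
        \<comment> \<open>each list has \<open>l + 1 \<ge> 3\<close> colours, because \<open>k\<close> is odd and hence at least \<open>5\<close>\<close>
        have "\<exists>y. y \<in> A (f i) \<and> y \<noteq> x \<and> y \<noteq> (if i = 1 then w1 else w2)" if "i < ?K" for i
        proof -
          have "card {x, if i = 1 then w1 else w2} \<le> 2" by (simp add: card_insert_if)
          moreover have "3 \<le> card (A (f i))" using A[of "f i"] f[OF that] kK unfolding q_def by simp
          ultimately have "\<not> A (f i) \<subseteq> {x, if i = 1 then w1 else w2}"
            using card_mono[of "{x, if i = 1 then w1 else w2}" "A (f i)"] by fastforce
          then show ?thesis by blast
        qed
        then obtain y where y: "\<And>i. i < ?K \<Longrightarrow> y i \<in> A (f i) \<and> y i \<noteq> x \<and> y i \<noteq> (if i = 1 then w1 else w2)" by metis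
        have dis: "Col (f i) \<inter> A (f j) = {}" if ij: "i < ?K" "j < ?K" "f i \<inter> f j = {}" for i j
          using light[of "f i" "f j"] inP f[OF ij(1)] f[OF ij(2)] ij(3) True lt by auto
        have "has_cycle (Suc ?K) F"
        proof (rule ring_odd_cycle[OF ring K4, of w1 x F w2 y])
          show "insert w1 (insert x (f 0) - {v 1}) \<in> F" "insert w2 (insert x (f 0) - {v 0}) \<in> F"
            using W[OF D0(1) x] v unfolding w1_def w2_def by blast+
          show "insert (y i) (f i) \<in> F" if "0 < i" "i < ?K" for i using Aedge f y that by blast
          have C0: "Col (f 0) \<inter> P = {}" using colP inP D0 by blast
          show "x \<notin> f i" "w1 \<notin> f i" "w2 \<notin> f i" if "i < ?K" for i using C0 w f[OF that] by blast+
          show "y i \<notin> f j" if "0 < i" "i < ?K" "j < ?K" for i j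
            using colP[OF inP, of "f i"] ACol[of "f i"] f[OF that(2)] f[OF that(3)] y[OF that(2)] by blast
          show "y i \<noteq> x \<and> y i \<noteq> w1" if i: "0 < i" "i < ?K - 1" for i
          proof (cases "i = 1")
            case False
            have iK: "i < ?K" using i by simp
            have "f 0 \<inter> f i = {}" using i False by (intro cell_ring_inter(3)[OF ring]) auto
            then have "Col (f 0) \<inter> A (f i) = {}" using iK K4 by (intro dis) auto
            then show ?thesis using y[OF iK] w by blast
          qed (use y[of 1] K4 in auto)
          show "y i \<noteq> x \<and> y i \<noteq> w2" if i: "1 < i" "i < ?K" for i using y[OF i(2)] i by auto
          show "y i \<noteq> y j" if ij: "0 < i" "Suc i < j" "j < ?K" for i j
          proof -
            have i: "i < ?K" using ij by simp
            have "f i \<inter> f j = {}" using ij by (intro cell_ring_inter(3)[OF ring]) auto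
            then have "Col (f i) \<inter> A (f j) = {}" using i ij by (intro dis) auto
            moreover have "y i \<in> Col (f i)" using y[OF i] ACol[of "f i"] f[OF i] by blast
            moreover have "y j \<in> A (f j)" using y[OF ij(3)] by simp
            ultimately show ?thesis by (metis disjoint_iff)
          qed
        qed
        then show ?thesis using kK by simp
      qed
    next
      case False
      then obtain x0 where x0: "x0 \<in> L" by blast
      obtain f v where ring: "cell_ring (2 * k) s f v" and f: "\<And>i. i < 2 * k \<Longrightarrow> f i \<in> D \<and> L \<subseteq> A (f i) \<and> f i \<subseteq> P"
        using ringex[of k] k by auto
      have fk: "f i \<in> D" "L \<subseteq> A (f i)" "f i \<subseteq> P" if "i < k" for i using f[of i] that by auto
      have "\<exists>c. (\<forall>i<k. c i \<in> A (f i) \<and> c i \<noteq> x0) \<and>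
         (\<forall>i j. 0 < i \<longrightarrow> Suc i < j \<longrightarrow> j < k - 1 \<longrightarrow> c i \<noteq> c j)"
      proof (cases "card L < q")
        case True
        have "\<exists>y. y \<in> A (f i) - L" if "i < k" for i
        proof -
          have "\<not> A (f i) \<subseteq> L" using A[OF fk(1)[OF that]] card_mono[OF L(1), of "A (f i)"] True by auto
          then show ?thesis by blast
        qed
        then obtain y where y: "\<And>i. i < k \<Longrightarrow> y i \<in> A (f i) - L" by metis
        show ?thesis
        proof (intro exI[of _ y] conjI allI impI)
          fix i j assume ij: "0 < i" "Suc i < j" "j < k - 1"
          have i: "i < k" and j: "j < k" using ij by simp_all
          have "f i \<inter> f j = {}" using ij by (intro cell_ring_inter(3)[OF ring]) auto
          then have "Col (f i) \<inter> (A (f j) - L) = {}"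
            using fk[OF i] fk[OF j] True by (intro light inP) auto
          moreover have "y i \<in> Col (f i)" using y[OF i] ACol[OF fk(1)[OF i]] by blast
          ultimately show "y i \<noteq> y j" using y[OF j] by (metis disjoint_iff)
        qed (use y x0 in auto)
      next
        case Lq: False
        then have "card (L - {x0}) = l" using L x0 unfolding q_def by simp
        then obtain h where h: "bij_betw h {0..<l} (L - {x0})"
          using ex_bij_betw_nat_finite[of "L - {x0}"] L by auto
        have hm: "h i \<in> L - {x0}" if "i < l" for i using h that unfolding bij_betw_def by auto
        have lt: "(i - 1) div 2 < l" if "i < k - 1" for i using that kl(1) k l1 by linarith
        \<comment> \<open>consecutive interior cells \<open>2 j + 1\<close> and \<open>2 j + 2\<close> receive the colour \<open>h j\<close>; the minimum only serves to keep the last index in range\<close>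
        define c where "c i = h (min (l - 1) ((i - 1) div 2))" for i
        show ?thesis
        proof (intro exI[of _ c] conjI allI impI)
          fix i assume i: "i < k"
          have "c i \<in> L - {x0}" unfolding c_def using l1 by (intro hm) auto
          then show "c i \<in> A (f i)" "c i \<noteq> x0" using fk(2)[OF i] by auto
        next
          fix i j assume ij: "0 < i" "Suc i < j" "j < k - 1"
          have i: "(i - 1) div 2 < l" and j: "(j - 1) div 2 < l" using lt ij by simp_all
          have "(i - 1) div 2 \<noteq> (j - 1) div 2" using ij by linarith
          then have "h ((i - 1) div 2) \<noteq> h ((j - 1) div 2)"
            using h i j unfolding bij_betw_def by (auto dest: inj_onD)
          moreover have "min (l - 1) ((i - 1) div 2) = (i - 1) div 2" "min (l - 1) ((j - 1) div 2) = (j - 1) div 2"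
            using i j by linarith+
          ultimately show "c i \<noteq> c j" unfolding c_def by simp
        qed
      qed
      then obtain c where c: "\<And>i. i < k \<Longrightarrow> c i \<in> A (f i)" "\<And>i. i < k \<Longrightarrow> c i \<noteq> x0"
        "\<And>i j. 0 < i \<Longrightarrow> Suc i < j \<Longrightarrow> j < k - 1 \<Longrightarrow> c i \<noteq> c j" by blast
      let ?col = "\<lambda>i. if i = 0 \<or> i = k - 1 then x0 else c i"
      show ?thesis
      proof (rule ring_jump_cycle[OF ring k, of ?col])
        show "k < 2 * k" using k by simp
        have mem: "?col i \<in> A (f i)" if "i < k" for i using c(1)[OF that] fk(2)[OF that] x0 by auto
        show "insert (?col i) (f i) \<in> F" if "i < k" for i using Aedge[OF fk(1)[OF that] mem[OF that]] by blast
        show "?col i \<notin> f j" if ij: "i < k" "j < k" for i j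
        proof -
          have "?col i \<in> Col (f i)" using mem[OF ij(1)] ACol[OF fk(1)[OF ij(1)]] by blast
          moreover have "Col (f i) \<inter> P = {}" using fk[OF ij(1)] by (intro colP inP)
          ultimately show ?thesis using fk(3)[OF ij(2)] by blast
        qed
        show "?col i \<noteq> ?col j" if ij: "Suc i < j" "j < k" "\<not> (i = 0 \<and> Suc j = k)" for i j
        proof -
          have ik: "i < k" "i \<noteq> k - 1" "j \<noteq> 0" using ij by linarith+
          consider "i = 0" | "j = k - 1" "i \<noteq> 0" | "0 < i" "j < k - 1" using ij by linarith
          then show ?thesis
          proof cases
            case 1
            then have "j \<noteq> k - 1" using ij by linarith
            then show ?thesis using 1 ik c(2)[OF ij(2)] by auto
          next
            case 2
            then show ?thesis using ik c(2)[OF ik(1)] by auto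
          next
            case 3
            then show ?thesis using ik c(3)[OF 3(1) ij(1) 3(2)] by auto
          qed
        qed
      qed simp
    qed
    then show False using free by simp
  qed
qed

section \<open>Exchanging a frequent colour\<close>

lemma ring_link_only:
  assumes ring: "cell_ring K s f v" and K: "4 \<le> K" and q: "q < K" and i: "i < K" and mem: "v q \<in> f i"
  shows "i = q \<or> Suc i = q \<or> (q = 0 \<and> i = K - 1)"
proof (rule ccontr)
  assume no: "\<not> ?thesis"
  define p where "p = (if q = 0 then K - 1 else q - 1)"
  have vq: "v q \<in> f q \<inter> f p"
  proof (cases "q = 0")
    case True
    then show ?thesis using cell_ring_inter(2)[OF ring] K unfolding p_def by auto
  next
    case False
    then have "f (q - 1) \<inter> f (Suc (q - 1)) = {v (Suc (q - 1))}" using q by (intro cell_ring_inter(1)[OF ring]) auto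
    then show ?thesis using False unfolding p_def by auto
  qed
  have pat: "cyclic_pattern K f"
    unfolding cyclic_pattern_def
  proof (intro allI impI)
    fix i j assume "i < j" "j < K"
    then have "f i \<inter> f j = (if j = Suc i then {v j} else if i = 0 \<and> Suc j = K then {v 0} else {})"
      using ring unfolding cell_ring_def by simp
    then show "(f i \<inter> f j \<noteq> {}) = (j = Suc i \<or> i = 0 \<and> Suc j = K)" by simp
  qed
  have "p < K" "p \<noteq> q" "p \<noteq> i" "i \<noteq> q" using no q K unfolding p_def by (auto split: if_splits)
  then show False using pattern_three[OF pat K q _ i, of p "v q"] vq mem by auto
qed

text \<open>
All \<open>s\<close>-sets in \<open>P\<close> have a list \<open>Ls\<close> of \<open>l\<close> colours outside \<open>P\<close>. The list \<open>L1\<close> is the one that occurs on all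
cells of some ring, and \<open>x\<close> is a colour outside \<open>L1\<close> that occurs on some cells disjoint from this ring.
\<close>

locale exchange =
  fixes s k l :: nat and H :: "'a set set" and Ls :: "'a set \<Rightarrow> 'a set" and P L1 :: "'a set" and x :: 'a
  assumes s: "2 \<le> s" and k: "4 \<le> k" and l: "l = (k - 1) div 2"
    and L1: "finite L1" "card L1 = l" "x \<notin> L1"
    and list: "\<And>S. S \<in> nsets P s \<Longrightarrow> card (Ls S) = l"
    and edge: "\<And>S c. S \<in> nsets P s \<Longrightarrow> c \<in> Ls S \<Longrightarrow> insert c S \<in> H"
    and off: "\<And>S. S \<in> nsets P s \<Longrightarrow> Ls S \<inter> P = {}"
begin

text \<open>
A closed chain of cells whose two ends share a colour \<open>z\<close> outside \<open>L1\<close>. The interior cells have list \<open>L1\<close>, except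
perhaps the outermost two; \<open>l\<close> colours suffice for them because two consecutive cells receive the same colour. As a
consequence, the cells \<open>g 1\<close> and \<open>g 2\<close> need not meet if both have list \<open>L1\<close>, which changes the parity of
the lengths that can be reached.
\<close>

lemma exchange_core:
  assumes g: "\<And>i. i < k \<Longrightarrow> g i \<in> nsets P s"
    and dis: "\<And>i j. Suc i < j \<Longrightarrow> j < k \<Longrightarrow> \<not> (i = 0 \<and> Suc j = k) \<Longrightarrow> g i \<inter> g j = {}"
    and con: "\<And>i. Suc i < k \<Longrightarrow> g i \<inter> g (Suc i) \<noteq> {} \<or> i = 1 \<and> Ls (g 1) = L1 \<and> Ls (g 2) = L1"
    and z: "z \<in> Ls (g 0)" "z \<in> Ls (g (k - 1))" "z \<notin> L1"
    and mid: "\<And>i. 1 < i \<Longrightarrow> i < k - 2 \<Longrightarrow> Ls (g i) = L1"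
    and one: "Ls (g 1) = L1 \<or> z \<notin> Ls (g 1)" and two: "Ls (g (k - 2)) = L1 \<or> z \<notin> Ls (g (k - 2))"
    and common: "5 \<le> k \<Longrightarrow> Ls (g 1) \<inter> Ls (g (k - 2)) \<subseteq> L1"
  shows "has_cycle k H"
proof -
  have kl: "k \<le> 2 * l + 2" "1 \<le> l" using k l by linarith+
  obtain h where h: "bij_betw h {0..<l} L1"
    using ex_bij_betw_nat_finite[OF L1(1)] L1(2) by auto
  have hm: "h i \<in> L1" if "i < l" for i using h that unfolding bij_betw_def by auto
  have hi: "h i \<noteq> h j" if "i < l" "j < l" "i \<noteq> j" for i j
    using h that unfolding bij_betw_def inj_on_def by auto
  have out: "\<exists>y. y \<in> Ls (g i) - L1" if i: "i < k" and ne: "Ls (g i) \<noteq> L1" for i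
  proof (rule ccontr)
    assume "\<not> ?thesis"
    then have "Ls (g i) \<subseteq> L1" by blast
    then have "Ls (g i) = L1" using card_subset_eq[OF L1(1)] list[OF g[OF i]] L1(2) by simp
    then show False using ne by simp
  qed
  \<comment> \<open>lists different from \<open>L1\<close> contain a colour outside \<open>L1\<close>, which is used instead of the default colour\<close>
  define col where "col i = (if i = 0 \<or> i = k - 1 then z else if Ls (g i) = L1 then h ((i - 1) div 2)
     else (SOME y. y \<in> Ls (g i) - L1))" for i
  have lt: "(i - 1) div 2 < l" if "i < k - 1" for i using that kl k by linarith
  have ends: "col 0 = z" "col (k - 1) = z" by (simp_all add: col_def)
  have dflt: "col i = h ((i - 1) div 2) \<and> col i \<in> L1" if "0 < i" "i < k - 1" "Ls (g i) = L1" for i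
    using that hm[OF lt[OF that(2)]] by (simp add: col_def)
  have special: "col i \<in> Ls (g i) - L1" if "0 < i" "i < k - 1" "Ls (g i) \<noteq> L1" for i
  proof -
    have "i < k" using that by simp
    from someI_ex[OF out[OF this that(3)]] show ?thesis using that by (simp add: col_def)
  qed
  have colL: "col i \<in> Ls (g i)" if "i < k" for i
  proof -
    have "i = 0 \<or> i = k - 1 \<or> (0 < i \<and> i < k - 1)" using that by auto
    then consider "i = 0" | "i = k - 1" | "0 < i" "i < k - 1" by blast
    then show ?thesis
    proof cases
      case 3
      then show ?thesis using dflt[OF 3] special[OF 3] by (cases "Ls (g i) = L1") auto
    qed (use z ends in simp_all)
  qed
  have spec_z: "col i \<noteq> z" if "0 < i" "i < k - 1" for i
  proof (cases "Ls (g i) = L1")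
    case True
    then show ?thesis using dflt[OF that True] z(3) by auto
  next
    case False
    then have "i = 1 \<or> i = k - 2" using mid[of i] that by linarith
    then have "z \<notin> Ls (g i)" using one two False by auto
    then show ?thesis using special[OF that False] by auto
  qed
  show ?thesis
  proof (rule has_cycle_coloured[where f = g and col = col])
    show "insert (col i) (g i) \<in> H" if "i < k" for i using edge[OF g[OF that] colL[OF that]] .
    show "col i \<notin> g j" if "i < k" "j < k" for i j
    proof -
      have "g j \<subseteq> P" using g[OF that(2)] unfolding nsets_def by blast
      then show ?thesis using off[OF g[OF that(1)]] colL[OF that(1)] by blast
    qed
    show "g i \<inter> g (Suc i) \<noteq> {} \<or> col i = col (Suc i)" if i: "Suc i < k" for i
    proof (cases "g i \<inter> g (Suc i) = {}")
      case True
      then have b: "i = 1" "Ls (g 1) = L1" "Ls (g 2) = L1" using con[OF i] by auto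
      have "col 1 = h 0" using dflt[of 1] b k by simp
      moreover have "col 2 = h 0" using dflt[of 2] b k by simp
      ultimately show ?thesis using b by (simp add: numeral_2_eq_2)
    qed simp
    show "g 0 \<inter> g (k - 1) \<noteq> {} \<or> col 0 = col (k - 1)" using ends by simp
    fix i j assume ij: "Suc i < j" "j < k" "\<not> (i = 0 \<and> Suc j = k)"
    have "col i \<noteq> col j"
    proof -
      consider "i = 0" "0 < j" "j < k - 1" | "j = k - 1" "0 < i" "i < k - 1" | "0 < i" "i < k - 1" "0 < j" "j < k - 1"
        using ij by linarith
      then show ?thesis
      proof cases
        case 1 then show ?thesis using spec_z[of j] ends by auto
      next
        case 2 then show ?thesis using spec_z[of i] ends by auto
      next
        case 3
        show ?thesis
        proof (cases "Ls (g i) = L1")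
          case Ti: True
          show ?thesis
          proof (cases "Ls (g j) = L1")
            case True
            have "(i - 1) div 2 \<noteq> (j - 1) div 2" using ij 3 by linarith
            then show ?thesis using dflt[OF 3(1,2) Ti] dflt[OF 3(3,4) True] hi lt 3 by auto
          next
            case False
            then show ?thesis using dflt[OF 3(1,2) Ti] special[OF 3(3,4) False] by auto
          qed
        next
          case Fi: False
          show ?thesis
          proof (cases "Ls (g j) = L1")
            case True
            then show ?thesis using special[OF 3(1,2) Fi] dflt[OF 3(3,4) True] by auto
          next
            case Fj: False
            have "i = 1 \<or> i = k - 2" "j = 1 \<or> j = k - 2" using mid[of i] mid[of j] Fi Fj 3 by linarith+
            then have "i = 1" "j = k - 2" "5 \<le> k" using ij 3 by linarith+
            then have "Ls (g i) \<inter> Ls (g j) \<subseteq> L1" using common by simp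
            then show ?thesis using special[OF 3(1,2) Fi] special[OF 3(3,4) Fj] by auto
          qed
        qed
      qed
    qed
    then show "g i \<inter> g j = {} \<and> col i \<noteq> col j" using dis[OF ij] by simp
  qed
qed

text \<open>
Two cells \<open>S0\<close>, \<open>S1\<close> with colour \<open>x\<close>, and two reservoirs of vertices for the cells that connect them to the
ring.
\<close>

definition arms_disjoint where
  "arms_disjoint K f S0 S1 R0 R1 \<longleftrightarrow> S0 \<inter> S1 = {} \<and> R0 \<inter> R1 = {} \<and> R0 \<inter> S0 = {} \<and> R0 \<inter> S1 = {} \<and> R1 \<inter> S0 = {} \<and> R1 \<inter> S1 = {} \<and>
     (\<forall>i<K. S0 \<inter> f i = {} \<and> S1 \<inter> f i = {} \<and> R0 \<inter> f i = {} \<and> R1 \<inter> f i = {})"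

lemma arm_cell:
  assumes "a \<in> P" "u \<in> P" "a \<noteq> u" "R \<subseteq> P" "a \<notin> R" "u \<notin> R" "finite R" "card R = s - 2"
  shows "{a, u} \<union> R \<in> nsets P s"
proof -
  have "card ({a, u} \<union> R) = card {a, u} + card R" using assms by (intro card_Un_disjoint) auto
  then show ?thesis using assms s unfolding nsets_def by auto
qed

text \<open>
The connecting cell \<open>Q\<close> has colour \<open>x\<close> itself, whereas \<open>Q'\<close> is continued by a cell \<open>S'\<close> with colour \<open>x\<close>.
\<close>

lemma exchange_one_cap:
  assumes Q: "Q \<in> nsets P s" "Q' \<in> nsets P s" "S' \<in> nsets P s" "x \<in> Ls Q" "x \<notin> Ls Q'" "x \<in> Ls S'"
    and QS: "Q' \<inter> S' \<noteq> {}" "Q \<inter> Q' = {}"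
    and h: "\<And>i. 0 < i \<Longrightarrow> i < k - 2 \<Longrightarrow> h i \<in> nsets P s \<and> Ls (h i) = L1 \<and> S' \<inter> h i = {}"
    and Qh: "Q \<inter> h 1 \<noteq> {}" "Q' \<inter> h (k - 3) \<noteq> {}" "\<And>i. 1 < i \<Longrightarrow> i < k - 2 \<Longrightarrow> Q \<inter> h i = {}"
      "\<And>i. 0 < i \<Longrightarrow> i < k - 3 \<Longrightarrow> Q' \<inter> h i = {}"
    and hc: "\<And>i. 1 < i \<Longrightarrow> Suc i < k - 2 \<Longrightarrow> h i \<inter> h (Suc i) \<noteq> {}"
    and hd: "\<And>i j. 0 < i \<Longrightarrow> Suc i < j \<Longrightarrow> j < k - 2 \<Longrightarrow> h i \<inter> h j = {}"
  shows "has_cycle k H"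
proof -
  define g where "g i = (if i = 0 then Q else if i = k - 1 then S' else if i = k - 2 then Q' else h i)" for i
  have g0: "g 0 = Q" "g (k - 1) = S'" "g (k - 2) = Q'" using k unfolding g_def by auto
  have gm: "g i = h i" if "0 < i" "i < k - 2" for i using that unfolding g_def by auto
  have L1g: "Ls (g i) = L1" if "0 < i" "i < k - 2" for i using gm[OF that] h[OF that] by simp
  show ?thesis
  proof (rule exchange_core[of g x])
    have cs: "i = 0 \<or> i = k - 1 \<or> i = k - 2 \<or> (0 < i \<and> i < k - 2)" if "i < k" for i using that by auto
    show "g i \<in> nsets P s" if "i < k" for i
      using cs[OF that] Q g0 gm[of i] h[of i] by auto
    show "g i \<inter> g j = {}" if ij: "Suc i < j" "j < k" "\<not> (i = 0 \<and> Suc j = k)" for i j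
    proof -
      have "(i = 0 \<and> j = k - 2) \<or> (i = 0 \<and> 1 < j \<and> j < k - 2) \<or> (j = k - 1 \<and> 0 < i \<and> i < k - 2)
          \<or> (j = k - 2 \<and> 0 < i \<and> i < k - 3) \<or> (0 < i \<and> i < k - 2 \<and> 0 < j \<and> j < k - 2)"
        using ij by auto
      then consider "i = 0" "j = k - 2" | "i = 0" "1 < j" "j < k - 2" | "j = k - 1" "0 < i" "i < k - 2"
          | "j = k - 2" "0 < i" "i < k - 3" | "0 < i" "i < k - 2" "0 < j" "j < k - 2" by blast
      then show ?thesis
      proof cases
        case 1 then show ?thesis using g0 QS by auto
      next
        case 2 then show ?thesis using g0 gm[of j] Qh(3)[of j] by auto
      next
        case 3 then show ?thesis using g0 gm[of i] h[of i] by auto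
      next
        case 4 then show ?thesis using g0 gm[of i] Qh(4)[of i] by auto
      next
        case 5 then show ?thesis using gm[of i] gm[of j] hd[of i j] ij by auto
      qed
    qed
    show "g i \<inter> g (Suc i) \<noteq> {} \<or> i = 1 \<and> Ls (g 1) = L1 \<and> Ls (g 2) = L1" if i: "Suc i < k" for i
    proof -
      have "i = 0 \<or> (i = 1 \<and> 2 < k - 2) \<or> (i = k - 3 \<and> Suc i = k - 2) \<or> (i = k - 2 \<and> Suc i = k - 1) \<or> (1 < i \<and> Suc i < k - 2) "
        using i k by linarith
      then consider "i = 0" | "i = 1" "2 < k - 2" | "i = k - 3" "Suc i = k - 2" | "i = k - 2" "Suc i = k - 1" | "1 < i" "Suc i < k - 2" by blast
      then show ?thesis
      proof cases
        case 1
        then show ?thesis using g0 gm[of 1] Qh(1) k by auto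
      next
        case 2
        then show ?thesis using L1g[of 1] L1g[of 2] by auto
      next
        case 3
        have "0 < i" "i < k - 2" using 3 k by linarith+
        then have "g i = h (k - 3)" using gm[of i] 3 by simp
        then show ?thesis using g0(3) 3(2) Qh(2) by auto
      next
        case 4
        then show ?thesis using g0 QS by auto
      next
        case 5
        then show ?thesis using gm[of i] gm[of "Suc i"] hc[of i] by auto
      qed
    qed
    show "x \<in> Ls (g 0)" "x \<in> Ls (g (k - 1))" using Q g0 by auto
    show "Ls (g i) = L1" if "1 < i" "i < k - 2" for i using L1g that by auto
    have "Ls (g 1) = L1" using L1g[of 1] k by simp
    then show "Ls (g 1) = L1 \<or> x \<notin> Ls (g 1)" "Ls (g 1) \<inter> Ls (g (k - 2)) \<subseteq> L1" by auto
    show "Ls (g (k - 2)) = L1 \<or> x \<notin> Ls (g (k - 2))" using g0 Q by simp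
  qed (use L1 in simp)
qed

text \<open>
The cells \<open>Q0\<close> and \<open>Q1\<close> connect \<open>S0\<close> and \<open>S1\<close> to the vertices \<open>v 0\<close> and \<open>v (k - 2)\<close> of the ring. These cut the
ring into a path of \<open>k - 2\<close> cells and one of \<open>k - 4\<close> cells. If \<open>Q0\<close> and \<open>Q1\<close> share a colour outside \<open>L1\<close>, they close
the long path. If neither has the colour \<open>x\<close>, then \<open>S0\<close>, \<open>Q0\<close>, the short path, \<open>Q1\<close> and \<open>S1\<close> form a
cycle. If exactly one of them has the colour \<open>x\<close>, the long path is used with its second cell (seen from the
one with colour \<open>x\<close>) left out.
\<close>

lemma exchange_long:
  assumes k5: "5 \<le> k" and K: "K = 2 * k - 6"
    and ring: "cell_ring K s f v" and fP: "\<And>i. i < K \<Longrightarrow> f i \<in> nsets P s \<and> Ls (f i) = L1"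
    and S: "S0 \<in> nsets P s" "S1 \<in> nsets P s" "x \<in> Ls S0" "x \<in> Ls S1" "a0 \<in> S0" "a1 \<in> S1"
    and R: "R0 \<subseteq> P" "R1 \<subseteq> P" "finite R0" "finite R1" "card R0 = s - 2" "card R1 = s - 2"
    and arm: "arms_disjoint K f S0 S1 R0 R1"
  shows "has_cycle k H"
proof -
  define Q0 where "Q0 = {a0, v 0} \<union> R0"
  define Q1 where "Q1 = {a1, v (k - 2)} \<union> R1"
  have K4: "4 \<le> K" and kK: "k - 2 < K" "k - 3 < K" "Suc (k - 3) = k - 2" using k5 K by linarith+
  have fd: "f i \<inter> f j = {}" if "Suc i < j" "j < K" "\<not> (i = 0 \<and> Suc j = K)" for i j
    using cell_ring_inter(3)[OF ring that] .
  have fc: "f i \<inter> f (Suc i) \<noteq> {}" if "Suc i < K" for i using cell_ring_inter(1)[OF ring that] by simp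
  have "v 0 \<in> f 0 \<inter> f (K - 1)" using cell_ring_inter(2)[OF ring] K4 by simp
  then have v0: "v 0 \<in> f 0" "v 0 \<in> f (K - 1)" by simp_all
  have "v (Suc (k - 3)) \<in> f (k - 3) \<inter> f (Suc (k - 3))" using cell_ring_inter(1)[OF ring, of "k - 3"] kK by simp
  then have v1: "v (k - 2) \<in> f (k - 3)" "v (k - 2) \<in> f (k - 2)" using kK by simp_all
  have v0only: "v 0 \<notin> f i" if "i < K" "i \<noteq> 0" "i \<noteq> K - 1" for i
    using ring_link_only[OF ring K4, of 0 i] that K4 by auto
  have v1only: "v (k - 2) \<notin> f i" if "i < K" "i \<noteq> k - 2" "i \<noteq> k - 3" for i
    using ring_link_only[OF ring K4 kK(1), of i] that k5 by auto
  have vne: "v 0 \<noteq> v (k - 2)"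
  proof
    assume "v 0 = v (k - 2)"
    then have "v 0 \<in> f (k - 3)" using v1 by simp
    moreover have "k - 3 \<noteq> 0" "k - 3 \<noteq> K - 1" using k5 K by linarith+
    ultimately show False using v0only kK by blast
  qed
  have dSf: "S0 \<inter> f i = {}" "S1 \<inter> f i = {}" "R0 \<inter> f i = {}" "R1 \<inter> f i = {}" if "i < K" for i
    using arm that unfolding arms_disjoint_def by simp_all
  have dS: "S0 \<inter> S1 = {}" "R0 \<inter> R1 = {}" "R0 \<inter> S0 = {}" "R0 \<inter> S1 = {}" "R1 \<inter> S0 = {}" "R1 \<inter> S1 = {}"
    using arm unfolding arms_disjoint_def by simp_all
  have dQ0f: "Q0 \<inter> f i = {}" if "i < K" "i \<noteq> 0" "i \<noteq> K - 1" for i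
    using dSf[OF that(1)] v0only[OF that] S(5) unfolding Q0_def by auto
  have dQ1f: "Q1 \<inter> f i = {}" if "i < K" "i \<noteq> k - 2" "i \<noteq> k - 3" for i
    using dSf[OF that(1)] v1only[OF that] S(6) unfolding Q1_def by auto
  have nS: "v 0 \<notin> S0" "v 0 \<notin> S1" "v 0 \<notin> R0" "v 0 \<notin> R1" using dSf[of 0] v0(1) K4 by auto
  have nS': "v (k - 2) \<notin> S0" "v (k - 2) \<notin> S1" "v (k - 2) \<notin> R0" "v (k - 2) \<notin> R1" using dSf[OF kK(1)] v1(2) by auto
  have dQ: "Q0 \<inter> Q1 = {}" "Q0 \<inter> S1 = {}" "Q1 \<inter> S0 = {}"
    using dS nS nS' S(5,6) vne unfolding Q0_def Q1_def by auto
  have mQ: "v 0 \<in> Q0" "v (k - 2) \<in> Q1" "a0 \<in> Q0" "a1 \<in> Q1" unfolding Q0_def Q1_def by auto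
  have SP: "a0 \<in> P" "a1 \<in> P" "v 0 \<in> P" "v (k - 2) \<in> P"
    using S v0(1) v1(2) fP[of 0] fP[OF kK(1)] K4 unfolding nsets_def by auto
  have aR: "a0 \<notin> R0" "a1 \<notin> R1" "a0 \<noteq> v 0" "a1 \<noteq> v (k - 2)" using dS S(5,6) nS nS' by auto
  have Q: "Q0 \<in> nsets P s" "Q1 \<in> nsets P s" unfolding Q0_def Q1_def
    using SP aR nS nS' R by (intro arm_cell; simp)+
  have LSx: "Ls S0 \<noteq> L1" "Ls S1 \<noteq> L1" using S L1 by auto
  show ?thesis
  proof (cases "\<exists>y. y \<in> Ls Q0 \<and> y \<in> Ls Q1 \<and> y \<notin> L1")
    case True
    then obtain y where y: "y \<in> Ls Q0" "y \<in> Ls Q1" "y \<notin> L1" by blast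
    define g where "g i = (if i = 0 then Q0 else if i = k - 1 then Q1 else f (i - 1))" for i
    have gm: "g i = f (i - 1) \<and> i - 1 < K" if "0 < i" "i < k - 1" for i using that kK unfolding g_def by auto
    have g0: "g 0 = Q0" "g (k - 1) = Q1" using k5 unfolding g_def by auto
    show ?thesis
    proof (rule exchange_core[of g y])
      show "g i \<in> nsets P s" if "i < k" for i
        using Q gm[of i] fP[of "i - 1"] that unfolding g_def by auto
      show "g i \<inter> g j = {}" if ij: "Suc i < j" "j < k" "\<not> (i = 0 \<and> Suc j = k)" for i j
      proof -
        have "(i = 0 \<and> 1 < j \<and> j < k - 1) \<or> (j = k - 1 \<and> 0 < i \<and> i < k - 2) \<or> (0 < i \<and> i < k - 1 \<and> j < k - 1 \<and> 0 < j)"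
          using ij by auto
        then consider "i = 0" "1 < j" "j < k - 1" | "j = k - 1" "0 < i" "i < k - 2" | "0 < i" "i < k - 1" "j < k - 1" "0 < j" by blast
        then show ?thesis
        proof cases
          case 1
          have "j - 1 < K" "j - 1 \<noteq> 0" "j - 1 \<noteq> K - 1" using 1 k5 K by linarith+
          then show ?thesis using dQ0f gm[of j] 1 g0 by auto
        next
          case 2
          have "i - 1 < K" "i - 1 \<noteq> k - 2" "i - 1 \<noteq> k - 3" using 2 k5 K by linarith+
          then show ?thesis using dQ1f gm[of i] 2 g0 by auto
        next
          case 3
          have "f (i - 1) \<inter> f (j - 1) = {}" by (rule fd) (use 3 ij k5 K in linarith)+
          then show ?thesis using gm[of i] gm[of j] 3 by auto
        qed
      qed
      show "g i \<inter> g (Suc i) \<noteq> {} \<or> i = 1 \<and> Ls (g 1) = L1 \<and> Ls (g 2) = L1" if i: "Suc i < k" for i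
      proof -
        have "i = 0 \<or> Suc i = k - 1 \<or> (0 < i \<and> Suc i < k - 1)" using i by auto
        then consider "i = 0" | "Suc i = k - 1" | "0 < i" "Suc i < k - 1" by blast
        then show ?thesis
        proof cases
          case 1
          then have "g (Suc i) = f 0" using gm[of 1] k5 by simp
          then show ?thesis using 1 g0 mQ v0 by auto
        next
          case 2
          then have "g i = f (i - 1)" "i - 1 = k - 3" using gm[of i] k5 by auto
          then show ?thesis using 2 g0 mQ v1 by auto
        next
          case 3
          then have "g i = f (i - 1)" "g (Suc i) = f (Suc (i - 1))" using gm[of i] gm[of "Suc i"] by auto
          moreover have "Suc (i - 1) < K" using 3 kK by linarith
          ultimately show ?thesis using fc by simp
        qed
      qed
      show "y \<in> Ls (g 0)" "y \<in> Ls (g (k - 1))" using y g0 by auto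
      have LL: "Ls (g i) = L1" if "0 < i" "i < k - 1" for i using gm[OF that] fP by auto
      show "Ls (g i) = L1" if "1 < i" "i < k - 2" for i using LL that by auto
      show "Ls (g 1) = L1 \<or> y \<notin> Ls (g 1)" "Ls (g (k - 2)) = L1 \<or> y \<notin> Ls (g (k - 2))"
        "Ls (g 1) \<inter> Ls (g (k - 2)) \<subseteq> L1" using LL[of 1] LL[of "k - 2"] k5 by auto
    qed (use y in simp)
  next
    case False
    then have com: "Ls Q0 \<inter> Ls Q1 \<subseteq> L1" by blast
    have notboth: "\<not> (x \<in> Ls Q0 \<and> x \<in> Ls Q1)" using False L1 by blast
    consider "x \<in> Ls Q0" "x \<notin> Ls Q1" | "x \<in> Ls Q1" "x \<notin> Ls Q0" | "x \<notin> Ls Q0" "x \<notin> Ls Q1" using notboth by blast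
    then show ?thesis
    proof cases
      case x: 1
      \<comment> \<open>the cell \<open>f 1\<close> is left out; \<open>f 0\<close> and \<open>f 2\<close> are linked by their common colour\<close>
      define h where "h i = (if i = 1 then f 0 else f i)" for i
      have h1: "h 1 = f 0" and hi: "h i = f i" if "1 < i" for i using that unfolding h_def by auto
      have hf: "\<exists>j<K. h i = f j" if "0 < i" "i < k - 2" for i
        using that kK unfolding h_def by (intro exI[of _ "if i = 1 then 0 else i"]) auto
      show ?thesis
      proof (rule exchange_one_cap[of Q0 Q1 S1 h])
        show "h i \<in> nsets P s \<and> Ls (h i) = L1 \<and> S1 \<inter> h i = {}" if i: "0 < i" "i < k - 2" for i
        proof -
          obtain j where "j < K" "h i = f j" using hf[OF i] by blast
          then show ?thesis using fP[of j] dSf[of j] by simp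
        qed
        show "Q0 \<inter> h 1 \<noteq> {}" using h1 mQ v0 by auto
        show "Q1 \<inter> h (k - 3) \<noteq> {}" using hi[of "k - 3"] k5 mQ v1 by auto
        show "Q0 \<inter> h i = {}" if i: "1 < i" "i < k - 2" for i
        proof -
          have "i < K" "i \<noteq> 0" "i \<noteq> K - 1" using i k5 K by linarith+
          then show ?thesis using dQ0f[of i] hi[OF i(1)] by auto
        qed
        show "Q1 \<inter> h i = {}" if i: "0 < i" "i < k - 3" for i
        proof (cases "i = 1")
          case True
          have "0 < K" "0 \<noteq> k - 2" "0 \<noteq> k - 3" using k5 K by linarith+
          then show ?thesis using True h1 dQ1f[of 0] by auto
        next
          case False
          have "i < K" "i \<noteq> k - 2" "i \<noteq> k - 3" using i k5 K by linarith+
          then show ?thesis using dQ1f[of i] hi[of i] i False by auto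
        qed
        show "h i \<inter> h (Suc i) \<noteq> {}" if i: "1 < i" "Suc i < k - 2" for i
          using hi[of i] hi[of "Suc i"] fc[of i] i kK by auto
        show "h i \<inter> h j = {}" if ij: "0 < i" "Suc i < j" "j < k - 2" for i j
        proof (cases "i = 1")
          case True
          have "f 0 \<inter> f j = {}" by (rule fd) (use ij True k5 K in linarith)+
          then show ?thesis using True h1 hi[of j] ij by auto
        next
          case False
          have "f i \<inter> f j = {}" by (rule fd) (use ij False k5 K in linarith)+
          then show ?thesis using False hi[of i] hi[of j] ij by auto
        qed
      qed (use Q S x dQ mQ in auto)
    next
      case x: 2
      \<comment> \<open>the same path in the opposite direction, without the cell \<open>f (k - 4)\<close>\<close>
      define h where "h i = (if i = 1 then f (k - 3) else f (k - 3 - i))" for i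
      have h1: "h 1 = f (k - 3)" and hi: "h i = f (k - 3 - i)" if "1 < i" for i using that unfolding h_def by auto
      have hf: "\<exists>j<K. h i = f j" if "0 < i" "i < k - 2" for i
      proof -
        have "k - 3 - i < K" using kK by linarith
        then show ?thesis using kK unfolding h_def by (intro exI[of _ "if i = 1 then k - 3 else k - 3 - i"]) auto
      qed
      show ?thesis
      proof (rule exchange_one_cap[of Q1 Q0 S0 h])
        show "h i \<in> nsets P s \<and> Ls (h i) = L1 \<and> S0 \<inter> h i = {}" if i: "0 < i" "i < k - 2" for i
        proof -
          obtain j where "j < K" "h i = f j" using hf[OF i] by blast
          then show ?thesis using fP[of j] dSf[of j] by simp
        qed
        show "Q1 \<inter> h 1 \<noteq> {}" using h1 mQ v1 by auto
        show "Q0 \<inter> h (k - 3) \<noteq> {}" using hi[of "k - 3"] k5 mQ v0 by auto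
        show "Q1 \<inter> h i = {}" if i: "1 < i" "i < k - 2" for i
        proof -
          have "k - 3 - i < K" "k - 3 - i \<noteq> k - 2" "k - 3 - i \<noteq> k - 3" using i k5 K by linarith+
          then show ?thesis using dQ1f[of "k - 3 - i"] hi[OF i(1)] by auto
        qed
        show "Q0 \<inter> h i = {}" if i: "0 < i" "i < k - 3" for i
        proof (cases "i = 1")
          case True
          have "k - 3 < K" "k - 3 \<noteq> 0" "k - 3 \<noteq> K - 1" using k5 K by linarith+
          then show ?thesis using True h1 dQ0f[of "k - 3"] by auto
        next
          case False
          have "k - 3 - i < K" "k - 3 - i \<noteq> 0" "k - 3 - i \<noteq> K - 1" using i k5 K by linarith+
          then show ?thesis using dQ0f[of "k - 3 - i"] hi[of i] i False by auto
        qed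
        show "h i \<inter> h (Suc i) \<noteq> {}" if i: "1 < i" "Suc i < k - 2" for i
        proof -
          have "Suc (k - 3 - Suc i) = k - 3 - i" "Suc (k - 3 - Suc i) < K" using i K by linarith+
          then have "f (k - 3 - Suc i) \<inter> f (k - 3 - i) \<noteq> {}" using fc[of "k - 3 - Suc i"] by simp
          then show ?thesis using hi[of i] hi[of "Suc i"] i by auto
        qed
        show "h i \<inter> h j = {}" if ij: "0 < i" "Suc i < j" "j < k - 2" for i j
        proof (cases "i = 1")
          case True
          have "f (k - 3 - j) \<inter> f (k - 3) = {}" by (rule fd) (use ij True k5 K in linarith)+
          then show ?thesis using True h1 hi[of j] ij by auto
        next
          case False
          have "f (k - 3 - j) \<inter> f (k - 3 - i) = {}" by (rule fd) (use ij False k5 K in linarith)+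
          then show ?thesis using False hi[of i] hi[of j] ij by auto
        qed
      qed (use Q S x dQ mQ in auto)
    next
      case x: 3
      define g where "g i = (if i = 0 then S0 else if i = 1 then Q0 else if i = k - 1 then S1 else if i = k - 2 then Q1 else f (K + 1 - i))" for i
      have g0: "g 0 = S0" "g 1 = Q0" "g (k - 1) = S1" "g (k - 2) = Q1" using k5 unfolding g_def by auto
      have gm: "g i = f (K + 1 - i) \<and> K + 1 - i < K" if "1 < i" "i < k - 2" for i using that K k5 unfolding g_def by auto
      show ?thesis
      proof (rule exchange_core[of g x])
        have cs: "i = 0 \<or> i = 1 \<or> i = k - 1 \<or> i = k - 2 \<or> (1 < i \<and> i < k - 2)" if "i < k" for i using that by auto
        show "g i \<in> nsets P s" if "i < k" for i
          using cs[OF that] Q S g0 gm[of i] fP[of "K + 1 - i"] by auto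
        show "g i \<inter> g j = {}" if ij: "Suc i < j" "j < k" "\<not> (i = 0 \<and> Suc j = k)" for i j
        proof -
          have "(i = 0 \<and> j = k - 2) \<or> (i = 0 \<and> 1 < j \<and> j < k - 2) \<or> (i = 1 \<and> j = k - 1) \<or> (i = 1 \<and> j = k - 2)
            \<or> (i = 1 \<and> 2 < j \<and> j < k - 2) \<or> (1 < i \<and> i < k - 2 \<and> j = k - 1) \<or> (1 < i \<and> i < k - 3 \<and> j = k - 2) \<or> (1 < i \<and> i < k - 2 \<and> 1 < j \<and> j < k - 2)"
          proof -
            obtain m where m: "k = m + 5" using k5 le_Suc_ex by (metis add.commute)
            have e: "k - 1 = m + 4" "k - 2 = m + 3" "k - 3 = m + 2" using m by simp_all
            have "i = 0 \<Longrightarrow> j = k - 2 \<or> (1 < j \<and> j < k - 2)" using ij unfolding e m by linarith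
            moreover have "i = 1 \<Longrightarrow> j = k - 1 \<or> j = k - 2 \<or> (2 < j \<and> j < k - 2)" using ij unfolding e m by linarith
            moreover have "1 < i \<Longrightarrow> i < k - 2 \<and> j = k - 1 \<or> i < k - 3 \<and> j = k - 2 \<or> i < k - 2 \<and> 1 < j \<and> j < k - 2" using ij unfolding e m by auto
            moreover have "i = 0 \<or> i = 1 \<or> 1 < i" by linarith
            ultimately show ?thesis by blast
          qed
          then consider "i = 0" "j = k - 2" | "i = 0" "1 < j" "j < k - 2" | "i = 1" "j = k - 1" | "i = 1" "j = k - 2"
            | "i = 1" "2 < j" "j < k - 2" | "1 < i" "i < k - 2" "j = k - 1" | "1 < i" "i < k - 3" "j = k - 2"
            | "1 < i" "i < k - 2" "1 < j" "j < k - 2" by blast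
          then show ?thesis
          proof cases
            case 1 then show ?thesis using g0 dQ by auto
          next
            case 2 then show ?thesis using g0 gm[of j] dSf(1) by auto
          next
            case 3 then show ?thesis using g0 dQ by auto
          next
            case 4 then show ?thesis using g0 dQ by auto
          next
            case 5
            have "K + 1 - j < K" "K + 1 - j \<noteq> 0" "K + 1 - j \<noteq> K - 1" using 5 k5 K by linarith+
            then show ?thesis using 5 g0 gm[of j] dQ0f[of "K + 1 - j"] by auto
          next
            case 6 then show ?thesis using g0 gm[of i] dSf(2) by auto
          next
            case 7
            have "K + 1 - i < K" "K + 1 - i \<noteq> k - 2" "K + 1 - i \<noteq> k - 3" using 7 k5 K by linarith+
            then show ?thesis using 7 g0 dQ1f[of "K + 1 - i"] gm[of i] by auto
          next
            case 8
            have "f (K + 1 - j) \<inter> f (K + 1 - i) = {}" by (rule fd) (use 8 ij k5 K in linarith)+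
            then show ?thesis using gm[of i] gm[of j] 8 by auto
          qed
        qed
        show "g i \<inter> g (Suc i) \<noteq> {} \<or> i = 1 \<and> Ls (g 1) = L1 \<and> Ls (g 2) = L1" if i: "Suc i < k" for i
        proof -
          obtain m where m: "k = m + 5" using k5 le_Suc_ex by (metis add.commute)
          have e: "k - 1 = m + 4" "k - 2 = m + 3" using m by simp_all
          have "i = 0 \<or> (i = 1 \<and> 2 < k - 2) \<or> (1 < i \<and> Suc i = k - 2) \<or> (i = k - 2 \<and> Suc i = k - 1) \<or> (1 < i \<and> Suc i < k - 2)"
            using i unfolding e m by linarith
          then consider "i = 0" | "i = 1" "2 < k - 2" | "1 < i" "Suc i = k - 2" | "i = k - 2" "Suc i = k - 1" | "1 < i" "Suc i < k - 2"
            by blast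
          then show ?thesis
          proof cases
            case 1
            then show ?thesis using g0 mQ S by auto
          next
            case 2
            then have "g 2 = f (K - 1)" using gm[of 2] by (simp add: numeral_2_eq_2)
            then show ?thesis using 2 g0 mQ v0 by (auto simp: numeral_2_eq_2)
          next
            case 3
            then have "K + 1 - i = k - 2" using K k5 by linarith
            then have "g i = f (k - 2)" using gm[of i] 3 by simp
            then show ?thesis using 3 g0 mQ v1 by auto
          next
            case 4
            then show ?thesis using g0 mQ S by auto
          next
            case 5
            have "Suc (K + 1 - Suc i) = K + 1 - i" "Suc (K + 1 - Suc i) < K" using 5 K by linarith+
            then have "f (K + 1 - Suc i) \<inter> f (K + 1 - i) \<noteq> {}" using fc[of "K + 1 - Suc i"] by simp
            then show ?thesis using gm[of i] gm[of "Suc i"] 5 by auto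
          qed
        qed
        show "x \<in> Ls (g 0)" "x \<in> Ls (g (k - 1))" using S g0 by auto
        show "Ls (g i) = L1" if "1 < i" "i < k - 2" for i using gm[OF that] fP by auto
        show "Ls (g 1) = L1 \<or> x \<notin> Ls (g 1)" "Ls (g (k - 2)) = L1 \<or> x \<notin> Ls (g (k - 2))"
          "Ls (g 1) \<inter> Ls (g (k - 2)) \<subseteq> L1" using g0 x com by auto
      qed (use L1 in simp)
    qed
  qed
qed

text \<open>
For \<open>k = 4\<close> the short path would be empty; here the two connecting cells end at adjacent links \<open>v 0\<close> and \<open>v 1\<close>.
\<close>

lemma exchange_short_half:
  assumes k4: "k = 4"
    and ring: "cell_ring 4 s f v" and fP: "\<And>i. i < 4 \<Longrightarrow> f i \<in> nsets P s \<and> Ls (f i) = L1"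
    and S: "S0 \<in> nsets P s" "S1 \<in> nsets P s" "x \<in> Ls S1" "a0 \<in> S0" "a1 \<in> S1"
    and R: "R0 \<subseteq> P" "R1 \<subseteq> P" "finite R0" "finite R1" "card R0 = s - 2" "card R1 = s - 2"
    and arm: "arms_disjoint 4 f S0 S1 R0 R1"
    and xQ: "x \<in> Ls ({a0, v 0} \<union> R0)"
  shows "has_cycle k H"
proof -
  define Q0 where "Q0 = {a0, v 0} \<union> R0"
  define Q1 where "Q1 = {a1, v 1} \<union> R1"
  have f: "f 0 \<inter> f 3 = {v 0}" "f 0 \<inter> f 1 = {v 1}" "f 1 \<inter> f 3 = {}"
    using cell_ring_inter(2)[OF ring] cell_ring_inter(1)[OF ring, of 0] cell_ring_inter(3)[OF ring, of 1 3] by auto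
  have "v 0 \<in> f 0 \<inter> f 3" "v 1 \<in> f 0 \<inter> f 1" unfolding f by simp_all
  then have vf: "v 0 \<in> f 0" "v 0 \<in> f 3" "v 1 \<in> f 0" "v 1 \<in> f 1" by simp_all
  then have vn: "v 0 \<notin> f 1" "v 1 \<notin> f 3" "v 0 \<noteq> v 1" using f(3) by auto
  have dSf: "S0 \<inter> f i = {}" "S1 \<inter> f i = {}" "R0 \<inter> f i = {}" "R1 \<inter> f i = {}" if "i < 4" for i
    using arm that unfolding arms_disjoint_def by simp_all
  have dS: "S0 \<inter> S1 = {}" "R0 \<inter> R1 = {}" "R0 \<inter> S0 = {}" "R0 \<inter> S1 = {}" "R1 \<inter> S0 = {}" "R1 \<inter> S1 = {}"
    using arm unfolding arms_disjoint_def by simp_all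
  have nS: "v 0 \<notin> S0" "v 0 \<notin> S1" "v 0 \<notin> R0" "v 0 \<notin> R1" using dSf[of 0] vf by auto
  have nS': "v 1 \<notin> S0" "v 1 \<notin> S1" "v 1 \<notin> R0" "v 1 \<notin> R1" using dSf[of 1] vf by auto
  have dQ: "Q0 \<inter> Q1 = {}" "Q0 \<inter> S1 = {}" "Q1 \<inter> S0 = {}"
    using dS nS nS' S(4,5) vn unfolding Q0_def Q1_def by auto
  have dQf: "Q0 \<inter> f 1 = {}" "Q1 \<inter> f 3 = {}"
    using dSf[of 1] dSf[of 3] vn S(4,5) unfolding Q0_def Q1_def by auto
  have mQ: "v 0 \<in> Q0" "v 1 \<in> Q1" "a1 \<in> Q1" unfolding Q0_def Q1_def by auto
  have SP: "a0 \<in> P" "a1 \<in> P" "v 0 \<in> P" "v 1 \<in> P"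
    using S vf fP[of 0] unfolding nsets_def by auto
  have aR: "a0 \<notin> R0" "a1 \<notin> R1" "a0 \<noteq> v 0" "a1 \<noteq> v 1" using dS S(4,5) nS nS' by auto
  have Q: "Q0 \<in> nsets P s" "Q1 \<in> nsets P s" unfolding Q0_def Q1_def
    using SP aR nS nS' R by (intro arm_cell; simp)+
  have x0: "x \<in> Ls Q0" using xQ unfolding Q0_def .
  show ?thesis
  proof (cases "x \<in> Ls Q1")
    case True
    define g where "g i = (if i = 0 then Q0 else if i = 1 then f 3 else if i = 2 then f 1 else Q1)" for i :: nat
    have g: "g 0 = Q0" "g 1 = f 3" "g 2 = f 1" "g 3 = Q1" unfolding g_def by simp_all
    have L: "Ls (g 1) = L1" "Ls (g 2) = L1" using g fP by auto
    have cs: "i = 0 \<or> i = 1 \<or> i = 2 \<or> i = 3" if "i < k" for i :: nat using that k4 by auto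
    show ?thesis
    proof (rule exchange_core[of g x])
      show "g i \<in> nsets P s" if "i < k" for i using cs[OF that] g Q fP by auto
      show "g i \<inter> g j = {}" if ij: "Suc i < j" "j < k" "\<not> (i = 0 \<and> Suc j = k)" for i j
      proof -
        have "(i = 0 \<and> j = 2) \<or> (i = 1 \<and> j = 3)" using ij k4 by linarith
        then show ?thesis using g dQf by auto
      qed
      show "g i \<inter> g (Suc i) \<noteq> {} \<or> i = 1 \<and> Ls (g 1) = L1 \<and> Ls (g 2) = L1" if i: "Suc i < k" for i
      proof -
        have "i = 0 \<or> i = 1 \<or> i = 2" using i k4 by linarith
        then show ?thesis using g mQ vf L by (auto simp: numeral_2_eq_2 numeral_3_eq_3)
      qed
      show "x \<in> Ls (g 0)" "x \<in> Ls (g (k - 1))" using g x0 True k4 by simp_all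
      show "Ls (g i) = L1" if "1 < i" "i < k - 2" for i using that k4 by simp
      show "Ls (g 1) = L1 \<or> x \<notin> Ls (g 1)" "Ls (g (k - 2)) = L1 \<or> x \<notin> Ls (g (k - 2))" using L k4 by simp_all
    qed (use L1 k4 in simp_all)
  next
    case False
    show ?thesis
      by (rule exchange_one_cap[of Q0 Q1 S1 "\<lambda>i. f 0"]) (use Q S x0 False mQ vf dQ k4 fP[of 0] dSf[of 0] in auto)
  qed
qed

text \<open>
If neither connecting cell to \<open>v 0\<close> has the colour \<open>x\<close>, the two of them with \<open>S0\<close> and \<open>S1\<close> are a cycle; otherwise one
of them plays the role of the cap in \<open>exchange_short_half\<close>.
\<close>

lemma exchange_short:
  assumes k4: "k = 4"
    and ring: "cell_ring 4 s f v" and fP: "\<And>i. i < 4 \<Longrightarrow> f i \<in> nsets P s \<and> Ls (f i) = L1"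
    and S: "S0 \<in> nsets P s" "S1 \<in> nsets P s" "x \<in> Ls S0" "x \<in> Ls S1" "a0 \<in> S0" "a1 \<in> S1"
    and R: "R0 \<subseteq> P" "R1 \<subseteq> P" "finite R0" "finite R1" "card R0 = s - 2" "card R1 = s - 2"
    and arm: "arms_disjoint 4 f S0 S1 R0 R1"
  shows "has_cycle k H"
proof -
  have arm': "arms_disjoint 4 f S1 S0 R1 R0" using arm unfolding arms_disjoint_def by auto
  define Q0 where "Q0 = {a0, v 0} \<union> R0"
  define Q1 where "Q1 = {a1, v 0} \<union> R1"
  consider "x \<in> Ls Q0" | "x \<in> Ls Q1" | "x \<notin> Ls Q0" "x \<notin> Ls Q1" by blast
  then show ?thesis
  proof cases
    case 1
    show ?thesis by (rule exchange_short_half[OF k4 ring fP S(1,2,4,5,6) R arm 1[unfolded Q0_def]])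
  next
    case 2
    show ?thesis by (rule exchange_short_half[OF k4 ring fP S(2,1,3,6,5) R(2,1,4,3,6,5) arm' 2[unfolded Q1_def]])
  next
    case 3
    have "f 0 \<inter> f 3 = {v 0}" using cell_ring_inter(2)[OF ring] by simp
    then have v0: "v 0 \<in> f 0" by blast
    have dSf: "S0 \<inter> f 0 = {}" "S1 \<inter> f 0 = {}" "R0 \<inter> f 0 = {}" "R1 \<inter> f 0 = {}"
      using arm unfolding arms_disjoint_def by simp_all
    have dS: "S0 \<inter> S1 = {}" "R0 \<inter> R1 = {}" "R0 \<inter> S0 = {}" "R0 \<inter> S1 = {}" "R1 \<inter> S0 = {}" "R1 \<inter> S1 = {}"
      using arm unfolding arms_disjoint_def by simp_all
    have nS: "v 0 \<notin> S0" "v 0 \<notin> S1" "v 0 \<notin> R0" "v 0 \<notin> R1" using dSf v0 by auto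
    have SP: "a0 \<in> P" "a1 \<in> P" "v 0 \<in> P" using S v0 fP[of 0] unfolding nsets_def by auto
    have aR: "a0 \<notin> R0" "a1 \<notin> R1" "a0 \<noteq> v 0" "a1 \<noteq> v 0" using dS S(5,6) nS by auto
    have Q: "Q0 \<in> nsets P s" "Q1 \<in> nsets P s" unfolding Q0_def Q1_def
      using SP aR nS R by (intro arm_cell; simp)+
    have dQ: "Q0 \<inter> S1 = {}" "Q1 \<inter> S0 = {}" using dS nS S(5,6) unfolding Q0_def Q1_def by auto
    have mQ: "v 0 \<in> Q0" "v 0 \<in> Q1" "a0 \<in> Q0" "a1 \<in> Q1" unfolding Q0_def Q1_def by auto
    define g where "g i = (if i = 0 then S0 else if i = 1 then Q0 else if i = 2 then Q1 else S1)" for i :: nat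
    have g: "g 0 = S0" "g 1 = Q0" "g 2 = Q1" "g 3 = S1" unfolding g_def by simp_all
    have cs: "i = 0 \<or> i = 1 \<or> i = 2 \<or> i = 3" if "i < k" for i :: nat using that k4 by auto
    show ?thesis
    proof (rule exchange_core[of g x])
      show "g i \<in> nsets P s" if "i < k" for i using cs[OF that] g Q S by auto
      show "g i \<inter> g j = {}" if ij: "Suc i < j" "j < k" "\<not> (i = 0 \<and> Suc j = k)" for i j
      proof -
        have "(i = 0 \<and> j = 2) \<or> (i = 1 \<and> j = 3)" using ij k4 by linarith
        then show ?thesis using g dQ by auto
      qed
      show "g i \<inter> g (Suc i) \<noteq> {} \<or> i = 1 \<and> Ls (g 1) = L1 \<and> Ls (g 2) = L1" if i: "Suc i < k" for i
      proof -
        have "i = 0 \<or> i = 1 \<or> i = 2" using i k4 by linarith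
        then show ?thesis using g mQ S by (auto simp: numeral_2_eq_2 numeral_3_eq_3)
      qed
      show "x \<in> Ls (g 0)" "x \<in> Ls (g (k - 1))" using g S k4 by simp_all
      show "Ls (g i) = L1" if "1 < i" "i < k - 2" for i using that k4 by simp
      show "Ls (g 1) = L1 \<or> x \<notin> Ls (g 1)" "Ls (g (k - 2)) = L1 \<or> x \<notin> Ls (g (k - 2))" using 3 g k4 by simp_all
    qed (use L1 k4 in simp_all)
  qed
qed

end

section \<open>Stability\<close>

text \<open>
The ring, the two cells with colour \<open>x\<close> and the reservoirs are found in one box for concatenated tuples: rows
below \<open>s\<close> give cells with list \<open>L1\<close>, the other rows give cells with colour \<open>x\<close>. Almost all \<open>s\<close>-sets have
lists, so the box can be chosen such that this holds for all connecting cells.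
\<close>

lemma exchange_box:
  fixes \<gamma>1 \<gamma>2 :: real
  assumes s: "2 \<le> s" and k: "4 \<le> k" and l: "l = (k - 1) div 2" and \<gamma>: "0 < \<gamma>1" "0 < \<gamma>2"
  shows "\<exists>\<epsilon>>0. \<exists>n0. \<forall>(V :: 'a set) H X Ls L1 x. finite V \<longrightarrow> n0 \<le> card V \<longrightarrow> X \<subseteq> nsets V s \<longrightarrow>
     real (card (nsets V s - X)) \<le> \<epsilon> * real (card V) ^ s \<longrightarrow>
     (\<forall>S\<in>X. finite (Ls S) \<and> card (Ls S) = l \<and> Ls S \<subseteq> nbr H S) \<longrightarrow>
     finite L1 \<longrightarrow> card L1 = l \<longrightarrow> x \<notin> L1 \<longrightarrow>
     \<gamma>1 * real (card V) ^ s \<le> real (card {S \<in> X. Ls S = L1}) \<longrightarrow>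
     \<gamma>2 * real (card V) ^ s \<le> real (card {S \<in> X. x \<in> Ls S}) \<longrightarrow> has_cycle k H"
proof -
  define t where "t = 2 * k + 4"
  define m where "m = Suc l"
  let ?I = "{..<2*s} \<times> {..<t}"
  have "0 < \<gamma>1 * \<gamma>2" using \<gamma> by simp
  from exists_good_box[OF this, where s = s and \<sigma> = "2 * s" and m = m and t = t and 'a = 'a]
  obtain \<epsilon> n0 where \<epsilon>: "0 < \<epsilon>" and box: "\<forall>(V :: 'a set) G X Col A Y. box_hypotheses s (2 * s) m (\<gamma>1 * \<gamma>2) \<epsilon> n0 V G X Col A Y \<longrightarrow>
     (\<exists>p. p ` ?I \<subseteq> V \<and> good_box s ?I X Col A Y p \<and> (\<forall>g. (\<forall>i<2*s. g i < t) \<longrightarrow> cell p g (2 * s) \<in> G))"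
    by (elim exE conjE) (rule that)
  show ?thesis
  proof (rule exI[of _ \<epsilon>], rule conjI[OF \<epsilon>], rule exI[of _ n0], intro allI impI)
    fix V :: "'a set" and H X and Ls :: "'a set \<Rightarrow> 'a set" and L1 x
    assume V: "finite V" "n0 \<le> card V" and XV: "X \<subseteq> nsets V s" and X: "real (card (nsets V s - X)) \<le> \<epsilon> * real (card V) ^ s"
      and Ls: "\<forall>S\<in>X. finite (Ls S) \<and> card (Ls S) = l \<and> Ls S \<subseteq> nbr H S"
      and L1: "finite L1" "card L1 = l" "x \<notin> L1"
      and d1: "\<gamma>1 * real (card V) ^ s \<le> real (card {S \<in> X. Ls S = L1})"
      and d2: "\<gamma>2 * real (card V) ^ s \<le> real (card {S \<in> X. x \<in> Ls S})"
    define T1 where "T1 = {w. distinct w \<and> length w = s \<and> set w \<in> {S \<in> X. Ls S = L1}}"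
    define T2 where "T2 = {w. distinct w \<and> length w = s \<and> set w \<in> {S \<in> X. x \<in> Ls S}}"
    have sub1: "{S \<in> X. Ls S = L1} \<subseteq> nsets V s" and sub2: "{S \<in> X. x \<in> Ls S} \<subseteq> nsets V s" using XV by auto
    note c1 = card_distinct_tuples[OF V(1) sub1, folded T1_def] and c2 = card_distinct_tuples[OF V(1) sub2, folded T2_def]
    define G where "G = (\<lambda>(u, w). u @ w) ` (T1 \<times> T2)"
    have len: "length u = s" if "u \<in> T1" for u using that unfolding T1_def by simp
    have "inj_on (\<lambda>(u, w). u @ w) (T1 \<times> T2)"
    proof (rule inj_onI, clarify)
      fix u w u' w' assume "u \<in> T1" "u' \<in> T1" "u @ w = u' @ w'"
      then show "u = u' \<and> w = w'" using len[of u] len[of u'] by (simp add: append_eq_append_conv)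
    qed
    then have cG: "card G = card T1 * card T2" unfolding G_def by (simp add: card_image card_cartesian_product)
    define Col where "Col S = (if S \<in> X then Ls S else {})" for S
    have "box_hypotheses s (2 * s) m (\<gamma>1 * \<gamma>2) \<epsilon> n0 V G X Col (\<lambda>S. {}) (insert x L1)"
      unfolding box_hypotheses_def
    proof (intro conjI V X)
      show "G \<subseteq> {w. length w = 2 * s \<and> set w \<subseteq> V}" 
      proof
        fix w assume "w \<in> G"
        then obtain a b where ab: "w = a @ b" "a \<in> T1" "b \<in> T2" unfolding G_def by auto
        have "a \<in> {w. length w = s \<and> set w \<subseteq> V}" "b \<in> {w. length w = s \<and> set w \<subseteq> V}"
          using c1(2) c2(2) ab(2,3) by blast+
        then show "w \<in> {w. length w = 2 * s \<and> set w \<subseteq> V}" using ab(1) by auto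
      qed
      have "\<gamma>1 * real (card V) ^ s \<le> real (card T1)" "\<gamma>2 * real (card V) ^ s \<le> real (card T2)"
        using d1 d2 c1(1) c2(1) by linarith+
      then have "(\<gamma>1 * real (card V) ^ s) * (\<gamma>2 * real (card V) ^ s) \<le> real (card T1) * real (card T2)"
        using \<gamma> by (intro mult_mono) auto
      moreover have "(\<gamma>1 * real (card V) ^ s) * (\<gamma>2 * real (card V) ^ s) = \<gamma>1 * \<gamma>2 * real (card V) ^ (2 * s)"
        by (simp add: mult_2 power_add)
      ultimately show "\<gamma>1 * \<gamma>2 * real (card V) ^ (2 * s) \<le> real (card G)" unfolding cG by simp
      show "\<forall>S\<in>nsets V s. finite (Col S) \<and> card (Col S) \<le> m \<and> Col S \<inter> S = {}"
      proof
        fix S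
        show "finite (Col S) \<and> card (Col S) \<le> m \<and> Col S \<inter> S = {}"
        proof (cases "S \<in> X")
          case True
          then have "Ls S \<subseteq> nbr H S" "finite (Ls S)" "card (Ls S) = l" using Ls by auto
          moreover have "nbr H S \<inter> S = {}" unfolding nbr_def by auto
          ultimately show ?thesis using True unfolding Col_def m_def by auto
        qed (simp add: Col_def)
      qed
      have "0 \<le> \<epsilon> * real (card V) ^ s" using \<epsilon> by simp
      then show "\<forall>c. real (card {S \<in> nsets V s. c \<in> {}}) \<le> \<epsilon> * real (card V) ^ s" by simp
      show "finite (insert x L1)" "card (insert x L1) \<le> m" using L1 unfolding m_def by simp_all
    qed
    then obtain p where p: "p ` ?I \<subseteq> V" "good_box s ?I X Col (\<lambda>S. {}) (insert x L1) p"
      "\<forall>g. (\<forall>i<2*s. g i < t) \<longrightarrow> cell p g (2 * s) \<in> G" using box by blast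
    define P where "P = p ` ?I"
    have inj: "inj_on p ?I" and PX: "\<And>S. S \<in> nsets P s \<Longrightarrow> S \<in> X" and PC: "\<And>S. S \<in> nsets P s \<Longrightarrow> Col S \<inter> P = {}"
      using p(2) unfolding good_box_def P_def by blast+
    interpret exchange s k l H Ls P L1 x
    proof
      fix S assume S: "S \<in> nsets P s"
      show "card (Ls S) = l" using PX[OF S] Ls by blast
      show "Ls S \<inter> P = {}" using PX[OF S] PC[OF S] unfolding Col_def by simp
      fix c assume "c \<in> Ls S"
      then show "insert c S \<in> H" using PX[OF S] Ls unfolding nbr_def by blast
    qed (use s k l L1 in auto)
    have cells: "set (map (\<lambda>i. p (i, g i)) [0..<s]) \<in> {S \<in> X. Ls S = L1} \<and>
        set (map (\<lambda>i. p (s + i, g (s + i))) [0..<s]) \<in> {S \<in> X. x \<in> Ls S}" if g: "\<forall>i<2*s. g i < t" for g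
    proof -
      have "cell p g (2 * s) \<in> G" using p(3) g by blast
      then obtain u w where uw: "u \<in> T1" "w \<in> T2" "cell p g (2 * s) = u @ w" unfolding G_def by auto
      have "[0..<2 * s] = [0..<s] @ map (\<lambda>i. s + i) [0..<s]"
        using upt_add_eq_append[of 0 s s] map_add_upt[of s s] by (simp add: mult_2 add.commute)
      then have "cell p g (2 * s) = map (\<lambda>i. p (i, g i)) [0..<s] @ map (\<lambda>i. p (s + i, g (s + i))) [0..<s]"
        unfolding cell_def by (simp add: comp_def)
      then have "u = map (\<lambda>i. p (i, g i)) [0..<s]" "w = map (\<lambda>i. p (s + i, g (s + i))) [0..<s]"
        using uw(3) len[OF uw(1)] by (simp_all add: append_eq_append_conv)
      then show ?thesis using uw(1,2) unfolding T1_def T2_def by blast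
    qed
    define SS where "SS j = p ` (\<lambda>i. (s + i, j)) ` {..<s}" for j
    have SSI: "(\<lambda>i. (s + i, j)) ` {..<s} \<subseteq> ?I" if "j < t" for j using that by auto
    have SS: "SS j \<in> nsets P s" "x \<in> Ls (SS j)" "card (SS j) = s" if j: "j < t" for j
    proof -
      have "set (map (\<lambda>i. p (s + i, (if s + i < s then 0 else j))) [0..<s]) \<in> {S \<in> X. x \<in> Ls S}"
        using cells[of "\<lambda>i. if i < s then 0 else j"] j unfolding t_def by auto
      moreover have "set (map (\<lambda>i. p (s + i, (if s + i < s then 0 else j))) [0..<s]) = SS j"
        unfolding SS_def by auto
      ultimately have 1: "SS j \<in> X" "x \<in> Ls (SS j)" by auto
      have "SS j \<subseteq> P" unfolding SS_def P_def using SSI[OF j] by blast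
      then show "SS j \<in> nsets P s" "x \<in> Ls (SS j)" "card (SS j) = s" using 1 XV unfolding nsets_def by auto
    qed
    have disSS: "SS i \<inter> SS j = {}" if ij: "i < t" "j < t" "i \<noteq> j" for i j
    proof -
      have "SS i \<inter> SS j = p ` ((\<lambda>a. (s + a, i)) ` {..<s} \<inter> (\<lambda>a. (s + a, j)) ` {..<s})"
        unfolding SS_def using inj_on_image_Int[OF inj SSI[OF ij(1)] SSI[OF ij(2)]] by simp
      also have "(\<lambda>a. (s + a, i)) ` {..<s} \<inter> (\<lambda>a. (s + a, j)) ` {..<s} = {}" using ij by auto
      finally show ?thesis by simp
    qed
    \<comment> \<open>rings of length \<open>2 k - 6\<close>, the sum of the lengths \<open>k - 2\<close> and \<open>k - 4\<close> of the two paths; for \<open>k = 4\<close> this would be too short\<close>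
    define \<kappa> where "\<kappa> = (if k = 4 then 2 else k - 3)"
    have \<kappa>: "2 \<le> \<kappa>" "2 * \<kappa> \<le> t" using k unfolding \<kappa>_def t_def by auto
    define f where "f q = p ` (\<lambda>i. (i, ring_pos \<kappa> q i)) ` {..<s}" for q
    define v where "v q = p (ring_link q)" for q
    have "inj_on p ({..<s} \<times> {..<t})" by (rule inj_on_subset[OF inj]) auto
    from cell_ring_of_box[OF this s \<kappa>(2,1)]
    have ring: "cell_ring (2 * \<kappa>) s f v" unfolding f_def v_def .
    have fI: "(\<lambda>i. (i, ring_pos \<kappa> q i)) ` {..<s} \<subseteq> ?I" if "q < 2 * \<kappa>" for q
    proof -
      have "ring_pos \<kappa> q i < t" for i using ring_pos_less[OF that, of i] \<kappa>(2) by linarith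
      then show ?thesis by auto
    qed
    have fP: "f q \<in> nsets P s \<and> Ls (f q) = L1" if q: "q < 2 * \<kappa>" for q
    proof -
      have "ring_pos \<kappa> q i < t" for i using ring_pos_less[OF q, of i] \<kappa>(2) by linarith
      then have "set (map (\<lambda>i. p (i, ring_pos \<kappa> q i)) [0..<s]) \<in> {S \<in> X. Ls S = L1}" using cells[of "ring_pos \<kappa> q"] by blast
      moreover have "set (map (\<lambda>i. p (i, ring_pos \<kappa> q i)) [0..<s]) = f q" unfolding f_def by auto
      ultimately have 1: "f q \<in> X" "Ls (f q) = L1" by auto
      have "f q \<subseteq> P" unfolding f_def P_def using fI[OF q] by blast
      then show ?thesis using 1 XV unfolding nsets_def by auto
    qed
    have disSf: "SS j \<inter> f q = {}" if jq: "j < t" "q < 2 * \<kappa>" for j q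
    proof -
      have "SS j \<inter> f q = p ` ((\<lambda>a. (s + a, j)) ` {..<s} \<inter> (\<lambda>i. (i, ring_pos \<kappa> q i)) ` {..<s})"
        unfolding SS_def f_def using inj_on_image_Int[OF inj SSI[OF jq(1)] fI[OF jq(2)]] by simp
      also have "(\<lambda>a. (s + a, j)) ` {..<s} \<inter> (\<lambda>i. (i, ring_pos \<kappa> q i)) ` {..<s} = {}" by auto
      finally show ?thesis by simp
    qed
    have t4: "0 < t" "1 < t" "2 < t" "3 < t" unfolding t_def by auto
    obtain R0 where R0: "R0 \<subseteq> SS 2" "card R0 = s - 2" "finite R0"
      using obtain_subset_with_card_n[of "s - 2" "SS 2"] SS(3)[OF t4(3)] by (metis diff_le_self)
    obtain R1 where R1: "R1 \<subseteq> SS 3" "card R1 = s - 2" "finite R1"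
      using obtain_subset_with_card_n[of "s - 2" "SS 3"] SS(3)[OF t4(4)] by (metis diff_le_self)
    have ne: "SS 0 \<noteq> {}" "SS 1 \<noteq> {}" using SS(3)[OF t4(1)] SS(3)[OF t4(2)] s by auto
    then obtain a0 a1 where a: "a0 \<in> SS 0" "a1 \<in> SS 1" by blast
    have RP: "R0 \<subseteq> P" "R1 \<subseteq> P" using R0(1) R1(1) SS(1)[OF t4(3)] SS(1)[OF t4(4)] unfolding nsets_def by auto
    have arm: "arms_disjoint (2 * \<kappa>) f (SS 0) (SS 1) R0 R1"
    proof -
      have d: "SS 0 \<inter> SS 1 = {}" "SS 2 \<inter> SS 3 = {}" "SS 2 \<inter> SS 0 = {}" "SS 2 \<inter> SS 1 = {}" "SS 3 \<inter> SS 0 = {}" "SS 3 \<inter> SS 1 = {}"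
        by (rule disSS; use t4 in simp)+
      have sub: "A \<inter> B = {}" if "A \<subseteq> A'" "B \<subseteq> B'" "A' \<inter> B' = {}" for A B A' B' :: "'a set"
        using that by blast
      have e: "SS 0 \<inter> f i = {}" "SS 1 \<inter> f i = {}" "SS 2 \<inter> f i = {}" "SS 3 \<inter> f i = {}" if "i < 2 * \<kappa>" for i
        by (rule disSf[OF _ that]; use t4 in simp)+
      have Rf: "R0 \<inter> f i = {} \<and> R1 \<inter> f i = {}" if "i < 2 * \<kappa>" for i
        using sub[OF R0(1) order_refl e(3)[OF that]] sub[OF R1(1) order_refl e(4)[OF that]] by simp
      have "R0 \<inter> R1 = {}" "R0 \<inter> SS 0 = {}" "R0 \<inter> SS 1 = {}" "R1 \<inter> SS 0 = {}" "R1 \<inter> SS 1 = {}"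
        by (rule sub[OF R0(1) R1(1) d(2)], rule sub[OF R0(1) order_refl d(3)], rule sub[OF R0(1) order_refl d(4)],
            rule sub[OF R1(1) order_refl d(5)], rule sub[OF R1(1) order_refl d(6)])
      then show ?thesis unfolding arms_disjoint_def by (intro conjI allI impI d(1) e(1,2) Rf[THEN conjunct1] Rf[THEN conjunct2])
    qed
    note S01 = SS(1)[OF t4(1)] SS(1)[OF t4(2)] SS(2)[OF t4(1)] SS(2)[OF t4(2)]
    show "has_cycle k H"
    proof (cases "k = 4")
      case True
      then have \<kappa>4: "2 * \<kappa> = 4" unfolding \<kappa>_def by simp
      show ?thesis
        by (rule exchange_short[OF True ring[unfolded \<kappa>4] fP[unfolded \<kappa>4] S01 a RP R0(3) R1(3) R0(2) R1(2) arm[unfolded \<kappa>4]])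
    next
      case False
      then have k5: "5 \<le> k" and K: "2 * \<kappa> = 2 * k - 6" using k unfolding \<kappa>_def by auto
      show ?thesis
        by (rule exchange_long[OF k5 K ring fP S01 a RP R0(3) R1(3) R0(2) R1(2) arm])
    qed
  qed
qed

text \<open>
If the lists are not exhausted by \<open>L\<close>, a path of \<open>k - 1\<close> cells with rare colours is closed by a set \<open>Q\<close> with
arbitrary colour. Unlike rings of a box, this works for both parities, and rareness of the colours on the path
prevents any conflict with the colour of \<open>Q\<close>.
\<close>

lemma core_box_closing:
  assumes box: "core_box s q (2 * k) V D X Col A L P" and Lq: "card L < q" and s: "2 \<le> s" and k: "4 \<le> k"
    and D: "D \<subseteq> nsets V s" "\<And>S. S \<in> D \<Longrightarrow> finite (A S) \<and> card (A S) = q \<and> A S \<subseteq> Col S"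
    and edge: "\<And>S c. S \<in> X \<Longrightarrow> c \<in> Col S \<Longrightarrow> insert c S \<in> H" and ne: "\<And>S. S \<in> X \<Longrightarrow> Col S \<noteq> {}"
  shows "has_cycle k H"
proof -
  note PX = core_boxD(5)[OF box] and PC = core_boxD(6)[OF box] and light = core_boxD(7)[OF box _ _ _ _ _ Lq]
  obtain f v where ring: "cell_ring (2 * k) s f v" and f: "\<forall>i<2 * k. f i \<in> D \<and> L \<subseteq> A (f i) \<and> f i \<subseteq> P"
    using core_boxD(8)[OF box, of k] k by auto
  have K4: "4 \<le> 2 * k" using k by simp
  have fP: "f i \<in> nsets P s" "f i \<in> D" "L \<subseteq> A (f i)" if "i < 2 * k" for i
  proof -
    show "f i \<in> D" "L \<subseteq> A (f i)" using f that by auto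
    then show "f i \<in> nsets P s" using f that D(1) unfolding nsets_def by auto
  qed
  have "\<exists>y. y \<in> A (f i) - L" if "i < k" for i
  proof -
    have "card (A (f i)) = q" using D(2) fP(2)[of i] that by simp
    then have "\<not> A (f i) \<subseteq> L" using card_mono[OF core_boxD(1)[OF box], of "A (f i)"] Lq by auto
    then show ?thesis by blast
  qed
  then obtain y where y: "\<And>i. i < k \<Longrightarrow> y i \<in> A (f i) - L" by metis
  have fd: "f i \<inter> f j = {}" if "Suc i < j" "j < 2 * k" "\<not> (i = 0 \<and> Suc j = 2 * k)" for i j
    using cell_ring_inter(3)[OF ring that] .
  have "f 0 \<inter> f (2 * k - 1) = {v 0}" using cell_ring_inter(2)[OF ring] k by simp
  then have v0: "v 0 \<in> f 0" by blast
  have sk: "Suc (k - 2) = k - 1" "k - 2 < 2 * k" "k - 1 < 2 * k" using k by linarith+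
  have "f (k - 2) \<inter> f (Suc (k - 2)) = {v (Suc (k - 2))}" using k by (intro cell_ring_inter(1)[OF ring]) simp
  then have v1: "v (k - 1) \<in> f (k - 2)" unfolding sk by blast
  have v0only: "v 0 \<notin> f i" if "0 < i" "i < 2 * k - 1" for i
  proof -
    have "i < 2 * k" using that by simp
    then show ?thesis using ring_link_only[OF ring K4, of 0 i] that by auto
  qed
  have v1only: "v (k - 1) \<notin> f i" if "i < k - 2 \<or> i = k" for i
  proof -
    have "i < 2 * k" "i \<noteq> k - 1" "Suc i \<noteq> k - 1" "k - 1 \<noteq> 0" using that k by linarith+
    then show ?thesis using ring_link_only[OF ring K4 sk(3), of i] by auto
  qed
  have vne: "v 0 \<noteq> v (k - 1)"
  proof
    assume "v 0 = v (k - 1)"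
    then have "v 0 \<in> f (k - 2)" using v1 by simp
    moreover have "0 < k - 2" "k - 2 < 2 * k - 1" using k by linarith+
    ultimately show False using v0only by blast
  qed
  have fk: "card (f k) = s" "finite (f k)" "f k \<subseteq> P" using fP(1)[of k] k unfolding nsets_def by auto
  obtain R where R: "R \<subseteq> f k" "card R = s - 2" "finite R"
    using obtain_subset_with_card_n[of "s - 2" "f k"] fk(1) by (metis diff_le_self)
  define Q where "Q = {v 0, v (k - 1)} \<union> R"
  have "k < 2 * k - 1" "0 < k" using k by linarith+
  then have "v 0 \<notin> R" "v (k - 1) \<notin> R" using R(1) v0only[of k] v1only[of k] by auto
  then have "card Q = card {v 0, v (k - 1)} + card R" unfolding Q_def using R(3) by (intro card_Un_disjoint) auto
  then have "card Q = s" using vne R(2) s by simp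
  moreover have "Q \<subseteq> P"
  proof -
    have "f 0 \<subseteq> P" "f (k - 2) \<subseteq> P" using f k by auto
    then show ?thesis using v0 v1 fk(3) R(1) unfolding Q_def by blast
  qed
  ultimately have Q: "Q \<in> nsets P s" using R(3) unfolding nsets_def Q_def by auto
  have Qf: "Q \<inter> f i = {}" if "0 < i" "i < k - 2" for i
  proof -
    have "f i \<inter> f k = {}" by (rule fd) (use that k in linarith)+
    moreover have "v 0 \<notin> f i" "v (k - 1) \<notin> f i" using v0only[of i] v1only[of i] that by auto
    ultimately show ?thesis using R(1) unfolding Q_def by auto
  qed
  obtain z where z: "z \<in> Col Q" using ne[OF PX[OF Q]] by blast
  define g where "g i = (if i = k - 1 then Q else f i)" for i
  define col where "col i = (if i = k - 1 then z else y i)" for i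
  have gl: "g (k - 1) = Q" "col (k - 1) = z" unfolding g_def col_def by simp_all
  have gm: "g i = f i" "col i = y i" if "i < k - 1" for i using that unfolding g_def col_def by simp_all
  have gP: "g i \<in> nsets P s" if "i < k" for i using that Q fP(1)[of i] unfolding g_def by auto
  have cC: "col i \<in> Col (g i)" if "i < k" for i
  proof (cases "i = k - 1")
    case False
    then have i: "i < k - 1" using that by simp
    have "y i \<in> Col (f i)" using y[OF that] D(2)[OF fP(2)[of i]] that by auto
    then show ?thesis using gm[OF i] by simp
  qed (use gl z in simp)
  show ?thesis
  proof (rule has_cycle_coloured[where f = g and col = col])
    show "insert (col i) (g i) \<in> H" if "i < k" for i using edge[OF PX[OF gP[OF that]] cC[OF that]] .
    show "col i \<notin> g j" if "i < k" "j < k" for i j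
      using PC[OF gP[OF that(1)]] cC[OF that(1)] gP[OF that(2)] unfolding nsets_def by auto
    show "g i \<inter> g (Suc i) \<noteq> {} \<or> col i = col (Suc i)" if i: "Suc i < k" for i
    proof (cases "Suc i = k - 1")
      case True
      then have "i = k - 2" by simp
      then have "g i = f (k - 2)" "g (Suc i) = Q" using gm[of i] gl True by simp_all
      then show ?thesis using v1 unfolding Q_def by auto
    next
      case False
      then have "g i = f i" "g (Suc i) = f (Suc i)" using gm i by auto
      then show ?thesis using cell_ring_inter(1)[OF ring, of i] i by simp
    qed
    have "g 0 = f 0" using gm(1)[of 0] k by simp
    then show "g 0 \<inter> g (k - 1) \<noteq> {} \<or> col 0 = col (k - 1)" using gl v0 unfolding Q_def by auto
    fix i j assume ij: "Suc i < j" "j < k" "\<not> (i = 0 \<and> Suc j = k)"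
    have i: "i < k - 1" "i < k" using ij by linarith+
    show "g i \<inter> g j = {} \<and> col i \<noteq> col j"
    proof (cases "j = k - 1")
      case True
      then have "0 < i" "i < k - 2" using ij by linarith+
      from Qf[OF this] have dis: "Q \<inter> f i = {}" .
      have "Col Q \<inter> (A (f i) - L) = {}" using fP[of i] i by (intro light Q dis) auto
      then have "z \<noteq> y i" using z y[OF i(2)] by auto
      then show ?thesis using True dis gl gm[OF i(1)] by auto
    next
      case False
      then have j: "j < k - 1" using ij by simp
      have dis: "f i \<inter> f j = {}" by (rule fd) (use ij in linarith)+
      have "Col (f i) \<inter> (A (f j) - L) = {}" using fP[of i] fP[of j] i ij by (intro light dis) auto
      moreover have "y i \<in> Col (f i)" using cC[OF i(2)] gm[OF i(1)] by simp
      moreover have "y j \<in> A (f j) - L" using y ij by simp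
      ultimately have "y i \<noteq> y j" by (metis disjoint_iff)
      then show ?thesis using dis gm[OF i(1)] gm[OF j] by simp
    qed
  qed
qed

lemma binomial_le_power: "a choose b \<le> a ^ b"
  by (cases "b \<le> a") (auto intro: binomial_le_pow simp: not_le binomial_eq_0)

lemma binomial_drop:
  assumes "j \<le> n" "1 \<le> s"
  shows "n choose s \<le> ((n - j) choose s) + j * n ^ (s - 1)"
  using assms(1)
proof (induction j)
  case (Suc j)
  obtain a where a: "n - j = Suc a" using Suc.prems by (metis Suc_diff_Suc Suc_le_lessD)
  obtain t where t: "s = Suc t" using assms(2) by (metis Suc_le_D One_nat_def)
  have "(n - j) choose s = (a choose s) + (a choose t)" unfolding a t by simp
  also have "a choose t \<le> a ^ t" by (rule binomial_le_power)
  also have "a ^ t \<le> n ^ t" using a by (intro power_mono) auto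
  finally have "(n - j) choose s \<le> (a choose s) + n ^ t" by simp
  moreover have "a = n - Suc j" using a by simp
  ultimately show ?case using Suc t by simp
qed simp

text \<open>
The star of an \<open>l\<close>-set has almost \<open>l * (n choose s)\<close> edges, where \<open>Suc s\<close> is the size of an edge.
\<close>

lemma binomial_shift:
  assumes "l \<le> n" "1 \<le> s"
  shows "l * (n choose s) + ((n - l) choose Suc s) \<le> (n choose Suc s) + l * l * n ^ (s - 1)"
  using assms(1)
proof (induction l)
  case (Suc l)
  obtain a where a: "n - l = Suc a" using Suc.prems by (metis Suc_diff_Suc Suc_le_lessD)
  then have a': "n - Suc l = a" by simp
  have "(n - l) choose Suc s = (a choose Suc s) + (a choose s)" unfolding a by simp
  moreover have "n choose s \<le> (a choose s) + Suc l * n ^ (s - 1)"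
    using binomial_drop[OF Suc.prems assms(2)] unfolding a' .
  moreover have "l * (n choose s) + ((n - l) choose Suc s) \<le> (n choose Suc s) + l * l * n ^ (s - 1)"
    using Suc by simp
  moreover have "Suc l * Suc l * n ^ (s - 1) = l * l * n ^ (s - 1) + Suc l * n ^ (s - 1) + l * n ^ (s - 1)"
    by (simp add: algebra_simps)
  ultimately show ?case unfolding a' by simp
qed simp

text \<open>
The sets that pay for the deletions number at most \<open>n choose (r - 1)\<close>, and each pays for at most \<open>l\<close>
edges. A set with fewer than \<open>l\<close> colours pays for fewer, so there are few of those.
\<close>

lemma few_poor_tuples:
  fixes \<delta> :: real
  assumes r: "3 \<le> r" and k: "4 \<le> k" and l: "l = (k - 1) div 2" and \<delta>: "0 < \<delta>"
  shows "\<exists>n0. \<forall>(V :: 'a set) H. finite V \<longrightarrow> n0 \<le> card V \<longrightarrow> H \<subseteq> nsets V r \<longrightarrow> \<not> has_cycle k H \<longrightarrow>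
     (card V choose r) - ((card V - l) choose r) \<le> card H \<longrightarrow>
     real (card {S \<in> nsets V (r - 1). card (nbr H S) < l}) \<le> \<delta> * real (card V) ^ (r - 1)"
proof -
  define d where "d = real (2 * r * k)"
  have d: "0 < d" using r k unfolding d_def by simp
  have "0 < \<delta> / (2 * d)" using \<delta> d by simp
  from full_shadow_small[OF r k l this, where 'a = 'a]
  obtain n1 where n1: "\<forall>(V :: 'a set) F. finite V \<longrightarrow> n1 \<le> card V \<longrightarrow> F \<subseteq> nsets V r \<longrightarrow> full (Suc l) F \<longrightarrow> \<not> has_cycle k F \<longrightarrow>
     real (card {S \<in> nsets V (r - 1). nbr F S \<noteq> {}}) \<le> \<delta> / (2 * d) * real (card V) ^ (r - 1)" by (elim exE) (rule that)
  obtain n2 :: nat where n2: "2 * real (l * l) / \<delta> < real n2" using reals_Archimedean2 by blast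
  show ?thesis
  proof (rule exI[of _ "max n1 (max n2 l)"], intro allI impI)
    fix V :: "'a set" and H
    assume V: "finite V" "max n1 (max n2 l) \<le> card V" and H: "H \<subseteq> nsets V r" and free: "\<not> has_cycle k H"
      and big: "(card V choose r) - ((card V - l) choose r) \<le> card H"
    let ?n = "card V" and ?s = "r - 1"
    define b where "b = card {S \<in> nsets V ?s. card (nbr H S) < l}"
    have finN: "finite (nsets V ?s)" using finite_imp_finite_nsets[OF V(1)] .
    obtain F where F: "F \<subseteq> H" "full (Suc l) F" "card H \<le> card F + (\<Sum>S\<in>nsets V ?s. min l (card (nbr H S)))"
      using peel[OF H V(1), of l] r by auto
    have FV: "F \<subseteq> nsets V r" and Ffree: "\<not> has_cycle k F" using F(1) H free has_cycle_mono by blast+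
    have "real (card F) \<le> d * real (card {S \<in> nsets V ?s. nbr F S \<noteq> {}})"
      using cycle_free_card_le_shadow[OF FV V(1) r k Ffree] unfolding d_def by (simp only: of_nat_mult[symmetric] of_nat_le_iff)
    also have "\<dots> \<le> d * (\<delta> / (2 * d) * real ?n ^ ?s)"
      using n1 V FV F(2) Ffree d by (intro mult_left_mono) auto
    also have "\<dots> = \<delta> / 2 * real ?n ^ ?s" using d by simp
    finally have cF: "real (card F) \<le> \<delta> / 2 * real ?n ^ ?s" .
    have "b = (\<Sum>S\<in>nsets V ?s. if card (nbr H S) < l then 1 else 0)"
      using finN by (simp add: b_def sum.If_cases Int_def)
    then have "(\<Sum>S\<in>nsets V ?s. min l (card (nbr H S))) + b
        = (\<Sum>S\<in>nsets V ?s. min l (card (nbr H S)) + (if card (nbr H S) < l then 1 else 0))"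
      by (simp add: sum.distrib)
    also have "\<dots> \<le> (\<Sum>S\<in>nsets V ?s. l)" by (intro sum_mono) auto
    also have "\<dots> = l * (?n choose ?s)" using card_nsets[OF V(1)] by simp
    finally have sb: "(\<Sum>S\<in>nsets V ?s. min l (card (nbr H S))) + b \<le> l * (?n choose ?s)" .
    have "l * (?n choose ?s) + ((?n - l) choose Suc ?s) \<le> (?n choose Suc ?s) + l * l * ?n ^ (?s - 1)"
      using V r by (intro binomial_shift) auto
    moreover have "Suc ?s = r" using r by simp
    moreover have "?n choose r \<le> card H + ((?n - l) choose r)" using big by (simp only: le_diff_conv)
    ultimately have "b \<le> card F + l * l * ?n ^ (?s - 1)" using sb F(3) by simp
    then have "real b \<le> real (card F) + real (l * l) * real ?n ^ (?s - 1)"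
      by (metis of_nat_add of_nat_le_iff of_nat_mult of_nat_power)
    also have "real (l * l) * real ?n ^ (?s - 1) \<le> \<delta> / 2 * real ?n ^ ?s"
    proof -
      have "2 * real (l * l) / \<delta> < real ?n" using n2 V(2) by linarith
      then have "real (l * l) \<le> \<delta> / 2 * real ?n" using \<delta> by (simp add: field_simps)
      then have "real (l * l) * real ?n ^ (?s - 1) \<le> (\<delta> / 2 * real ?n) * real ?n ^ (?s - 1)" by (intro mult_right_mono) auto
      also have "\<dots> = \<delta> / 2 * real ?n ^ Suc (?s - 1)" by simp
      also have "Suc (?s - 1) = ?s" using r by simp
      finally show ?thesis .
    qed
    finally show "real (card {S \<in> nsets V ?s. card (nbr H S) < l}) \<le> \<delta> * real ?n ^ ?s"
      using cF unfolding b_def by (simp add: field_simps)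
  qed
qed

text \<open>
First, the core of the lists is a full list \<open>L\<close>, as otherwise \<open>core_box_closing\<close> gives a cycle. The sets \<open>B\<close> with another
list are then examined through one colour \<open>c S\<close> outside \<open>L\<close>: these colours cannot be rare for the same
reason, and a frequent one contradicts \<open>exchange_box\<close>.
\<close>

lemma stability:
  fixes \<eta> :: real
  assumes r: "3 \<le> r" and k: "4 \<le> k" and l: "l = (k - 1) div 2" and \<eta>: "0 < \<eta>"
  shows "\<exists>n0. \<forall>(V :: 'a set) H. finite V \<longrightarrow> n0 \<le> card V \<longrightarrow> H \<subseteq> nsets V r \<longrightarrow> \<not> has_cycle k H \<longrightarrow>
     (card V choose r) - ((card V - l) choose r) \<le> card H \<longrightarrow>
     (\<exists>L\<subseteq>V. card L = l \<and> real (card {S \<in> nsets V (r - 1). \<not> L \<subseteq> nbr H S}) \<le> \<eta> * real (card V) ^ (r - 1))"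
proof -
  define s where "s = r - 1"
  have s: "2 \<le> s" using r by (simp add: s_def)
  have l1: "1 \<le> l" using k l by linarith
  define \<delta>1 where "\<delta>1 = 1 / (2 * real s ^ s)"
  have \<delta>1: "0 < \<delta>1" using s by (simp add: \<delta>1_def)
  from core_ring[OF s \<delta>1 order_refl[of l], of "2 * k", where 'a = 'a]
  obtain \<gamma>1 \<epsilon>1 n1 where p1: "0 < \<gamma>1" "0 < \<epsilon>1" and core1: "\<forall>(V :: 'a set) D X Col A. core_hypotheses s l l \<delta>1 \<epsilon>1 n1 V D X Col A \<longrightarrow>
     (\<exists>L P. \<gamma>1 * real (card V) ^ s \<le> real (card {S \<in> D. L \<subseteq> A S}) \<and> core_box s l (2 * k) V D X Col A L P)"
    by (elim exE conjE) (rule that)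
  have \<eta>2: "0 < \<eta> / 2" using \<eta> by simp
  from core_ring[OF s \<eta>2 l1, of "2 * k", where 'a = 'a]
  obtain \<gamma>2 \<epsilon>2 n2 where p2: "0 < \<gamma>2" "0 < \<epsilon>2" and core2: "\<forall>(V :: 'a set) D X Col A. core_hypotheses s 1 l (\<eta> / 2) \<epsilon>2 n2 V D X Col A \<longrightarrow>
     (\<exists>L P. \<gamma>2 * real (card V) ^ s \<le> real (card {S \<in> D. L \<subseteq> A S}) \<and> core_box s 1 (2 * k) V D X Col A L P)"
    by (elim exE conjE) (rule that)
  from exchange_box[OF s k l p1(1) p2(1), where 'a = 'a]
  obtain \<epsilon>3 n3 where p3: "0 < \<epsilon>3" and exch: "\<forall>(V :: 'a set) H X Ls L1 x. finite V \<longrightarrow> n3 \<le> card V \<longrightarrow> X \<subseteq> nsets V s \<longrightarrow>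
     real (card (nsets V s - X)) \<le> \<epsilon>3 * real (card V) ^ s \<longrightarrow>
     (\<forall>S\<in>X. finite (Ls S) \<and> card (Ls S) = l \<and> Ls S \<subseteq> nbr H S) \<longrightarrow>
     finite L1 \<longrightarrow> card L1 = l \<longrightarrow> x \<notin> L1 \<longrightarrow>
     \<gamma>1 * real (card V) ^ s \<le> real (card {S \<in> X. Ls S = L1}) \<longrightarrow>
     \<gamma>2 * real (card V) ^ s \<le> real (card {S \<in> X. x \<in> Ls S}) \<longrightarrow> has_cycle k H"
    by (elim exE conjE) (rule that)
  define \<delta> where "\<delta> = min (min \<delta>1 (\<eta> / 2)) (min \<epsilon>1 (min \<epsilon>2 \<epsilon>3))"
  have \<delta>: "0 < \<delta>" "\<delta> \<le> \<delta>1" "\<delta> \<le> \<eta> / 2" "\<delta> \<le> \<epsilon>1" "\<delta> \<le> \<epsilon>2" "\<delta> \<le> \<epsilon>3"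
    using \<delta>1 \<eta>2 p1 p2 p3 unfolding \<delta>_def by auto
  from few_poor_tuples[OF r k l \<delta>(1), where 'a = 'a, folded s_def]
  obtain n4 where poor: "\<forall>(V :: 'a set) H. finite V \<longrightarrow> n4 \<le> card V \<longrightarrow> H \<subseteq> nsets V r \<longrightarrow> \<not> has_cycle k H \<longrightarrow>
     (card V choose r) - ((card V - l) choose r) \<le> card H \<longrightarrow>
     real (card {S \<in> nsets V s. card (nbr H S) < l}) \<le> \<delta> * real (card V) ^ s"
    by (elim exE) (rule that)
  show ?thesis
  proof (rule exI[of _ "n1 + n2 + n3 + n4 + s"], intro allI impI)
    fix V :: "'a set" and H
    assume V: "finite V" "n1 + n2 + n3 + n4 + s \<le> card V" and H: "H \<subseteq> nsets V r" and free: "\<not> has_cycle k H"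
      and big: "(card V choose r) - ((card V - l) choose r) \<le> card H"
    let ?N = "real (card V) ^ s"
    have n: "n1 \<le> card V" "n2 \<le> card V" "n3 \<le> card V" "n4 \<le> card V" "s \<le> card V" using V(2) by linarith+
    then have N: "0 < ?N" using s by simp
    define X where "X = {S \<in> nsets V s. l \<le> card (nbr H S)}"
    have XV: "X \<subseteq> nsets V s" unfolding X_def by blast
    have finN: "finite (nsets V s)" using finite_imp_finite_nsets[OF V(1)] .
    have finX: "finite X" using XV finN finite_subset by blast
    have nX: "nsets V s - X = {S \<in> nsets V s. card (nbr H S) < l}" unfolding X_def by auto
    have Xc: "real (card (nsets V s - X)) \<le> \<delta> * ?N" unfolding nX using poor V(1) n H free big by blast
    have Xe: "real (card (nsets V s - X)) \<le> e * ?N" if "\<delta> \<le> e" for e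
    proof -
      have "\<delta> * ?N \<le> e * ?N" using that N by (intro mult_right_mono) auto
      then show ?thesis using Xc by linarith
    qed
    have nb: "finite (nbr H S)" "nbr H S \<subseteq> V" "nbr H S \<inter> S = {}" for S
      using finite_nbr[OF H V(1)] nbr_subset[OF H] unfolding nbr_def by auto
    define Ls where "Ls S = (SOME B. B \<subseteq> nbr H S \<and> card B = l)" for S
    have Ls: "Ls S \<subseteq> nbr H S \<and> card (Ls S) = l" if "S \<in> X" for S
    proof -
      have "l \<le> card (nbr H S)" using that unfolding X_def by simp
      then have "\<exists>B. B \<subseteq> nbr H S \<and> card B = l" using obtain_subset_with_card_n by metis
      then show ?thesis unfolding Ls_def by (rule someI_ex)
    qed
    have Lfin: "finite (Ls S)" if "S \<in> X" for S using Ls[OF that] nb(1) finite_subset by blast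
    define Col where "Col S = (if S \<in> X then Ls S else {})" for S
    have Col: "\<forall>S\<in>nsets V s. finite (Col S) \<and> card (Col S) \<le> l \<and> Col S \<inter> S = {}"
    proof
      fix S
      show "finite (Col S) \<and> card (Col S) \<le> l \<and> Col S \<inter> S = {}"
        using Ls[of S] Lfin[of S] nb(3)[of S] unfolding Col_def by auto
    qed
    have edge: "insert c S \<in> H" if "S \<in> X" "c \<in> Col S" for S c
      using that Ls[of S] unfolding Col_def nbr_def by auto
    have Cne: "Col S \<noteq> {}" if "S \<in> X" for S using that Ls[of S] l1 unfolding Col_def by auto
    have "\<delta>1 * ?N \<le> real (card X)"
    proof -
      have "(real (card V) / real s) ^ s \<le> real (card V choose s)"
        using binomial_ge_n_over_k_pow_k[OF n(5)] by (simp)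
      also have "\<dots> = real (card (nsets V s))" using card_nsets[OF V(1)] by simp
      also have "\<dots> = real (card X) + real (card (nsets V s - X))"
        using card_Diff_subset[OF finX XV] card_mono[OF finN XV] by simp
      finally have "(real (card V) / real s) ^ s \<le> real (card X) + \<delta>1 * ?N" using Xe[OF \<delta>(2)] by linarith
      moreover have "(real (card V) / real s) ^ s = 2 * \<delta>1 * ?N" unfolding \<delta>1_def by (simp add: power_divide)
      ultimately show ?thesis by linarith
    qed
    then have "core_hypotheses s l l \<delta>1 \<epsilon>1 n1 V X X Col Ls" unfolding core_hypotheses_def
      using V(1) n XV Ls Lfin Xe[OF \<delta>(4)] Col by blast
    then obtain L P where dL: "\<gamma>1 * ?N \<le> real (card {S \<in> X. L \<subseteq> Ls S})" and box: "core_box s l (2 * k) V X X Col Ls L P"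
      using core1 by blast
    have "\<not> card L < l"
      using core_box_closing[OF box _ s k XV _ edge Cne] Ls Lfin free unfolding Col_def by auto
    then have L: "card L = l" "finite L" using core_boxD(1,2)[OF box] by linarith+
    have Leq: "{S \<in> X. L \<subseteq> Ls S} = {S \<in> X. Ls S = L}"
    proof -
      have "L = Ls S" if "S \<in> X" "L \<subseteq> Ls S" for S
        using card_subset_eq[OF Lfin[OF that(1)] that(2)] Ls[OF that(1)] L(1) by simp
      then show ?thesis by auto
    qed
    have LV: "L \<subseteq> V"
    proof -
      have "0 < \<gamma>1 * ?N" using p1 N by simp
      then have "{S \<in> X. L \<subseteq> Ls S} \<noteq> {}" using dL by (metis card.empty of_nat_0 not_le)
      then obtain S where "S \<in> X" "L \<subseteq> Ls S" by blast
      then show ?thesis using Ls[of S] nb(2)[of S] by auto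
    qed
    define B where "B = {S \<in> X. Ls S \<noteq> L}"
    have BX: "B \<subseteq> X" unfolding B_def by blast
    have Bsmall: "real (card B) \<le> \<eta> / 2 * ?N"
    proof (rule ccontr)
      assume "\<not> ?thesis"
      then have Bbig: "\<eta> / 2 * ?N \<le> real (card B)" by linarith
      define c where "c S = (SOME x. x \<in> Ls S - L)" for S
      have c: "c S \<in> Ls S - L" if "S \<in> B" for S
      proof -
        have S: "S \<in> X" "Ls S \<noteq> L" using that unfolding B_def by auto
        have "\<not> Ls S \<subseteq> L" using card_subset_eq[OF L(2), of "Ls S"] Ls[OF S(1)] L(1) S(2) by auto
        then have "\<exists>x. x \<in> Ls S - L" by blast
        then show ?thesis unfolding c_def by (rule someI_ex)
      qed
      have cC: "finite {c S} \<and> card {c S} = 1 \<and> {c S} \<subseteq> Col S" if "S \<in> B" for S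
        using c[OF that] BX that unfolding Col_def by auto
      have BV: "B \<subseteq> nsets V s" using BX XV by blast
      have "core_hypotheses s 1 l (\<eta> / 2) \<epsilon>2 n2 V B X Col (\<lambda>S. {c S})" unfolding core_hypotheses_def
        using V(1) n BV Bbig Xe[OF \<delta>(5)] Col by simp
      then obtain L2 P2 where d2: "\<gamma>2 * ?N \<le> real (card {S \<in> B. L2 \<subseteq> {c S}})"
        and box2: "core_box s 1 (2 * k) V B X Col (\<lambda>S. {c S}) L2 P2" using core2 by blast
      have "\<not> card L2 < 1"
        using core_box_closing[OF box2 _ s k BV cC edge Cne] free by blast
      then have "card L2 = 1" using core_boxD(2)[OF box2] by linarith
      then obtain x where x: "L2 = {x}" using card_1_singletonE by blast
      have "0 < \<gamma>2 * ?N" using p2 N by simp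
      then have "{S \<in> B. L2 \<subseteq> {c S}} \<noteq> {}" using d2 by (metis card.empty of_nat_0 not_le)
      then obtain S0 where "S0 \<in> B" "x = c S0" using x by blast
      then have xL: "x \<notin> L" using c by blast
      have "{S \<in> B. L2 \<subseteq> {c S}} \<subseteq> {S \<in> X. x \<in> Ls S}" using c BX x by auto
      then have "card {S \<in> B. L2 \<subseteq> {c S}} \<le> card {S \<in> X. x \<in> Ls S}" using finX by (intro card_mono finite_filter)
      then have "\<gamma>2 * ?N \<le> real (card {S \<in> X. x \<in> Ls S})" using d2 by linarith
      then have "has_cycle k H"
        using exch V(1) n(3) XV Xe[OF \<delta>(6)] Ls Lfin L xL dL[unfolded Leq] by blast
      then show False using free by simp
    qed
    have "{S \<in> nsets V s. \<not> L \<subseteq> nbr H S} \<subseteq> (nsets V s - X) \<union> B" using Ls unfolding B_def by auto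
    then have "card {S \<in> nsets V s. \<not> L \<subseteq> nbr H S} \<le> card ((nsets V s - X) \<union> B)"
      using finN finX BX by (intro card_mono) (auto intro: finite_subset)
    also have "\<dots> \<le> card (nsets V s - X) + card B" by (rule card_Un_le)
    finally have "real (card {S \<in> nsets V s. \<not> L \<subseteq> nbr H S}) \<le> \<eta> / 2 * ?N + \<eta> / 2 * ?N"
      using Bsmall Xe[OF \<delta>(3)] by linarith
    then show "\<exists>L\<subseteq>V. card L = l \<and> real (card {S \<in> nsets V (r - 1). \<not> L \<subseteq> nbr H S}) \<le> \<eta> * real (card V) ^ (r - 1)"
      using LV L(1) unfolding s_def by (intro exI[of _ L]) (simp add: field_simps)
  qed
qed

section \<open>Cycles in a hypergraph close to a star\<close>

text \<open>
Cores of a path in the star: its edges run through \<open>w 0\<close>, \<open>x 0\<close>, \<open>w 1\<close>, \<open>x 1\<close>, and so on, where the \<open>x j\<close> are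
centres of the star.
\<close>

definition arc :: "(nat \<Rightarrow> 'a) \<Rightarrow> (nat \<Rightarrow> 'a) \<Rightarrow> nat \<Rightarrow> 'a set" where
  "arc w x i = {w (i div 2), x ((i - 1) div 2)}"

lemma arc_consecutive: "1 \<le> i \<Longrightarrow> arc w x i \<inter> arc w x (Suc i) \<noteq> {}"
proof -
  assume "1 \<le> i"
  then have "(i - 1) div 2 = (Suc i - 1) div 2 \<or> i div 2 = Suc i div 2" by presburger
  then show ?thesis unfolding arc_def by auto
qed

lemma arc_disjoint:
  assumes "inj_on w {..l}" "inj_on x {..<l}" "\<And>i j. i \<le> l \<Longrightarrow> j < l \<Longrightarrow> w i \<noteq> x j"
    and "1 \<le> i" "Suc i < j" "j \<le> 2 * l"
  shows "arc w x i \<inter> arc w x j = {}"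
proof -
  have d: "i div 2 < j div 2" "j div 2 \<le> l" "(i - 1) div 2 < (j - 1) div 2" "(j - 1) div 2 < l" using assms(4-6) by linarith+
  have "w (i div 2) \<noteq> w (j div 2)"
    using inj_on_eq_iff[OF assms(1), of "i div 2" "j div 2"] d by auto
  moreover have "x ((i - 1) div 2) \<noteq> x ((j - 1) div 2)"
    using inj_on_eq_iff[OF assms(2), of "(i - 1) div 2" "(j - 1) div 2"] d by auto
  moreover have "w (i div 2) \<noteq> x ((j - 1) div 2)" "w (j div 2) \<noteq> x ((i - 1) div 2)" using assms(3) d by auto
  ultimately show ?thesis unfolding arc_def by auto
qed

text \<open>
\<open>Gd\<close> is a set of good vertices: every pair of a good vertex and a centre extends to an edge by good vertices
that avoid a given bounded set.
\<close>

locale near_star =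
  fixes r k l :: nat and V :: "'a set" and H :: "'a set set" and L Gd :: "'a set"
  assumes r: "3 \<le> r" and k: "4 \<le> k" and l: "l = (k - 1) div 2"
    and V: "finite V" and H: "H \<subseteq> nsets V r" and free: "\<not> has_cycle k H"
    and L: "finite L" "card L = l" and GL: "Gd \<inter> L = {}" and GV: "Gd \<subseteq> V"
    and pick: "\<And>v x U. v \<in> Gd \<Longrightarrow> x \<in> L \<Longrightarrow> finite U \<Longrightarrow> card U \<le> 2 * r * k \<Longrightarrow>
       \<exists>R\<subseteq>Gd. card R = r - 2 \<and> R \<inter> U = {} \<and> v \<notin> R \<and> {v, x} \<union> R \<in> H"
    and many: "2 * r * k \<le> card Gd"
begin

lemma l1: "1 \<le> l" using k l by linarith

lemma kl: "odd k \<Longrightarrow> k = 2 * l + 1" "even k \<Longrightarrow> k = 2 * l + 2" "k \<le> 2 * l + 2" using k l by presburger+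

lemma edge_fin: "f \<in> H \<Longrightarrow> finite f \<and> card f = r" using H unfolding nsets_def by auto

lemma core_cycle:
  assumes pat: "cyclic_pattern k core"
    and core: "\<And>i. i < k \<Longrightarrow> core i \<in> H \<or> (\<exists>v\<in>Gd. \<exists>x\<in>L. core i = {v, x})"
  shows False
proof -
  have "has_cycle k H"
  proof (rule expand_cores[OF pat, of "2 * r * k" r])
    fix i and U :: "'a set" assume i: "i < k" and U: "finite U" "card U \<le> 2 * r * k"
    consider "core i \<in> H" | v x where "v \<in> Gd" "x \<in> L" "core i = {v, x}" using core[OF i] by blast
    then show "\<exists>R. finite R \<and> card R \<le> r \<and> R \<inter> U = {} \<and> core i \<union> R \<in> H"
    proof cases
      case 1
      then show ?thesis by (intro exI[of _ "{}"]) simp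
    next
      case 2
      obtain R where R: "R \<subseteq> Gd" "card R = r - 2" "R \<inter> U = {}" "{v, x} \<union> R \<in> H"
        using pick[OF 2(1,2) U] by blast
      have "finite R" by (rule finite_subset[OF subset_trans[OF R(1) GV] V])
      moreover have "card R \<le> r" using R(2) by simp
      ultimately show ?thesis using R(3,4) unfolding 2(3) by (intro exI[of _ R] conjI)
    qed
  next
    fix i assume i: "i < k"
    show "finite (core i) \<and> card (core i) \<le> r"
    proof (cases "core i \<in> H")
      case False
      then obtain v x where "core i = {v, x}" using core[OF i] by blast
      then show ?thesis using r by (simp add: card_insert_if)
    qed (use edge_fin in simp)
  qed simp
  then show False using free by simp
qed

lemma labels:
  obtains x where "inj_on x {..<l}" "\<And>i. i < l \<Longrightarrow> x i \<in> L"
proof -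
  obtain x where "bij_betw x {0..<l} L" using ex_bij_betw_nat_finite[OF L(1)] L(2) by auto
  then have "inj_on x {..<l}" "\<And>i. i < l \<Longrightarrow> x i \<in> L" unfolding bij_betw_def by (auto simp: atLeast0LessThan)
  then show thesis using that by blast
qed

lemma fresh_links:
  assumes "finite U" "card U \<le> 3 * r"
  obtains p where "inj_on p {..l}" "\<And>i. i \<le> l \<Longrightarrow> p i \<in> Gd - U"
proof -
  have "finite Gd" by (rule finite_subset[OF GV V])
  have "2 * l + 1 \<le> k" using kl k by (cases "odd k") auto
  then have "3 * r + (l + 1) \<le> 2 * r * k"
  proof -
    have "r * 4 \<le> r * k" "3 * k \<le> r * k" using k r by simp_all
    moreover have "l + 1 \<le> 3 * k" using \<open>2 * l + 1 \<le> k\<close> by linarith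
    moreover have "2 * r * k = r * k + r * k" by simp
    ultimately show ?thesis by linarith
  qed
  moreover have "card Gd - card U \<le> card (Gd - U)" using assms(1) by (rule diff_card_le_card_Diff)
  ultimately have "l + 1 \<le> card (Gd - U)" using many assms(2) by linarith
  then obtain T where T: "T \<subseteq> Gd - U" "card T = l + 1" "finite T" using obtain_subset_with_card_n by metis
  obtain p where "bij_betw p {0..<l+1} T" using ex_bij_betw_nat_finite[OF T(3)] T(2) by auto
  then have "inj_on p {..l}" "\<And>i. i \<le> l \<Longrightarrow> p i \<in> T" unfolding bij_betw_def by (auto simp: atLeast0LessThan lessThan_Suc_atMost)
  then show thesis using that T(1) by blast
qed

text \<open>
The vertices \<open>w 0, \<dots>, w l\<close> of an arc, two of which are prescribed while the others avoid \<open>U\<close>.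
\<close>

lemma links_between:
  assumes "finite U" "card U \<le> 3 * r" "a \<in> Gd" "b \<in> Gd" "a \<in> U" "b \<in> U" "a \<noteq> b" "j < l"
  obtains w where "\<And>i. i \<le> l \<Longrightarrow> w i \<in> Gd" "w l = b" "w j = a"
    "\<And>i. i < l \<Longrightarrow> i \<noteq> j \<Longrightarrow> w i \<notin> U" "inj_on w {..l}"
proof -
  obtain p where p: "inj_on p {..l}" "\<And>i. i \<le> l \<Longrightarrow> p i \<in> Gd - U" using fresh_links[OF assms(1,2)] by blast
  have pn: "p i \<noteq> a" "p i \<noteq> b" if "i \<le> l" for i using p(2)[OF that] assms(5,6) by auto
  define w where "w i = (if i = l then b else if i = j then a else p i)" for i
  have "inj_on w {..l}"
  proof (rule inj_onI)
    fix i i' assume i: "i \<in> {..l}" "i' \<in> {..l}" and eq: "w i = w i'"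
    show "i = i'"
      using eq i assms(7,8) pn[of i] pn[of i'] inj_onD[OF p(1), of i i'] unfolding w_def by (auto split: if_splits)
  qed
  moreover have "w i \<in> Gd" if "i \<le> l" for i using p(2)[OF that] assms(3,4) unfolding w_def by auto
  moreover have "w i \<notin> U" if "i < l" "i \<noteq> j" for i using p(2)[of i] that unfolding w_def by auto
  moreover have "w l = b" "w j = a" using assms(8) unfolding w_def by auto
  ultimately show thesis using that by blast
qed

text \<open>
An arc through all \<open>l\<close> centres has \<open>2 l = k - 1\<close> edges and connects two vertices of \<open>f\<close>.
\<close>

lemma odd_two_good:
  assumes odd: "odd k" and f: "f \<in> H" "f \<inter> L = {}" and ab: "a \<in> f" "b \<in> f" "a \<in> Gd" "b \<in> Gd" "a \<noteq> b"
  shows False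
proof -
  have kk: "k = 2 * l + 1" using kl odd by blast
  obtain x where x: "inj_on x {..<l}" "\<And>i. i < l \<Longrightarrow> x i \<in> L" using labels by blast
  obtain w where w: "\<And>i. i \<le> l \<Longrightarrow> w i \<in> Gd" "w l = b" "w 0 = a" "\<And>i. i < l \<Longrightarrow> i \<noteq> 0 \<Longrightarrow> w i \<notin> f" "inj_on w {..l}"
    using links_between[of f a b 0] edge_fin[OF f(1)] ab l1 by auto
  have wx: "w i \<noteq> x j" if "i \<le> l" "j < l" for i j using w(1)[OF that(1)] x(2)[OF that(2)] GL by auto
  have xf: "x j \<notin> f" if "j < l" for j using x(2)[OF that] f(2) by auto
  have ij: "i div 2 \<le> l" "(i - 1) div 2 < l" if "1 \<le> i" "i \<le> 2 * l" for i using that by linarith+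
  let ?c = "\<lambda>i. if i = 0 then f else arc w x i"
  have "cyclic_pattern k ?c"
  proof (rule cyclic_patternI)
    fix i assume "Suc i < k"
    show "?c i \<inter> ?c (Suc i) \<noteq> {}"
    proof (cases "i = 0")
      case True
      then show ?thesis using w(3) ab unfolding arc_def by simp
    next
      case False
      then show ?thesis using arc_consecutive[of i w x] by simp
    qed
  next
    have "w l \<in> arc w x (2 * l)" unfolding arc_def by simp
    then show "?c 0 \<inter> ?c (k - 1) \<noteq> {}" using w(2) ab l1 unfolding kk by auto
  next
    fix i j assume a: "Suc i < j" "j < k" "\<not> (i = 0 \<and> Suc j = k)"
    show "?c i \<inter> ?c j = {}"
    proof (cases "i = 0")
      case True
      have "j div 2 < l" "j div 2 \<noteq> 0" using a True unfolding kk by linarith+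
      then have "w (j div 2) \<notin> f" by (rule w(4))
      moreover have "x ((j - 1) div 2) \<notin> f" using a unfolding kk by (intro xf) linarith
      ultimately show ?thesis using True a unfolding arc_def by auto
    next
      case False
      then show ?thesis using arc_disjoint[OF w(5) x(1) wx, of i j] a unfolding kk by auto
    qed
  qed
  then show False
  proof (rule core_cycle)
    fix i assume i: "i < k"
    show "?c i \<in> H \<or> (\<exists>v\<in>Gd. \<exists>x\<in>L. ?c i = {v, x})"
    proof (cases "i = 0")
      case False
      then have "w (i div 2) \<in> Gd" "x ((i - 1) div 2) \<in> L" using i unfolding kk by (intro w(1) x(2); linarith)+
      then show ?thesis using False unfolding arc_def
        by (intro disjI2 bexI[of _ "w (i div 2)"] bexI[of _ "x ((i - 1) div 2)"]) simp_all
    qed (use f in simp)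
  qed
qed

text \<open>
An arc through all \<open>l\<close> centres has \<open>2 l = k - 2\<close> edges and connects a vertex of \<open>f\<close> with one of \<open>f'\<close>.
\<close>

lemma even_private_good:
  assumes even: "even k" and f: "f \<in> H" "f \<inter> L = {}" "f' \<in> H" "f' \<inter> L = {}" "f \<inter> f' \<noteq> {}"
    and ab: "a \<in> f - f'" "b \<in> f' - f" "a \<in> Gd" "b \<in> Gd"
  shows False
proof -
  have kk: "k = 2 * l + 2" using kl even by blast
  obtain x where x: "inj_on x {..<l}" "\<And>i. i < l \<Longrightarrow> x i \<in> L" using labels by blast
  have U: "finite (f \<union> f')" "card (f \<union> f') \<le> 3 * r"
    using edge_fin[OF f(1)] edge_fin[OF f(3)] card_Un_le[of f f'] by auto
  have abne: "a \<noteq> b" using ab by auto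
  obtain w where w: "\<And>i. i \<le> l \<Longrightarrow> w i \<in> Gd" "w l = b" "w 0 = a" "\<And>i. i < l \<Longrightarrow> i \<noteq> 0 \<Longrightarrow> w i \<notin> f \<union> f'" "inj_on w {..l}"
    using links_between[OF U ab(3,4) _ _ abne, of 0] ab l1 by auto
  have wx: "w i \<noteq> x j" if "i \<le> l" "j < l" for i j using w(1)[OF that(1)] x(2)[OF that(2)] GL by auto
  have xf: "x j \<notin> f" "x j \<notin> f'" if "j < l" for j using x(2)[OF that] f(2,4) by auto
  have wf: "w i \<notin> f" if "0 < i" "i \<le> l" for i using w(4)[of i] w(2) ab that by (cases "i = l") auto
  have wf': "w i \<notin> f'" if "i < l" for i using w(4)[of i] w(3) ab that by (cases "i = 0") auto
  have ij: "i div 2 \<le> l" "(i - 1) div 2 < l" if "1 \<le> i" "i \<le> 2 * l" for i using that by linarith+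
  define c where "c i = (if i = 0 then f else if i = 2 * l + 1 then f' else arc w x i)" for i
  have c: "c 0 = f" "c (2 * l + 1) = f'" "\<And>i. 1 \<le> i \<Longrightarrow> i \<le> 2 * l \<Longrightarrow> c i = arc w x i" unfolding c_def by auto
  have "cyclic_pattern k c"
  proof (rule cyclic_patternI)
    fix i assume i: "Suc i < k"
    consider "i = 0" | "i = 2 * l" "i \<noteq> 0" | "1 \<le> i" "Suc i \<le> 2 * l" using i unfolding kk by linarith
    then show "c i \<inter> c (Suc i) \<noteq> {}"
    proof cases
      case 1
      then show ?thesis using c(1) c(3)[of 1] w(3) ab l1 unfolding arc_def by auto
    next
      case 2
      have "w l \<in> arc w x (2 * l)" unfolding arc_def by simp
      then show ?thesis using 2 c(2) c(3)[of "2 * l"] w(2) ab l1 by auto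
    next
      case 3
      then show ?thesis using arc_consecutive[of i w x] c(3)[of i] c(3)[of "Suc i"] by simp
    qed
  next
    show "c 0 \<inter> c (k - 1) \<noteq> {}" using f(5) c unfolding kk by simp
  next
    fix i j assume a: "Suc i < j" "j < k" "\<not> (i = 0 \<and> Suc j = k)"
    consider "i = 0" "1 < j" "j \<le> 2 * l" | "j = 2 * l + 1" "1 \<le> i" "i < 2 * l" | "1 \<le> i" "i \<le> 2 * l" "1 \<le> j" "j \<le> 2 * l"
      using a unfolding kk by linarith
    then show "c i \<inter> c j = {}"
    proof cases
      case 1
      have "w (j div 2) \<notin> f" "x ((j - 1) div 2) \<notin> f" using 1 by (intro wf xf; linarith)+
      then show ?thesis using 1 c(1) c(3)[of j] unfolding arc_def by auto
    next
      case 2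
      have "w (i div 2) \<notin> f'" "x ((i - 1) div 2) \<notin> f'" using 2 by (intro wf' xf; linarith)+
      then show ?thesis using 2 c(2) c(3)[of i] unfolding arc_def by auto
    next
      case 3
      then show ?thesis using arc_disjoint[OF w(5) x(1) wx, of i j] a c(3) by auto
    qed
  qed
  then show False
  proof (rule core_cycle)
    fix i assume i: "i < k"
    consider "i = 0" | "i = 2 * l + 1" | "1 \<le> i" "i \<le> 2 * l" using i unfolding kk by linarith
    then show "c i \<in> H \<or> (\<exists>v\<in>Gd. \<exists>x\<in>L. c i = {v, x})"
    proof cases
      case 3
      then show ?thesis using c(3)[OF 3] w(1)[OF ij(1)[OF 3]] x(2)[OF ij(2)[OF 3]] unfolding arc_def by auto
    qed (use f c in auto)
  qed
qed

text \<open>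
For odd \<open>k\<close> the arc has to have \<open>k - 2 = 2 l - 1\<close> edges. Its first centre \<open>x 0\<close> is therefore used in one edge \<open>e\<close>
only, which contains \<open>a\<close> and another good vertex \<open>p\<close>, from where an arc through the remaining centres starts.
\<close>

lemma odd_private_good:
  assumes odd: "odd k" and f: "f \<in> H" "f \<inter> L = {}" "f' \<in> H" "f' \<inter> L = {}" "f \<inter> f' \<noteq> {}"
    and ab: "a \<in> f - f'" "b \<in> f' - f" "a \<in> Gd" "b \<in> Gd"
  shows False
proof -
  have kk: "k = 2 * l + 1" and l2: "2 \<le> l" using kl odd k by auto
  obtain x where x: "inj_on x {..<l}" "\<And>i. i < l \<Longrightarrow> x i \<in> L" using labels by blast
  have U: "finite (f \<union> f')" "card (f \<union> f') \<le> 2 * r"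
    using edge_fin[OF f(1)] edge_fin[OF f(3)] card_Un_le[of f f'] by auto
  have "2 * r * 1 \<le> 2 * r * k" using k by (intro mult_le_mono) auto
  then have "card (f \<union> f') \<le> 2 * r * k" using U(2) by linarith
  then obtain R where R: "R \<subseteq> Gd" "card R = r - 2" "R \<inter> (f \<union> f') = {}" "{a, x 0} \<union> R \<in> H"
    using pick[OF ab(3) x(2)[of 0] U(1)] l2 by auto
  have "R \<noteq> {}" using R(2) r by auto
  then obtain p where p: "p \<in> R" by blast
  define e where "e = {a, x 0} \<union> R"
  have e: "e \<in> H" "a \<in> e" "x 0 \<in> e" "p \<in> e" using R p unfolding e_def by auto
  have U1: "finite (f \<union> f' \<union> e)" "card (f \<union> f' \<union> e) \<le> 3 * r"
    using U edge_fin[OF e(1)] card_Un_le[of "f \<union> f'" e] by auto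
  have x0: "x 0 \<in> L" using x(2)[of 0] l2 by simp
  have pb: "p \<in> Gd" "p \<notin> f" "p \<notin> f'" "p \<noteq> b" using p R ab by auto
  obtain w where w: "\<And>i. i \<le> l \<Longrightarrow> w i \<in> Gd" "w l = b" "w 1 = p" "\<And>i. i < l \<Longrightarrow> i \<noteq> 1 \<Longrightarrow> w i \<notin> f \<union> f' \<union> e" "inj_on w {..l}"
    using links_between[OF U1 pb(1) ab(4) _ _ pb(4), of 1] e ab l2 by auto
  have wx: "w i \<noteq> x j" if "i \<le> l" "j < l" for i j using w(1)[OF that(1)] x(2)[OF that(2)] GL by auto
  have xf: "x j \<notin> f" "x j \<notin> f'" if "j < l" for j using x(2)[OF that] f(2,4) by auto
  have xe: "x j \<notin> e" if "0 < j" "j < l" for j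
  proof -
    have "x j \<noteq> x 0" using inj_on_eq_iff[OF x(1), of j 0] that by auto
    moreover have "x j \<notin> Gd" using x(2)[OF that(2)] GL by auto
    ultimately show ?thesis using R(1) ab(3) unfolding e_def by auto
  qed
  have be: "b \<notin> e" using ab R x0 GL unfolding e_def by auto
  have f'e: "f' \<inter> e = {}" using ab(1) R(3) f(4) x0 unfolding e_def by auto
  have wf: "w i \<notin> f" if "0 < i" "i \<le> l" for i
  proof -
    have "i = l \<or> i = 1 \<or> (i < l \<and> i \<noteq> 1)" using that by auto
    then consider "i = l" | "i = 1" | "i < l" "i \<noteq> 1" by blast
    then show ?thesis using w(2,3) w(4)[of i] pb ab by cases auto
  qed
  have wf': "w i \<notin> f'" if "0 < i" "i < l" for i using w(4)[of i] w(3) pb that by (cases "i = 1") auto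
  have we: "w i \<notin> e" if "1 < i" "i \<le> l" for i using w(4)[of i] w(2) be that by (cases "i = l") auto
  have ij: "i div 2 \<le> l" "(i - 1) div 2 < l" if "1 \<le> i" "i \<le> 2 * l" for i using that by linarith+
  define c where "c i = (if i = 0 then f' else if i = 1 then f else if i = 2 then e else arc w x i)" for i :: nat
  have c: "c 0 = f'" "c 1 = f" "c 2 = e" "\<And>i. 3 \<le> i \<Longrightarrow> c i = arc w x i" unfolding c_def by auto
  have "cyclic_pattern k c"
  proof (rule cyclic_patternI)
    fix i assume i: "Suc i < k"
    consider "i = 0" | "i = 1" | "i = 2" | "3 \<le> i" by linarith
    then show "c i \<inter> c (Suc i) \<noteq> {}"
    proof cases
      case 1
      then show ?thesis using c(1,2) f(5) by auto
    next
      case 2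
      then have "c (Suc i) = e" using c(3) by (simp add: numeral_2_eq_2)
      then show ?thesis using 2 c(2) e ab by auto
    next
      case 3
      then have "c (Suc i) = arc w x 3" using c(4)[of 3] by (simp add: numeral_3_eq_3)
      then show ?thesis using 3 c(3) w(3) e unfolding arc_def by auto
    next
      case 4
      then show ?thesis using arc_consecutive[of i w x] c(4)[of i] c(4)[of "Suc i"] by simp
    qed
  next
    have "w l \<in> arc w x (2 * l)" unfolding arc_def by simp
    then show "c 0 \<inter> c (k - 1) \<noteq> {}" using c(1) c(4)[of "2 * l"] w(2) ab l2 unfolding kk by auto
  next
    fix i j assume a: "Suc i < j" "j < k" "\<not> (i = 0 \<and> Suc j = k)"
    have j: "j \<le> 2 * l" "2 \<le> j" using a unfolding kk by linarith+
    consider "i = 0" "j = 2" | "i = 0" "3 \<le> j" "j < 2 * l" | "i = 1" "3 \<le> j" | "i = 2" "4 \<le> j" | "3 \<le> i"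
      using a unfolding kk by linarith
    then show "c i \<inter> c j = {}"
    proof cases
      case 1
      then show ?thesis using c(1,3) f'e by simp
    next
      case 2
      have "w (j div 2) \<notin> f'" "x ((j - 1) div 2) \<notin> f'" using 2 by (intro wf' xf; linarith)+
      then show ?thesis using 2 c(1) c(4)[of j] unfolding arc_def by auto
    next
      case 3
      have "w (j div 2) \<notin> f" "x ((j - 1) div 2) \<notin> f" using 3 j by (intro wf xf; linarith)+
      then show ?thesis using 3 c(2) c(4)[of j] unfolding arc_def by auto
    next
      case 4
      have "w (j div 2) \<notin> e" "x ((j - 1) div 2) \<notin> e" using 4 j by (intro we xe; linarith)+
      then show ?thesis using 4 c(3) c(4)[of j] unfolding arc_def by auto
    next
      case 5
      then show ?thesis using arc_disjoint[OF w(5) x(1) wx, of i j] a j c(4)[of i] c(4)[of j] by auto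
    qed
  qed
  then show False
  proof (rule core_cycle)
    fix i assume i: "i < k"
    consider "i = 0" | "i = 1" | "i = 2" | "3 \<le> i" "1 \<le> i" "i \<le> 2 * l" using i unfolding kk by linarith
    then show "c i \<in> H \<or> (\<exists>v\<in>Gd. \<exists>x\<in>L. c i = {v, x})"
    proof cases
      case 4
      then show ?thesis using c(4)[OF 4(1)] w(1)[OF ij(1)[OF 4(2,3)]] x(2)[OF ij(2)[OF 4(2,3)]] unfolding arc_def by auto
    qed (use f e c in auto)
  qed
qed

text \<open>
Two arcs connect \<open>f\<close> with \<open>f'\<close>: one through the first centre, the other through the remaining \<open>l - 1 \<ge> 1\<close>
centres.
\<close>

lemma even_disjoint_good:
  assumes even: "even k" "6 \<le> k" and f: "f \<in> H" "f \<inter> L = {}" "f' \<in> H" "f' \<inter> L = {}" "f \<inter> f' = {}"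
    and ab: "a \<in> f" "b \<in> f" "a \<in> Gd" "b \<in> Gd" "a \<noteq> b"
    and ab': "a' \<in> f'" "b' \<in> f'" "a' \<in> Gd" "b' \<in> Gd" "a' \<noteq> b'"
  shows False
proof -
  have kk: "k = 2 * l + 2" and l2: "2 \<le> l" using kl even by auto
  obtain x where x: "inj_on x {..<l}" "\<And>i. i < l \<Longrightarrow> x i \<in> L" using labels by blast
  have U: "finite (f \<union> f')" "card (f \<union> f') \<le> 3 * r"
    using edge_fin[OF f(1)] edge_fin[OF f(3)] card_Un_le[of f f'] by auto
  have x0: "x 0 \<in> L" using x(2)[of 0] l2 by simp
  have bne: "b' \<noteq> b" using ab ab' f by auto
  obtain w where w: "\<And>i. i \<le> l \<Longrightarrow> w i \<in> Gd" "w l = b" "w 1 = b'" "\<And>i. i < l \<Longrightarrow> i \<noteq> 1 \<Longrightarrow> w i \<notin> f \<union> f'" "inj_on w {..l}"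
    using links_between[OF U ab'(4) ab(4) _ _ bne, of 1] ab ab' l2 by auto
  have wx: "w i \<noteq> x j" if "i \<le> l" "j < l" for i j using w(1)[OF that(1)] x(2)[OF that(2)] GL by auto
  have xf: "x j \<notin> f" "x j \<notin> f'" if "j < l" for j using x(2)[OF that] f(2,4) by auto
  have x00: "x j \<noteq> x 0" if "0 < j" "j < l" for j using inj_on_eq_iff[OF x(1), of j 0] that by auto
  have xG: "x j \<notin> Gd" if "j < l" for j using x(2)[OF that] GL by auto
  have wf: "w i \<notin> f" if "0 < i" "i < l" for i using w(4)[of i] w(3) ab' f(5) that by (cases "i = 1") auto
  have wf': "w i \<notin> f'" if "1 < i" "i \<le> l" for i using w(4)[of i] w(2) ab f(5) that by (cases "i = l") auto
  have wa: "w i \<noteq> a \<and> w i \<noteq> a'" if "0 < i" "i \<le> l" for i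
  proof -
    have "i = l \<or> i = 1 \<or> (i < l \<and> i \<noteq> 1)" using that by auto
    then consider "i = l" | "i = 1" | "i < l" "i \<noteq> 1" by blast
    then show ?thesis using w(2,3) w(4)[of i] ab ab' f(5) by cases auto
  qed
  have aL: "a \<notin> L" "a' \<notin> L" using ab ab' f by auto
  have ij: "i div 2 \<le> l" "(i - 1) div 2 < l" if "1 \<le> i" "i \<le> 2 * l" for i using that by linarith+
  define c where "c i = (if i = 0 then f else if i = 1 then {a, x 0} else if i = 2 then {a', x 0} else if i = 3 then f' else arc w x (i - 1))" for i :: nat
  have c: "c 0 = f" "c 1 = {a, x 0}" "c 2 = {a', x 0}" "c 3 = f'" "\<And>i. 4 \<le> i \<Longrightarrow> c i = arc w x (i - 1)" unfolding c_def by auto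
  have "cyclic_pattern k c"
  proof (rule cyclic_patternI)
    fix i assume i: "Suc i < k"
    consider "i = 0" | "i = 1" | "i = 2" | "i = 3" | "4 \<le> i" by linarith
    then show "c i \<inter> c (Suc i) \<noteq> {}"
    proof cases
      case 1
      then show ?thesis using c(1,2) ab by auto
    next
      case 2
      then have "c (Suc i) = {a', x 0}" using c(3) by (simp add: numeral_2_eq_2)
      then show ?thesis using 2 c(2) by auto
    next
      case 3
      then have "c (Suc i) = f'" using c(4) by (simp add: numeral_3_eq_3)
      then show ?thesis using 3 c(3) ab' by auto
    next
      case 4
      then have "c (Suc i) = arc w x 3" using c(5)[of 4] by simp
      then show ?thesis using 4 c(4) w(3) ab' unfolding arc_def by auto
    next
      case 5
      then have "arc w x (i - 1) \<inter> arc w x (Suc (i - 1)) \<noteq> {}" by (intro arc_consecutive) simp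
      then show ?thesis using c(5)[of i] c(5)[of "Suc i"] 5 by simp
    qed
  next
    have "w l \<in> arc w x (2 * l)" unfolding arc_def by simp
    then show "c 0 \<inter> c (k - 1) \<noteq> {}" using c(1) c(5)[of "2 * l + 1"] w(2) ab l2 unfolding kk by auto
  next
    fix i j assume a: "Suc i < j" "j < k" "\<not> (i = 0 \<and> Suc j = k)"
    have j: "j - 1 \<le> 2 * l" "2 \<le> j" using a unfolding kk by linarith+
    have "i = 0 \<or> i = 1 \<or> i = 2 \<or> i = 3 \<or> 4 \<le> i" "j = 2 \<or> j = 3 \<or> 4 \<le> j" using j(2) by linarith+
    moreover have "i = 0 \<Longrightarrow> j \<le> 2 * l" "i = 1 \<Longrightarrow> j \<noteq> 2" "2 \<le> i \<Longrightarrow> 4 \<le> j" "i = 3 \<Longrightarrow> 5 \<le> j" using a unfolding kk by linarith+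
    ultimately consider "i = 0" "j = 2" | "i = 0" "j = 3" | "i = 0" "4 \<le> j" "j \<le> 2 * l" | "i = 1" "j = 3" | "i = 1" "4 \<le> j" | "i = 2" "4 \<le> j"
      | "i = 3" "5 \<le> j" | "4 \<le> i"
      by fastforce
    then show "c i \<inter> c j = {}"
    proof cases
      case 1
      then show ?thesis using c(1,3) ab' f x0 by auto
    next
      case 2
      then show ?thesis using c(1,4) f by simp
    next
      case 3
      have "w ((j - 1) div 2) \<notin> f" "x ((j - 1 - 1) div 2) \<notin> f" using 3 by (intro wf xf; linarith)+
      then show ?thesis using 3 c(1) c(5)[of j] unfolding arc_def by auto
    next
      case 4
      then show ?thesis using c(2,4) ab f x0 by auto
    next
      case 5
      have "w ((j - 1) div 2) \<noteq> a \<and> w ((j - 1) div 2) \<noteq> a'" "x ((j - 1 - 1) div 2) \<noteq> x 0" "w ((j - 1) div 2) \<noteq> x 0" "x ((j - 1 - 1) div 2) \<in> L"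
        using 5 j l2 by (intro wa x00 wx x(2); linarith)+
      then show ?thesis using 5 c(2) c(5)[of j] aL unfolding arc_def by auto
    next
      case 6
      have "w ((j - 1) div 2) \<noteq> a \<and> w ((j - 1) div 2) \<noteq> a'" "x ((j - 1 - 1) div 2) \<noteq> x 0" "w ((j - 1) div 2) \<noteq> x 0" "x ((j - 1 - 1) div 2) \<in> L"
        using 6 j l2 by (intro wa x00 wx x(2); linarith)+
      then show ?thesis using 6 c(3) c(5)[of j] aL unfolding arc_def by auto
    next
      case 7
      have "w ((j - 1) div 2) \<notin> f'" "x ((j - 1 - 1) div 2) \<notin> f'" using 7 j by (intro wf' xf; linarith)+
      then show ?thesis using 7 c(4) c(5)[of j] unfolding arc_def by auto
    next
      case 8
      have "arc w x (i - 1) \<inter> arc w x (j - 1) = {}" using 8 a j by (intro arc_disjoint[OF w(5) x(1) wx]) auto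
      then show ?thesis using 8 a c(5)[of i] c(5)[of j] by auto
    qed
  qed
  then show False
  proof (rule core_cycle)
    fix i assume i: "i < k"
    consider "i = 0" | "i = 1" | "i = 2" | "i = 3" | "4 \<le> i" "1 \<le> i - 1" "i - 1 \<le> 2 * l" using i unfolding kk by linarith
    then show "c i \<in> H \<or> (\<exists>v\<in>Gd. \<exists>x\<in>L. c i = {v, x})"
    proof cases
      case 5
      then show ?thesis using c(5)[OF 5(1)] w(1)[OF ij(1)[OF 5(2,3)]] x(2)[OF ij(2)[OF 5(2,3)]] unfolding arc_def by auto
    qed (use f c ab ab' x0 in auto)
  qed
qed

lemma private_good:
  assumes "f \<in> H" "f \<inter> L = {}" "f' \<in> H" "f' \<inter> L = {}" "f \<inter> f' \<noteq> {}"
    and "a \<in> f - f'" "b \<in> f' - f" "a \<in> Gd" "b \<in> Gd"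
  shows False
  using even_private_good[OF _ assms] odd_private_good[OF _ assms] by blast

definition bad_vertices where "bad_vertices = V - L - Gd"
definition outer where "outer = {f \<in> H. f \<inter> L = {}}"

lemma outer_sub: "f \<in> outer \<Longrightarrow> f \<in> H \<and> f \<inter> L = {} \<and> f \<subseteq> Gd \<union> bad_vertices \<and> finite f \<and> card f = r"
  using H unfolding outer_def bad_vertices_def nsets_def by auto

text \<open>
Two different edges have private vertices on both sides; these are good if the bad parts agree, and then
there is a cycle.
\<close>

lemma outer_determined_by_bad_part:
  assumes f: "f \<in> outer" "f' \<in> outer" and eq: "f \<inter> bad_vertices = f' \<inter> bad_vertices" "f \<inter> bad_vertices \<noteq> {}"
  shows "f = f'"
proof (rule ccontr)
  assume ne: "f \<noteq> f'"
  have "\<not> f \<subseteq> f'" "\<not> f' \<subseteq> f"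
    using card_subset_eq[of f' f] card_subset_eq[of f f'] outer_sub[OF f(1)] outer_sub[OF f(2)] ne by auto
  then obtain a b where ab: "a \<in> f - f'" "b \<in> f' - f" by blast
  have "a \<notin> bad_vertices" "b \<notin> bad_vertices" using ab eq by auto
  then have "a \<in> Gd" "b \<in> Gd" using ab outer_sub[OF f(1)] outer_sub[OF f(2)] by auto
  moreover have "f \<inter> f' \<noteq> {}" using eq by auto
  ultimately show False using private_good[of f f' a b] outer_sub[OF f(1)] outer_sub[OF f(2)] ab by blast
qed

text \<open>
Edges that consist of bad vertices form a cycle-free hypergraph on \<open>bad_vertices\<close>. The others are determined by their
bad parts, which have at most \<open>r - 1\<close> elements.
\<close>

lemma card_outer_bad_le: "card {f \<in> outer. f \<inter> bad_vertices \<noteq> {}} \<le> (2 * r * k + r) * card bad_vertices ^ (r - 1)"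
proof -
  let ?z = "card bad_vertices"
  have finZ: "finite bad_vertices" using V unfolding bad_vertices_def by simp
  have finH: "finite H" using H finite_imp_finite_nsets[OF V] finite_subset by metis
  have finE: "finite outer" unfolding outer_def using finH by simp
  let ?A = "outer \<inter> nsets bad_vertices r" and ?B = "{f \<in> outer. f \<inter> bad_vertices \<noteq> {} \<and> \<not> f \<subseteq> bad_vertices}"
  have "?A \<subseteq> H" unfolding outer_def by auto
  then have "\<not> has_cycle k ?A" using free has_cycle_mono by blast
  then have "card ?A \<le> (2 * r * k) * card {S \<in> nsets bad_vertices (r - 1). nbr ?A S \<noteq> {}}"
    using finZ r k by (intro cycle_free_card_le_shadow) auto
  also have "card {S \<in> nsets bad_vertices (r - 1). nbr ?A S \<noteq> {}} \<le> card (nsets bad_vertices (r - 1))"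
    using finite_imp_finite_nsets[OF finZ] by (intro card_mono) auto
  also have "card (nsets bad_vertices (r - 1)) \<le> ?z ^ (r - 1)"
    unfolding card_nsets[OF finZ] by (cases "r - 1 \<le> ?z") (auto intro: binomial_le_pow simp: not_le binomial_eq_0)
  finally have cA: "card ?A \<le> (2 * r * k) * ?z ^ (r - 1)" by simp
  have "inj_on (\<lambda>f. f \<inter> bad_vertices) ?B" by (rule inj_onI) (use outer_determined_by_bad_part in blast)
  moreover have "(\<lambda>f. f \<inter> bad_vertices) ` ?B \<subseteq> (\<Union>j\<in>{1..r-1}. nsets bad_vertices j)"
  proof (rule image_subsetI)
    fix f assume f: "f \<in> ?B"
    have ff: "finite f" "card f = r" using outer_sub[of f] f by auto
    have "f \<inter> bad_vertices \<subset> f" using f by auto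
    then have "card (f \<inter> bad_vertices) < r" using psubset_card_mono[OF ff(1)] ff(2) by simp
    moreover have "0 < card (f \<inter> bad_vertices)" using f ff(1) by (simp add: card_gt_0_iff)
    ultimately have "card (f \<inter> bad_vertices) \<in> {1..r-1}" by auto
    moreover have "f \<inter> bad_vertices \<in> nsets bad_vertices (card (f \<inter> bad_vertices))" using ff unfolding nsets_def by auto
    ultimately show "f \<inter> bad_vertices \<in> (\<Union>j\<in>{1..r-1}. nsets bad_vertices j)" by blast
  qed
  moreover have "finite (\<Union>j\<in>{1..r-1}. nsets bad_vertices j)" using finite_imp_finite_nsets[OF finZ] by simp
  ultimately have "card ?B \<le> card (\<Union>j\<in>{1..r-1}. nsets bad_vertices j)" by (rule card_inj_on_le)
  also have "\<dots> \<le> (\<Sum>j\<in>{1..r-1}. card (nsets bad_vertices j))" by (rule card_UN_le) simp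
  also have "\<dots> \<le> (\<Sum>j\<in>{1..r-1}. ?z ^ (r - 1))"
  proof (rule sum_mono)
    fix j assume j: "j \<in> {1..r-1}"
    show "card (nsets bad_vertices j) \<le> ?z ^ (r - 1)"
    proof (cases "j \<le> ?z")
      case True
      then have "?z choose j \<le> ?z ^ j" by (rule binomial_le_pow)
      also have "\<dots> \<le> ?z ^ (r - 1)" using True j by (intro power_increasing) auto
      finally show ?thesis unfolding card_nsets[OF finZ] .
    next
      case False
      then show ?thesis unfolding card_nsets[OF finZ] by (simp add: binomial_eq_0)
    qed
  qed
  also have "\<dots> \<le> r * ?z ^ (r - 1)" by simp
  finally have cB: "card ?B \<le> r * ?z ^ (r - 1)" .
  have "{f \<in> outer. f \<inter> bad_vertices \<noteq> {}} \<subseteq> ?A \<union> ?B" using outer_sub unfolding nsets_def by auto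
  then have "card {f \<in> outer. f \<inter> bad_vertices \<noteq> {}} \<le> card (?A \<union> ?B)" using finE by (intro card_mono) auto
  also have "\<dots> \<le> card ?A + card ?B" by (rule card_Un_le)
  also have "\<dots> \<le> (2 * r * k + r) * ?z ^ (r - 1)" using cA cB by (simp add: add_mult_distrib)
  finally show ?thesis .
qed

lemma good_edge:
  assumes "f \<in> outer" "f \<inter> bad_vertices = {}"
  obtains a b where "a \<in> f" "b \<in> f" "a \<noteq> b" "f \<subseteq> Gd"
proof -
  have "finite f" "card f = r" "f \<subseteq> Gd" using outer_sub[OF assms(1)] assms(2) by auto
  moreover from this have "\<not> card f \<le> Suc 0" using r by simp
  ultimately show thesis using card_le_Suc0_iff_eq[of f] that by blast
qed

lemma good_edges_disjoint: "even k \<Longrightarrow> pairwise disjnt {f \<in> outer. f \<inter> bad_vertices = {}}"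
proof (rule pairwiseI)
  fix f f' assume f: "f \<in> {f \<in> outer. f \<inter> bad_vertices = {}}" "f' \<in> {f \<in> outer. f \<inter> bad_vertices = {}}" "f \<noteq> f'"
  have "\<not> f \<subseteq> f'" "\<not> f' \<subseteq> f"
    using card_subset_eq[of f' f] card_subset_eq[of f f'] outer_sub[of f] outer_sub[of f'] f by auto
  then obtain a b where ab: "a \<in> f - f'" "b \<in> f' - f" by blast
  have G: "a \<in> Gd" "b \<in> Gd" using ab outer_sub[of f] outer_sub[of f'] f by auto
  have fH: "f \<in> H" "f \<inter> L = {}" "f' \<in> H" "f' \<inter> L = {}" using f unfolding outer_def by simp_all
  show "disjnt f f'" unfolding disjnt_def using private_good[OF fH _ ab G] by (rule ccontr)
qed

lemma no_good_edge_odd: "odd k \<Longrightarrow> {f \<in> outer. f \<inter> bad_vertices = {}} = {}"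
proof (rule ccontr)
  assume odd: "odd k" and "{f \<in> outer. f \<inter> bad_vertices = {}} \<noteq> {}"
  then obtain f where f: "f \<in> outer" "f \<inter> bad_vertices = {}" by blast
  obtain a b where "a \<in> f" "b \<in> f" "a \<noteq> b" "f \<subseteq> Gd" using good_edge[OF f] by blast
  then show False using odd_two_good[OF odd, of f a b] outer_sub[OF f(1)] by blast
qed

lemma one_good_edge_even:
  assumes "even k" "6 \<le> k"
  shows "card {f \<in> outer. f \<inter> bad_vertices = {}} \<le> 1"
proof -
  have "f = f'" if f: "f \<in> {f \<in> outer. f \<inter> bad_vertices = {}}" "f' \<in> {f \<in> outer. f \<inter> bad_vertices = {}}" for f f'
  proof (rule ccontr)
    assume "f \<noteq> f'"
    then have dis: "f \<inter> f' = {}" using good_edges_disjoint[OF assms(1)] f unfolding pairwise_def disjnt_def by blast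
    obtain a b where ab: "a \<in> f" "b \<in> f" "a \<noteq> b" "f \<subseteq> Gd" using good_edge[of f] f by blast
    obtain a' b' where ab': "a' \<in> f'" "b' \<in> f'" "a' \<noteq> b'" "f' \<subseteq> Gd" using good_edge[of f'] f by blast
    have fH: "f \<in> H" "f \<inter> L = {}" "f' \<in> H" "f' \<inter> L = {}" using f unfolding outer_def by simp_all
    have G: "a \<in> Gd" "b \<in> Gd" "a' \<in> Gd" "b' \<in> Gd" using ab ab' by auto
    show False
      by (rule even_disjoint_good[OF assms fH dis ab(1,2) G(1,2) ab(3) ab'(1,2) G(3,4) ab'(3)])
  qed
  note eq = this
  have fin: "finite {f \<in> outer. f \<inter> bad_vertices = {}}"
  proof -
    have "finite H" using H finite_imp_finite_nsets[OF V] finite_subset by metis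
    then show ?thesis unfolding outer_def by simp
  qed
  have "card {f \<in> outer. f \<inter> bad_vertices = {}} \<le> Suc 0"
    unfolding card_le_Suc0_iff_eq[OF fin] by (intro ballI) (rule eq)
  then show ?thesis by simp
qed

end

section \<open>From stability to the exact structure\<close>

lemma sum_degrees_le:
  assumes "finite M" "\<And>e. e \<in> M \<Longrightarrow> finite e \<and> card e = r" "finite Z"
  shows "(\<Sum>v\<in>Z. card {e \<in> M. v \<in> e}) \<le> r * card M"
proof -
  have "(\<Sum>v\<in>Z. card {e \<in> M. v \<in> e}) = (\<Sum>e\<in>M. card {v \<in> Z. v \<in> e})"
    using sum_card_swap[OF assms(3,1), of "\<lambda>e v. v \<in> e"] .
  also have "\<dots> \<le> (\<Sum>e\<in>M. r)"
  proof (rule sum_mono)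
    fix e assume "e \<in> M"
    then have "finite e" "card e = r" using assms(2) by auto
    then show "card {v \<in> Z. v \<in> e} \<le> r" using card_mono[of e "{v \<in> Z. v \<in> e}"] by auto
  qed
  finally show ?thesis by (simp add: mult.commute)
qed

text \<open>
A missing edge is \<open>insert x S\<close> for a centre \<open>x\<close> and a set \<open>S\<close> that lacks the colour \<open>x\<close>.
\<close>

lemma missing_edges_le:
  assumes V: "finite V" and L: "finite L" and r: "1 \<le> r"
  shows "card {e \<in> nsets V r. e \<inter> L \<noteq> {} \<and> e \<notin> H} \<le> card {S \<in> nsets V (r - 1). \<not> L \<subseteq> nbr H S} * card L"
proof -
  let ?B = "{S \<in> nsets V (r - 1). \<not> L \<subseteq> nbr H S}"
  have finB: "finite ?B" using finite_imp_finite_nsets[OF V] by simp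
  have "{e \<in> nsets V r. e \<inter> L \<noteq> {} \<and> e \<notin> H} \<subseteq> (\<lambda>(S, x). insert x S) ` (?B \<times> L)"
  proof
    fix e assume e: "e \<in> {e \<in> nsets V r. e \<inter> L \<noteq> {} \<and> e \<notin> H}"
    then obtain x where x: "x \<in> e" "x \<in> L" by blast
    have "e - {x} \<in> nsets V (r - 1)" using e x unfolding nsets_def by auto
    moreover have "x \<notin> nbr H (e - {x})" using e x unfolding nbr_def by (auto simp: insert_absorb)
    ultimately have "(e - {x}, x) \<in> ?B \<times> L" using x by auto
    moreover have "e = (\<lambda>(S, x). insert x S) (e - {x}, x)" using x by auto
    ultimately show "e \<in> (\<lambda>(S, x). insert x S) ` (?B \<times> L)" by (rule rev_image_eqI)
  qed
  then have "card {e \<in> nsets V r. e \<inter> L \<noteq> {} \<and> e \<notin> H} \<le> card (?B \<times> L)"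
    using finB L by (intro surj_card_le) simp_all
  then show ?thesis by (simp add: card_cartesian_product)
qed

lemma card_star:
  assumes V: "finite V" and L: "L \<subseteq> V"
  shows "card {e \<in> nsets V r. e \<inter> L \<noteq> {}} + ((card V - card L) choose r) = card V choose r"
proof -
  have "finite L" using assms finite_subset by blast
  have fin: "finite (nsets V r)" using finite_imp_finite_nsets[OF V] .
  have "nsets V r = {e \<in> nsets V r. e \<inter> L \<noteq> {}} \<union> nsets (V - L) r" unfolding nsets_def by auto
  moreover have "{e \<in> nsets V r. e \<inter> L \<noteq> {}} \<inter> nsets (V - L) r = {}" unfolding nsets_def by auto
  ultimately have "card (nsets V r) = card {e \<in> nsets V r. e \<inter> L \<noteq> {}} + card (nsets (V - L) r)"
    using card_Un_disjoint[of "{e \<in> nsets V r. e \<inter> L \<noteq> {}}" "nsets (V - L) r"] fin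
      finite_imp_finite_nsets[of "V - L" r] V by simp
  moreover have "card (nsets (V - L) r) = (card V - card L) choose r"
    using card_nsets[of "V - L" r] V card_Diff_subset[OF \<open>finite L\<close> L] by simp
  ultimately show ?thesis using card_nsets[OF V, of r] by simp
qed

lemma card_disjoint_edges:
  assumes "finite X" "W \<subseteq> nsets X r" "pairwise disjnt W" "0 < r"
  shows "card W \<le> card X div r"
proof -
  have "r * card W = (\<Sum>f\<in>W. card f)" using assms(2) unfolding nsets_def by (subst sum.cong[of W W card "\<lambda>_. r"]) auto
  also have "\<dots> = card (\<Union>W)"
    using assms unfolding nsets_def by (intro card_Union_disjoint[symmetric]) auto
  also have "\<dots> \<le> card X" using assms unfolding nsets_def by (intro card_mono) auto
  finally show ?thesis using assms(4) by (simp add: less_eq_div_iff_mult_less_eq mult.commute)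
qed

text \<open>
The number of edges outside the star in an extremal hypergraph.
\<close>

definition extra_edges :: "nat \<Rightarrow> nat \<Rightarrow> nat \<Rightarrow> nat" where
  "extra_edges r k n = (if odd k then 0 else if k = 4 then (n - 1) div r else 1)"

lemma most_vertices_good:
  assumes "G + z + l = N" "4 * z \<le> N" "4 * (l + c + 1) \<le> (N :: nat)"
  shows "N \<le> 2 * (G - (c + 1)) \<and> c \<le> G"
proof -
  have "c + 1 \<le> G" using assms by (simp add: algebra_simps)
  then obtain d where "G = c + 1 + d" using le_Suc_ex by blast
  then show ?thesis using assms by simp
qed

text \<open>
The missing edges \<open>M\<close> and the edges outside the star are compared. With \<open>z\<close> bad vertices, \<open>M\<close> has at least
\<open>\<theta> z n^(r-2) / r\<close> elements, because each bad vertex lies on \<open>\<theta> n^(r-2)\<close> of them. At most \<open>\<kappa> z^(r-1)\<close> outer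
edges contain a bad vertex, which is less if \<open>0 < z \<le> \<rho> n\<close>. The outer edges that consist of good vertices number
at most \<open>extra_edges r k n\<close>. As \<open>H\<close> is at least as large as the extremal example, \<open>z = 0\<close> and \<open>M = {}\<close>.
\<close>

lemma exact_structure:
  assumes r: "3 \<le> r" and k: "4 \<le> k" and l: "l = (k - 1) div 2"
  shows "\<exists>n0. \<forall>(V :: 'a set) H. finite V \<longrightarrow> n0 \<le> card V \<longrightarrow> H \<subseteq> nsets V r \<longrightarrow> \<not> has_cycle k H \<longrightarrow>
     (card V choose r) - ((card V - l) choose r) + extra_edges r k (card V) \<le> card H \<longrightarrow>
     (\<exists>L\<subseteq>V. card L = l \<and> {e \<in> nsets V r. e \<inter> L \<noteq> {}} \<subseteq> H \<and> card {f \<in> H. f \<inter> L = {}} = extra_edges r k (card V) \<and>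
        (k = 4 \<longrightarrow> pairwise disjnt {f \<in> H. f \<inter> L = {}}))"
proof -
  have l1: "1 \<le> l" using k l by linarith
  define \<kappa> where "\<kappa> = real (2 * r * k + r)"
  \<comment> \<open>\<open>\<theta>\<close> is small enough for good vertices to have extensions, \<open>\<rho>\<close> makes \<open>\<kappa> z^(r-1)\<close> smaller than \<open>\<theta> z n^(r-2) / r\<close> for \<open>z \<le> \<rho> n\<close>, and \<open>\<eta>\<close> ensures \<open>z \<le> \<rho> n\<close>\<close>
  define \<theta> where "\<theta> = (1 / (4 * real r)) ^ (r - 2)"
  define \<rho> where "\<rho> = \<theta> / (2 * real r * \<kappa>)"
  define \<eta> where "\<eta> = \<rho> * \<theta> / (real r * real l)"
  have \<theta>: "0 < \<theta>" "\<theta> \<le> 1" using r unfolding \<theta>_def by (auto intro!: power_le_one)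
  have "1 \<le> 2 * r * k + r" using r by linarith
  then have \<kappa>: "1 \<le> \<kappa>" unfolding \<kappa>_def by (metis of_nat_1 of_nat_le_iff)
  have rk1: "4 \<le> 2 * real r * \<kappa>"
  proof -
    have "6 * 1 \<le> (2 * real r) * \<kappa>" using r \<kappa> by (intro mult_mono) auto
    then show ?thesis by simp
  qed
  have \<rho>: "0 < \<rho>" "\<rho> \<le> 1 / 4" "\<kappa> * \<rho> < \<theta> / real r"
  proof -
    show "0 < \<rho>" using \<theta> rk1 unfolding \<rho>_def by simp
    have "\<rho> \<le> 1 / (2 * real r * \<kappa>)" unfolding \<rho>_def using \<theta> rk1 by (intro divide_right_mono) auto
    also have "\<dots> \<le> 1 / 4" using rk1 by (intro divide_left_mono) auto
    finally show "\<rho> \<le> 1 / 4" .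
    have "\<kappa> * \<rho> = \<theta> / real r / 2" using \<kappa> r unfolding \<rho>_def by (simp add: field_simps)
    moreover have "0 < \<theta> / real r" using \<theta> r by simp
    moreover have "t / 2 < t" if "0 < t" for t :: real using that by simp
    ultimately show "\<kappa> * \<rho> < \<theta> / real r" by metis
  qed
  have \<eta>: "0 < \<eta>" using \<rho> \<theta> r l1 unfolding \<eta>_def by simp
  from stability[OF r k l \<eta>, where 'a = 'a]
  obtain n1 where stab: "\<forall>(V :: 'a set) H. finite V \<longrightarrow> n1 \<le> card V \<longrightarrow> H \<subseteq> nsets V r \<longrightarrow> \<not> has_cycle k H \<longrightarrow>
     (card V choose r) - ((card V - l) choose r) \<le> card H \<longrightarrow>
     (\<exists>L\<subseteq>V. card L = l \<and> real (card {S \<in> nsets V (r - 1). \<not> L \<subseteq> nbr H S}) \<le> \<eta> * real (card V) ^ (r - 1))"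
    by (elim exE) (rule that)
  show ?thesis
  proof (rule exI[of _ "max n1 (4 * (l + 2 * r * k + 1))"], intro allI impI)
    fix V :: "'a set" and H
    assume V: "finite V" "max n1 (4 * (l + 2 * r * k + 1)) \<le> card V" and H: "H \<subseteq> nsets V r" and free: "\<not> has_cycle k H"
      and big: "(card V choose r) - ((card V - l) choose r) + extra_edges r k (card V) \<le> card H"
    let ?n = "card V"
    have n: "n1 \<le> ?n" "4 * (l + 2 * r * k + 1) \<le> ?n" using V(2) by simp_all
    have npos: "0 < real ?n" using n by simp
    have "(?n choose r) - ((?n - l) choose r) \<le> card H" using big by linarith
    then obtain L where L: "L \<subseteq> V" "card L = l" "real (card {S \<in> nsets V (r - 1). \<not> L \<subseteq> nbr H S}) \<le> \<eta> * real ?n ^ (r - 1)"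
      using stab V(1) n(1) H free by blast
    have finL: "finite L" using L(1) V(1) finite_subset by blast
    have finH: "finite H" using H finite_imp_finite_nsets[OF V(1)] finite_subset by metis
    define M where "M = {e \<in> nsets V r. e \<inter> L \<noteq> {} \<and> e \<notin> H}"
    have finM: "finite M" unfolding M_def using finite_imp_finite_nsets[OF V(1)] by simp
    have cardM: "real (card M) \<le> \<eta> * real ?n ^ (r - 1) * real l"
    proof -
      have "real (card M) \<le> real (card {S \<in> nsets V (r - 1). \<not> L \<subseteq> nbr H S}) * real l"
      proof -
        have "1 \<le> r" using r by simp
        from missing_edges_le[OF V(1) finL this, of H, folded M_def, unfolded L(2)]
        show ?thesis by (simp only: of_nat_mult[symmetric] of_nat_le_iff)
      qed
      also have "\<dots> \<le> \<eta> * real ?n ^ (r - 1) * real l" using L(3) by (intro mult_right_mono) auto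
      finally show ?thesis .
    qed
    define Gd where "Gd = {v \<in> V - L. \<forall>x\<in>L. real (card {e \<in> M. v \<in> e \<and> x \<in> e}) \<le> \<theta> * real ?n ^ (r - 2)}"
    define Z where "Z = V - L - Gd"
    have finZ: "finite Z" unfolding Z_def using V(1) by simp
    let ?z = "real (card Z)"
    have bad: "\<theta> * real ?n ^ (r - 2) \<le> real (card {e \<in> M. v \<in> e})" if v: "v \<in> Z" for v
    proof -
      obtain x where "\<not> real (card {e \<in> M. v \<in> e \<and> x \<in> e}) \<le> \<theta> * real ?n ^ (r - 2)" using v unfolding Z_def Gd_def by blast
      moreover have "card {e \<in> M. v \<in> e \<and> x \<in> e} \<le> card {e \<in> M. v \<in> e}" using finM by (intro card_mono) auto
      ultimately show ?thesis by linarith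
    qed
    have Mz: "?z * (\<theta> * real ?n ^ (r - 2)) \<le> real r * real (card M)"
    proof -
      have "?z * (\<theta> * real ?n ^ (r - 2)) = (\<Sum>v\<in>Z. \<theta> * real ?n ^ (r - 2))" by simp
      also have "\<dots> \<le> (\<Sum>v\<in>Z. real (card {e \<in> M. v \<in> e}))" by (rule sum_mono[OF bad])
      also have "\<dots> = real (\<Sum>v\<in>Z. card {e \<in> M. v \<in> e})" by simp
      also have "\<dots> \<le> real (r * card M)"
        unfolding of_nat_le_iff by (rule sum_degrees_le[OF finM _ finZ]) (auto simp: M_def nsets_def)
      finally show ?thesis by simp
    qed
    have zr: "?z \<le> \<rho> * real ?n"
    proof -
      have e: "r - 1 = Suc (r - 2)" using r by simp
      have "?z * (\<theta> * real ?n ^ (r - 2)) \<le> real r * (\<eta> * real ?n ^ (r - 1) * real l)"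
        using Mz cardM r by (meson mult_left_mono of_nat_0_le_iff order_trans)
      also have "\<dots> = (\<rho> * real ?n) * (\<theta> * real ?n ^ (r - 2))"
        using r l1 unfolding \<eta>_def e by (simp add: field_simps)
      finally show ?thesis using \<theta> npos by (simp add: mult_le_cancel_right)
    qed
    have cardGd: "card Gd + card Z + l = ?n"
    proof -
      have "Gd \<union> Z = V - L" "Gd \<inter> Z = {}" unfolding Z_def Gd_def by auto
      moreover have "finite Gd" unfolding Gd_def using V(1) by simp
      ultimately have "card Gd + card Z = card (V - L)" using card_Un_disjoint[of Gd Z] finZ by simp
      then show ?thesis using card_Diff_subset[OF finL L(1)] card_mono[OF V(1) L(1)] L(2) by simp
    qed
    have "\<rho> * real ?n \<le> 1 / 4 * real ?n" using \<rho>(2) by (intro mult_right_mono) auto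
    then have "?z \<le> real ?n / 4" using zr by linarith
    then have z4: "4 * card Z \<le> ?n" by simp
    have manyG: "?n \<le> 2 * (card Gd - (2 * r * k + 1))" "2 * r * k \<le> card Gd"
      using most_vertices_good[OF cardGd z4 n(2)] by simp_all
    note LV = L(1)
    interpret near_star r k l V H L Gd
    proof
      fix v x and U :: "'a set" assume v: "v \<in> Gd" and x: "x \<in> L" and U: "finite U" "card U \<le> 2 * r * k"
      show "\<exists>R\<subseteq>Gd. card R = r - 2 \<and> R \<inter> U = {} \<and> v \<notin> R \<and> {v, x} \<union> R \<in> H"
      proof (rule ccontr)
        assume no: "\<not> ?thesis"
        let ?C = "Gd - insert v U"
        have vx: "v \<in> V" "x \<in> V" "v \<noteq> x" "v \<notin> L" using v x L(1) unfolding Gd_def by auto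
        have finG: "finite Gd" unfolding Gd_def using V(1) by simp
        then have finC: "finite ?C" by simp
        have "card Gd - card (insert v U) \<le> card ?C" using U(1) by (intro diff_card_le_card_Diff) simp
        moreover have "card (insert v U) \<le> 2 * r * k + 1" using U by (simp add: card_insert_if)
        ultimately have C: "?n \<le> 2 * card ?C" using manyG(1) by linarith
        let ?g = "\<lambda>R. {v, x} \<union> R"
        have "inj_on ?g (nsets ?C (r - 2))"
        proof (rule inj_onI)
          fix R R' assume R: "R \<in> nsets ?C (r - 2)" "R' \<in> nsets ?C (r - 2)" "?g R = ?g R'"
          have "x \<notin> Gd" using x unfolding Gd_def by auto
          then have "v \<notin> R" "x \<notin> R" "v \<notin> R'" "x \<notin> R'" using R(1,2) unfolding nsets_def by auto
          then show "R = R'" using R(3) by auto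
        qed
        moreover have "?g ` nsets ?C (r - 2) \<subseteq> {e \<in> M. v \<in> e \<and> x \<in> e}"
        proof (rule image_subsetI)
          fix R assume R: "R \<in> nsets ?C (r - 2)"
          then have RR: "R \<subseteq> Gd" "R \<inter> U = {}" "v \<notin> R" "card R = r - 2" "finite R" unfolding nsets_def by auto
          then have "{v, x} \<union> R \<notin> H" using no by blast
          moreover have "x \<notin> R" using RR(1) x unfolding Gd_def by auto
          then have "card ({v, x} \<union> R) = r" using RR vx r by (subst card_Un_disjoint) auto
          moreover have "{v, x} \<union> R \<subseteq> V" using RR(1) vx unfolding Gd_def by auto
          ultimately show "?g R \<in> {e \<in> M. v \<in> e \<and> x \<in> e}" using RR(5) x unfolding M_def nsets_def by auto
        qed
        ultimately have "card (nsets ?C (r - 2)) \<le> card {e \<in> M. v \<in> e \<and> x \<in> e}"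
          using finM by (intro card_inj_on_le) auto
        then have "real (card ?C choose (r - 2)) \<le> real (card {e \<in> M. v \<in> e \<and> x \<in> e})"
          unfolding card_nsets[OF finC] by simp
        also have "\<dots> \<le> \<theta> * real ?n ^ (r - 2)" using v x unfolding Gd_def by blast
        finally have up: "real (card ?C choose (r - 2)) \<le> \<theta> * real ?n ^ (r - 2)" .
        have "r * 1 \<le> r * k" using k by (intro mult_le_mono) auto
        then have "r - 2 \<le> r * k" by (metis diff_le_self mult.right_neutral order_trans)
        moreover have "8 * (r * k) \<le> ?n" using n(2) by (simp add: algebra_simps)
        moreover have "c \<le> d" if "8 * b \<le> a" "a \<le> 2 * d" "c \<le> b" for a b c d :: nat using that by simp
        ultimately have "r - 2 \<le> card ?C" using C by blast
        then have "(real (card ?C) / real (r - 2)) ^ (r - 2) \<le> real (card ?C choose (r - 2))"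
          using binomial_ge_n_over_k_pow_k[of "r - 2" "card ?C"] by simp
        moreover have "(real ?n / (4 * real r)) ^ (r - 2) < (real (card ?C) / real (r - 2)) ^ (r - 2)"
        proof (rule power_strict_mono)
          have "real ?n / (4 * real r) < real ?n / (2 * real r)" using npos r by (simp add: field_simps)
          also have "\<dots> \<le> real (card ?C) / real r" using C r by (simp add: field_simps)
          also have "\<dots> \<le> real (card ?C) / real (r - 2)" using r by (intro divide_left_mono) auto
          finally show "real ?n / (4 * real r) < real (card ?C) / real (r - 2)" .
        qed (use r in auto)
        moreover have "(real ?n / (4 * real r)) ^ (r - 2) = \<theta> * real ?n ^ (r - 2)"
          unfolding \<theta>_def by (simp add: power_divide)
        ultimately show False using up by linarith
      qed
    qed (use r k l V H free finL L manyG in \<open>auto simp: Gd_def\<close>)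
    have bad_vertices: "bad_vertices = Z" unfolding bad_vertices_def Z_def ..
    let ?W = "{f \<in> outer. f \<inter> Z = {}}" and ?B = "{f \<in> outer. f \<inter> Z \<noteq> {}}"
    have outer_eq: "outer = {f \<in> H. f \<inter> L = {}}" unfolding outer_def ..
    have finE: "finite outer" unfolding outer_eq using finH by simp
    have "?W \<union> ?B = outer" "?W \<inter> ?B = {}" by auto
    then have EWB: "card outer = card ?W + card ?B" using card_Un_disjoint[of ?W ?B] finE by simp
    have WV: "?W \<subseteq> nsets (V - L) r" using H unfolding outer_eq nsets_def by auto
    have W4: "pairwise disjnt ?W" if "even k" using good_edges_disjoint[OF that] unfolding bad_vertices .
    have W: "card ?W \<le> extra_edges r k ?n"
    proof -
      consider "odd k" | "k = 4" | "even k" "k \<noteq> 4" by blast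
      then show ?thesis
      proof cases
        case 1
        have "?W = {}" using no_good_edge_odd[OF 1] unfolding bad_vertices .
        then show ?thesis by (simp only: card.empty le0)
      next
        case 2
        have "card ?W \<le> card (V - L) div r" using V(1) WV W4 r 2 by (intro card_disjoint_edges) auto
        moreover have "card (V - L) = ?n - 1" using card_Diff_subset[OF finL LV] L(2) l 2 by simp
        ultimately show ?thesis using 2 unfolding extra_edges_def by simp
      next
        case 3
        then have "6 \<le> k" using k by presburger
        then have "card ?W \<le> 1" using one_good_edge_even 3 unfolding bad_vertices by blast
        then show ?thesis using 3 unfolding extra_edges_def by simp
      qed
    qed
    have sumH: "card H + card M = card {e \<in> nsets V r. e \<inter> L \<noteq> {}} + card outer"
    proof -
      have "{e \<in> nsets V r. e \<inter> L \<noteq> {}} = {e \<in> H. e \<inter> L \<noteq> {}} \<union> M" "{e \<in> H. e \<inter> L \<noteq> {}} \<inter> M = {}"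
        using H unfolding M_def by auto
      then have 1: "card {e \<in> nsets V r. e \<inter> L \<noteq> {}} = card {e \<in> H. e \<inter> L \<noteq> {}} + card M"
        using card_Un_disjoint[of "{e \<in> H. e \<inter> L \<noteq> {}}" M] finH finM by simp
      have "H = {e \<in> H. e \<inter> L \<noteq> {}} \<union> outer" "{e \<in> H. e \<inter> L \<noteq> {}} \<inter> outer = {}" unfolding outer_eq by auto
      then have "card H = card {e \<in> H. e \<inter> L \<noteq> {}} + card outer"
        using card_Un_disjoint[of "{e \<in> H. e \<inter> L \<noteq> {}}" outer] finH finE by simp
      then show ?thesis using 1 by simp
    qed
    have star: "card {e \<in> nsets V r. e \<inter> L \<noteq> {}} = (?n choose r) - ((?n - l) choose r)"
      using card_star[OF V(1) LV, of r] L(2) by simp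
    have cmp: "card M + extra_edges r k ?n \<le> card outer" using sumH big unfolding star by linarith
    have MB: "card M \<le> card ?B" using cmp EWB W by linarith
    have "Z = {}"
    proof (rule ccontr)
      assume "Z \<noteq> {}"
      then have z: "0 < ?z" using finZ by (simp add: card_gt_0_iff)
      have e: "r - 1 = Suc (r - 2)" "r - 2 = Suc (r - 3)" using r by linarith+
      have nn: "0 < real ?n ^ (r - 2)" using npos by simp
      have "real (card M) \<le> real (card ?B)" using MB by simp
      also have "\<dots> \<le> real ((2 * r * k + r) * card Z ^ (r - 1))"
        using card_outer_bad_le unfolding bad_vertices by (simp only: of_nat_le_iff)
      also have "\<dots> = \<kappa> * ?z ^ (r - 1)" unfolding \<kappa>_def by (simp only: of_nat_mult of_nat_power)
      also have "\<dots> = \<kappa> * ?z * ?z ^ (r - 2)" unfolding e(1) by simp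
      also have "\<dots> \<le> \<kappa> * ?z * (\<rho> * real ?n) ^ (r - 2)"
        using zr \<kappa> by (intro mult_left_mono power_mono) auto
      also have "\<dots> = \<kappa> * ?z * \<rho> ^ (r - 2) * real ?n ^ (r - 2)" by (simp add: power_mult_distrib)
      also have "\<dots> \<le> \<kappa> * ?z * \<rho> * real ?n ^ (r - 2)"
      proof -
        have "\<rho> ^ (r - 2) \<le> \<rho> ^ 1" using \<rho> e by (intro power_decreasing) auto
        then show ?thesis using \<kappa> nn by (intro mult_right_mono mult_left_mono) auto
      qed
      also have "\<dots> = (\<kappa> * \<rho>) * (?z * real ?n ^ (r - 2))" by simp
      also have "\<dots> < (\<theta> / real r) * (?z * real ?n ^ (r - 2))" using \<rho>(3) z nn by (intro mult_strict_right_mono) auto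
      finally have "real r * real (card M) < ?z * (\<theta> * real ?n ^ (r - 2))" using r by (simp add: field_simps)
      then show False using Mz by linarith
    qed
    then have B0: "?B = {}" and WE: "?W = outer" by auto
    have "card M = 0" using MB unfolding B0 by simp
    then have M0: "M = {}" using finM by simp
    have "card outer = extra_edges r k ?n" using cmp W unfolding WE by linarith
    then have "card {f \<in> H. f \<inter> L = {}} = extra_edges r k ?n" unfolding outer_eq .
    moreover have "k = 4 \<longrightarrow> pairwise disjnt {f \<in> H. f \<inter> L = {}}"
    proof
      assume "k = 4"
      then have "even k" by simp
      from W4[OF this] have "pairwise disjnt outer" unfolding WE .
      then show "pairwise disjnt {f \<in> H. f \<inter> L = {}}" unfolding outer_eq .
    qed
    moreover have "{e \<in> nsets V r. e \<inter> L \<noteq> {}} \<subseteq> H" using M0 unfolding M_def by blast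
    ultimately show "\<exists>L\<subseteq>V. card L = l \<and> {e \<in> nsets V r. e \<inter> L \<noteq> {}} \<subseteq> H \<and> card {f \<in> H. f \<inter> L = {}} = extra_edges r k ?n \<and>
        (k = 4 \<longrightarrow> pairwise disjnt {f \<in> H. f \<inter> L = {}})"
      using LV L(2) by blast
  qed
qed

section \<open>Extremal examples and the theorem\<close>

lemma card_pattern_meeting_le:
  assumes pat: "cyclic_pattern k e" and k: "4 \<le> k" and L: "finite L"
  shows "card {i. i < k \<and> e i \<inter> L \<noteq> {}} \<le> 2 * card L"
proof -
  have two: "card {i. i < k \<and> x \<in> e i} \<le> 2" for x
  proof (rule ccontr)
    assume "\<not> ?thesis"
    then have "3 \<le> card {i. i < k \<and> x \<in> e i}" by simp
    then obtain T where T: "T \<subseteq> {i. i < k \<and> x \<in> e i}" "card T = 3" using obtain_subset_with_card_n by metis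
    then obtain a b c where "T = {a, b, c}" "a \<noteq> b" "b \<noteq> c" "a \<noteq> c" unfolding card_3_iff by blast
    then show False using pattern_three[OF pat k, of a b c x] T(1) by auto
  qed
  have "card {i. i < k \<and> e i \<inter> L \<noteq> {}} \<le> card (\<Union>x\<in>L. {i. i < k \<and> x \<in> e i})"
    using L by (intro card_mono) auto
  also have "\<dots> \<le> (\<Sum>x\<in>L. card {i. i < k \<and> x \<in> e i})" by (rule card_UN_le[OF L])
  also have "\<dots> \<le> (\<Sum>x\<in>L. 2)" by (intro sum_mono two)
  finally show ?thesis by simp
qed

text \<open>
At most \<open>2 l\<close> edges of a cycle meet \<open>L\<close>. For \<open>k = 4\<close> this leaves two edges outside the star; they would have to be
opposite, as they are disjoint, but then so are the two edges through the centre.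
\<close>

lemma star_plus_no_cycle:
  assumes k: "4 \<le> k" and L: "finite L" "card L = (k - 1) div 2"
    and E: "odd k \<Longrightarrow> {f \<in> H. f \<inter> L = {}} = {}" "card {f \<in> H. f \<inter> L = {}} \<le> 1 \<or> k = 4"
      "k = 4 \<Longrightarrow> pairwise disjnt {f \<in> H. f \<inter> L = {}}" and finH: "finite H"
  shows "\<not> has_cycle k H"
proof
  assume "has_cycle k H"
  then obtain e where e: "\<And>i. i < k \<Longrightarrow> e i \<in> H" and pat: "cyclic_pattern k e" unfolding has_cycle_def by blast
  let ?A = "{i. i < k \<and> e i \<inter> L \<noteq> {}}" and ?B = "{i. i < k \<and> e i \<inter> L = {}}"
  have inj: "inj_on e {..<k}" by (rule pattern_inj[OF pat k])
  have A: "card ?A \<le> 2 * ((k - 1) div 2)" using card_pattern_meeting_le[OF pat k L(1)] L(2) by simp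
  have "?A \<union> ?B = {..<k}" "?A \<inter> ?B = {}" by auto
  then have AB: "card ?A + card ?B = k" using card_Un_disjoint[of ?A ?B] by simp
  have B: "card ?B \<le> card {f \<in> H. f \<inter> L = {}}"
  proof (rule card_inj_on_le[of e])
    show "inj_on e ?B" by (rule inj_on_subset[OF inj]) auto
    show "e ` ?B \<subseteq> {f \<in> H. f \<inter> L = {}}" using e by auto
    show "finite {f \<in> H. f \<inter> L = {}}" using finH by simp
  qed
  consider "odd k" | "even k" "k \<noteq> 4" | "k = 4" by blast
  then show False
  proof cases
    case 1
    then have "card ?B = 0" using B E(1) by simp
    then show False using A AB k by linarith
  next
    case 2
    then have "card ?B \<le> 1" using B E(2) by linarith
    moreover have "2 * ((k - 1) div 2) + 2 = k" using 2 k by presburger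
    ultimately show False using A AB by linarith
  next
    case 3
    have x: "e i \<inter> e j \<noteq> {} \<longleftrightarrow> j = Suc i \<or> (i = 0 \<and> j = 3)" if "i < j" "j < 4" for i j
      using pat that 3 unfolding cyclic_pattern_def by auto
    have nb: "\<not> (e i \<inter> L = {} \<and> e j \<inter> L = {})" if ij: "i < j" "j < 4" "e i \<inter> e j \<noteq> {}" for i j
    proof
      assume a: "e i \<inter> L = {} \<and> e j \<inter> L = {}"
      have "e i \<in> H" "e j \<in> H" using e ij 3 by auto
      moreover have "e i \<noteq> e j" using inj_on_eq_iff[OF inj, of i j] ij 3 by auto
      ultimately have "disjnt (e i) (e j)" using E(3)[OF 3] a unfolding pairwise_def by blast
      then show False using ij(3) unfolding disjnt_def by simp
    qed
    obtain c where c: "L = {c}" using L(2) 3 by (auto simp: card_1_singleton_iff)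
    have op: "e i \<inter> L = {} \<or> e j \<inter> L = {}" if "e i \<inter> e j = {}" for i j using that unfolding c by auto
    have "e 0 \<inter> e 2 = {}" "e 1 \<inter> e 3 = {}" using x[of 0 2] x[of 1 3] by auto
    then have "e 0 \<inter> L = {} \<or> e 2 \<inter> L = {}" "e 1 \<inter> L = {} \<or> e 3 \<inter> L = {}" using op by blast+
    moreover have "e 0 \<inter> e 1 \<noteq> {}" "e 1 \<inter> e 2 \<noteq> {}" "e 2 \<inter> e 3 \<noteq> {}" "e 0 \<inter> e 3 \<noteq> {}"
      using x[of 0 1] x[of 1 2] x[of 2 3] x[of 0 3] by auto
    moreover have "\<not> (e 0 \<inter> L = {} \<and> e 1 \<inter> L = {})" "\<not> (e 1 \<inter> L = {} \<and> e 2 \<inter> L = {})"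
        "\<not> (e 2 \<inter> L = {} \<and> e 3 \<inter> L = {})" "\<not> (e 0 \<inter> L = {} \<and> e 3 \<inter> L = {})"
      by (rule nb; use calculation in simp)+
    ultimately show False by metis
  qed
qed

lemma extremal_example:
  assumes r: "3 \<le> r" and k: "4 \<le> k" and l: "l = (k - 1) div 2" and n: "l + r \<le> n"
  shows "\<exists>H. H \<subseteq> nsets {1..n} r \<and> \<not> has_cycle k H \<and> card H = (n choose r) - ((n - l) choose r) + extra_edges r k n"
proof -
  let ?L = "{1..l}"
  let ?S = "{e \<in> nsets {1..n} r. e \<inter> ?L \<noteq> {}}"
  obtain E where E: "E \<subseteq> nsets ({1..n} - ?L) r" "card E = extra_edges r k n" "finite E" "k = 4 \<Longrightarrow> pairwise disjnt E"
  proof (cases "k = 4")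
    case True
    then have l1: "l = 1" using l by simp
    \<comment> \<open>the blocks start at \<open>2\<close> because the centre is the vertex \<open>1\<close>\<close>
    let ?b = "\<lambda>i. {i * r + 2..<i * r + r + 2}"
    let ?E = "?b ` {..<(n - 1) div r}"
    have dis: "?b i \<inter> ?b j = {}" if "i < j" for i j
    proof -
      have "Suc i * r \<le> j * r" using that by (intro mult_le_mono1) simp
      then show ?thesis by auto
    qed
    have ne: "?b i \<noteq> {}" for i using r by simp
    have inj: "inj_on ?b {..<(n - 1) div r}"
    proof (rule inj_onI)
      fix i j assume "?b i = ?b j"
      then show "i = j" using dis[of i j] dis[of j i] ne[of i] ne[of j] by (metis inf.idem nat_neq_iff)
    qed
    show thesis
    proof (rule that[of ?E])
      show "card ?E = extra_edges r k n" using True card_image[OF inj] by (simp add: extra_edges_def)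
      show "?E \<subseteq> nsets ({1..n} - ?L) r"
      proof (rule image_subsetI)
        fix i assume i: "i \<in> {..<(n - 1) div r}"
        then have "Suc i * r \<le> (n - 1) div r * r" by (intro mult_le_mono1) simp
        also have "\<dots> \<le> n - 1" by simp
        finally have "i * r + r \<le> n - 1" by simp
        then show "?b i \<in> nsets ({1..n} - ?L) r" using n r l1 unfolding nsets_def by auto
      qed
      show "pairwise disjnt ?E"
      proof (rule pairwiseI)
        fix x y assume "x \<in> ?E" "y \<in> ?E" "x \<noteq> y"
        then obtain i j where ij: "x = ?b i" "y = ?b j" "i \<noteq> j" by blast
        then show "disjnt x y" using dis[of i j] dis[of j i] unfolding disjnt_def by (metis inf.commute nat_neq_iff)
      qed
    qed simp
  next
    case False
    show thesis
    proof (cases "odd k")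
      case True
      then show thesis using that[of "{}"] False by (simp add: extra_edges_def)
    next
      case ev: False
      have "{l+1..l+r} \<in> nsets ({1..n} - ?L) r" using n unfolding nsets_def by auto
      then show thesis using that[of "{{l+1..l+r}}"] False ev by (simp add: extra_edges_def)
    qed
  qed
  define H where "H = ?S \<union> E"
  have EL: "f \<inter> ?L = {}" if "f \<in> E" for f using E(1) that unfolding nsets_def by auto
  have HE: "{f \<in> H. f \<inter> ?L = {}} = E" using EL unfolding H_def by auto
  have sub: "H \<subseteq> nsets {1..n} r" using E(1) nsets_mono[of "{1..n} - ?L" "{1..n}" r] unfolding H_def by auto
  have finS: "finite ?S" using finite_imp_finite_nsets[of "{1..n}" r] by simp
  have finH: "finite H" unfolding H_def using finS E(3) by simp
  have "\<not> has_cycle k H"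
  proof (rule star_plus_no_cycle[OF k, of ?L])
    show "card {f \<in> H. f \<inter> ?L = {}} \<le> 1 \<or> k = 4" unfolding HE E(2) extra_edges_def by simp
    show "{f \<in> H. f \<inter> ?L = {}} = {}" if "odd k" unfolding HE using E(2,3) that by (simp add: extra_edges_def)
    show "pairwise disjnt {f \<in> H. f \<inter> ?L = {}}" if "k = 4" unfolding HE using E(4) that .
  qed (use l finH in simp_all)
  moreover have "card H = (n choose r) - ((n - l) choose r) + extra_edges r k n"
  proof -
    have "?S \<inter> E = {}" using EL by auto
    then have "card H = card ?S + card E" unfolding H_def by (rule card_Un_disjoint[OF finS E(3)])
    moreover have "card ?S + ((n - l) choose r) = n choose r" using card_star[of "{1..n}" ?L r] n by simp
    ultimately show ?thesis using E(2) by simp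
  qed
  ultimately show ?thesis using sub by blast
qed

text \<open>
A cycle-free hypergraph with more edges than the extremal example would also have the extremal structure, and
hence not more edges.
\<close>

lemma turan_minimal_cycles:
  assumes r: "3 \<le> r" and k: "4 \<le> k" and l: "l = (k - 1) div 2"
  shows "\<exists>n0. \<forall>n\<ge>n0. turan_number r n (minimal_cycles r k) = (n choose r) - ((n - l) choose r) + extra_edges r k n \<and>
     (\<forall>H. r_graph r {1..n} H \<and> family_free (minimal_cycles r k) H \<and>
          card H = (n choose r) - ((n - l) choose r) + extra_edges r k n \<longrightarrow>
        (\<exists>L\<subseteq>{1..n}. card L = l \<and> S_graph L r n \<subseteq> H \<and> card {f \<in> H. f \<inter> L = {}} = extra_edges r k n \<and>
           (k = 4 \<longrightarrow> pairwise disjnt {f \<in> H. f \<inter> L = {}})))"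
proof -
  obtain n1 where ex: "\<forall>(V :: nat set) H. finite V \<longrightarrow> n1 \<le> card V \<longrightarrow> H \<subseteq> nsets V r \<longrightarrow> \<not> has_cycle k H \<longrightarrow>
     (card V choose r) - ((card V - l) choose r) + extra_edges r k (card V) \<le> card H \<longrightarrow>
     (\<exists>L\<subseteq>V. card L = l \<and> {e \<in> nsets V r. e \<inter> L \<noteq> {}} \<subseteq> H \<and> card {f \<in> H. f \<inter> L = {}} = extra_edges r k (card V) \<and>
        (k = 4 \<longrightarrow> pairwise disjnt {f \<in> H. f \<inter> L = {}}))"
    using exact_structure[OF r k l, where 'a = nat] by (elim exE) (rule that)
  show ?thesis
  proof (rule exI[of _ "max n1 (l + r)"], intro allI impI)
    fix n assume n: "max n1 (l + r) \<le> n"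
    define m where "m = (n choose r) - ((n - l) choose r) + extra_edges r k n"
    have str: "\<exists>L\<subseteq>{1..n}. card L = l \<and> S_graph L r n \<subseteq> H \<and> card {f \<in> H. f \<inter> L = {}} = extra_edges r k n \<and>
        (k = 4 \<longrightarrow> pairwise disjnt {f \<in> H. f \<inter> L = {}})"
      if H: "r_graph r {1..n} H" "family_free (minimal_cycles r k) H" "m \<le> card H" for H
    proof -
      have "H \<subseteq> nsets {1..n} r" using H(1) unfolding r_graph_def by simp
      moreover have "\<not> has_cycle k H" using family_free_iff_no_cycle[OF H(1) k] H(2) by simp
      ultimately show ?thesis
        using ex[THEN spec, of "{1..n}", THEN spec, of H] n H(3) unfolding S_graph_def m_def by simp
    qed
    have up: "card H \<le> m" if H: "r_graph r {1..n} H" "family_free (minimal_cycles r k) H" for H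
    proof (rule ccontr)
      assume "\<not> card H \<le> m"
      then obtain L where L: "L \<subseteq> {1..n}" "card L = l" "S_graph L r n \<subseteq> H" "card {f \<in> H. f \<inter> L = {}} = extra_edges r k n"
        using str[OF H] by auto
      have Hs: "H \<subseteq> nsets {1..n} r" using H(1) unfolding r_graph_def by simp
      have finH: "finite H" using Hs finite_imp_finite_nsets[of "{1..n}" r] finite_subset by auto
      have "H = S_graph L r n \<union> {f \<in> H. f \<inter> L = {}}" using L(3) Hs unfolding S_graph_def by auto
      then have "card H \<le> card (S_graph L r n) + card {f \<in> H. f \<inter> L = {}}" by (metis card_Un_le)
      also have "\<dots> = m" using card_star[OF _ L(1), of r] L(2,4) unfolding S_graph_def m_def by simp
      finally show False using \<open>\<not> card H \<le> m\<close> by simp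
    qed
    let ?C = "{card H | H. r_graph r {1..n} H \<and> family_free (minimal_cycles r k) H}"
    have "m \<in> ?C"
    proof -
      obtain H where H: "H \<subseteq> nsets {1..n} r" "\<not> has_cycle k H" "card H = m"
        using extremal_example[OF r k l, of n] n unfolding m_def by auto
      have "r_graph r {1..n} H" using H(1) unfolding r_graph_def by simp
      then show ?thesis using family_free_iff_no_cycle[of r "{1..n}" H k] k H(2,3) by blast
    qed
    moreover have sub: "?C \<subseteq> {..m}" using up by auto
    moreover have "finite ?C" by (rule finite_subset[OF sub]) simp
    ultimately have "Max ?C = m" by (intro Max_eqI) blast+
    then have tn: "turan_number r n (minimal_cycles r k) = m" unfolding turan_number_def .
    show "turan_number r n (minimal_cycles r k) = (n choose r) - ((n - l) choose r) + extra_edges r k n \<and>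
     (\<forall>H. r_graph r {1..n} H \<and> family_free (minimal_cycles r k) H \<and>
          card H = (n choose r) - ((n - l) choose r) + extra_edges r k n \<longrightarrow>
        (\<exists>L\<subseteq>{1..n}. card L = l \<and> S_graph L r n \<subseteq> H \<and> card {f \<in> H. f \<inter> L = {}} = extra_edges r k n \<and>
           (k = 4 \<longrightarrow> pairwise disjnt {f \<in> H. f \<inter> L = {}})))"
      unfolding m_def[symmetric] using tn str by simp
  qed
qed

theorem theorem1p2:
  shows "(\<forall>r k :: nat. r \<ge> 3 \<longrightarrow> k \<ge> 5 \<longrightarrow>
      (\<exists>n\<^sub>0. \<forall>n\<ge>n\<^sub>0. let l = (k - 1) div 2;
          m = (n choose r) - ((n - l) choose r) + (if odd k then 0 else 1) in
        turan_number r n (minimal_cycles r k) = m \<and>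
        (\<forall>H :: nat set set.
           r_graph r {1..n} H \<and> family_free (minimal_cycles r k) H \<and> card H = m \<longrightarrow>
           (\<exists>L\<subseteq>{1..n}. card L = l \<and>
              (if odd k then H = S_graph L r n
               else \<exists>f\<in>nsets {1..n} r - S_graph L r n. H = insert f (S_graph L r n))))))
    \<and>
    (\<forall>r :: nat. r \<ge> 3 \<longrightarrow>
      (\<exists>n\<^sub>0. \<forall>n\<ge>n\<^sub>0. let m = (n choose r) - ((n - 1) choose r) + (n - 1) div r in
        turan_number r n (minimal_cycles r 4) = m \<and>
        (\<forall>H :: nat set set.
           r_graph r {1..n} H \<and> family_free (minimal_cycles r 4) H \<and> card H = m \<longrightarrow>
           (\<exists>L\<subseteq>{1..n}. card L = 1 \<and>
              (\<exists>F\<subseteq>nsets ({1..n} - L) r. card F = (n - 1) div r \<and> pairwise disjnt F \<and>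
                 H = S_graph L r n \<union> F)))))"
proof (intro conjI allI impI)
  fix r k :: nat assume r: "3 \<le> r" and k5: "5 \<le> k"
  define l where "l = (k - 1) div 2"
  have k: "4 \<le> k" using k5 by simp
  have ext: "extra_edges r k n = (if odd k then 0 else 1)" for n using k5 by (simp add: extra_edges_def)
  obtain n0 where main: "\<forall>n\<ge>n0. turan_number r n (minimal_cycles r k) = (n choose r) - ((n - l) choose r) + (if odd k then 0 else 1) \<and>
     (\<forall>H. r_graph r {1..n} H \<and> family_free (minimal_cycles r k) H \<and>
          card H = (n choose r) - ((n - l) choose r) + (if odd k then 0 else 1) \<longrightarrow>
        (\<exists>L\<subseteq>{1..n}. card L = l \<and> S_graph L r n \<subseteq> H \<and> card {f \<in> H. f \<inter> L = {}} = (if odd k then 0 else 1) \<and>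
           (k = 4 \<longrightarrow> pairwise disjnt {f \<in> H. f \<inter> L = {}})))"
    using turan_minimal_cycles[OF r k l_def] unfolding ext by (elim exE) (rule that)
  show "\<exists>n\<^sub>0. \<forall>n\<ge>n\<^sub>0. let l = (k - 1) div 2;
          m = (n choose r) - ((n - l) choose r) + (if odd k then 0 else 1) in
        turan_number r n (minimal_cycles r k) = m \<and>
        (\<forall>H :: nat set set.
           r_graph r {1..n} H \<and> family_free (minimal_cycles r k) H \<and> card H = m \<longrightarrow>
           (\<exists>L\<subseteq>{1..n}. card L = l \<and>
              (if odd k then H = S_graph L r n
               else \<exists>f\<in>nsets {1..n} r - S_graph L r n. H = insert f (S_graph L r n))))"
    unfolding Let_def l_def[symmetric]
  proof (rule exI[of _ n0], intro allI impI conjI)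
    fix n assume n: "n0 \<le> n"
    show "turan_number r n (minimal_cycles r k) = (n choose r) - ((n - l) choose r) + (if odd k then 0 else 1)"
      using main n by blast
    fix H :: "nat set set"
    assume H: "r_graph r {1..n} H \<and> family_free (minimal_cycles r k) H \<and>
        card H = (n choose r) - ((n - l) choose r) + (if odd k then 0 else 1)"
    then obtain L where L: "L \<subseteq> {1..n}" "card L = l" "S_graph L r n \<subseteq> H" "card {f \<in> H. f \<inter> L = {}} = (if odd k then 0 else 1)"
      using main n by blast
    have Hs: "H \<subseteq> nsets {1..n} r" using H unfolding r_graph_def by simp
    have finH: "finite H" using Hs finite_imp_finite_nsets[of "{1..n}" r] finite_subset by auto
    have dec: "H = S_graph L r n \<union> {f \<in> H. f \<inter> L = {}}" using L(3) Hs unfolding S_graph_def by auto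
    have "if odd k then H = S_graph L r n
               else \<exists>f\<in>nsets {1..n} r - S_graph L r n. H = insert f (S_graph L r n)"
    proof (cases "odd k")
      case True
      then have "card {f \<in> H. f \<inter> L = {}} = 0" using L(4) by simp
      moreover have "finite {f \<in> H. f \<inter> L = {}}" using finH by simp
      ultimately have none: "{f \<in> H. f \<inter> L = {}} = {}" by (simp only: card_0_eq)
      show ?thesis using dec[unfolded none] True by simp
    next
      case False
      then obtain f where f: "{f \<in> H. f \<inter> L = {}} = {f}" using L(4) by (auto simp: card_1_singleton_iff)
      then have "f \<in> nsets {1..n} r - S_graph L r n" using Hs unfolding S_graph_def by auto
      then show ?thesis using dec False unfolding f by auto
    qed
    then show "\<exists>L\<subseteq>{1..n}. card L = l \<and>
              (if odd k then H = S_graph L r n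
               else \<exists>f\<in>nsets {1..n} r - S_graph L r n. H = insert f (S_graph L r n))"
      using L(1,2) by blast
  qed
next
  fix r :: nat assume r: "3 \<le> r"
  have l: "1 = (4 - 1) div (2::nat)" by simp
  have ext: "extra_edges r 4 n = (n - 1) div r" for n by (simp add: extra_edges_def)
  obtain n0 where main: "\<forall>n\<ge>n0. turan_number r n (minimal_cycles r 4) = (n choose r) - ((n - 1) choose r) + (n - 1) div r \<and>
     (\<forall>H. r_graph r {1..n} H \<and> family_free (minimal_cycles r 4) H \<and>
          card H = (n choose r) - ((n - 1) choose r) + (n - 1) div r \<longrightarrow>
        (\<exists>L\<subseteq>{1..n}. card L = 1 \<and> S_graph L r n \<subseteq> H \<and> card {f \<in> H. f \<inter> L = {}} = (n - 1) div r \<and>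
           ((4::nat) = 4 \<longrightarrow> pairwise disjnt {f \<in> H. f \<inter> L = {}})))"
    using turan_minimal_cycles[OF r order_refl l] unfolding ext by (elim exE) (rule that)
  show "\<exists>n\<^sub>0. \<forall>n\<ge>n\<^sub>0. let m = (n choose r) - ((n - 1) choose r) + (n - 1) div r in
        turan_number r n (minimal_cycles r 4) = m \<and>
        (\<forall>H :: nat set set.
           r_graph r {1..n} H \<and> family_free (minimal_cycles r 4) H \<and> card H = m \<longrightarrow>
           (\<exists>L\<subseteq>{1..n}. card L = 1 \<and>
              (\<exists>F\<subseteq>nsets ({1..n} - L) r. card F = (n - 1) div r \<and> pairwise disjnt F \<and>
                 H = S_graph L r n \<union> F)))"
    unfolding Let_def
  proof (rule exI[of _ n0], intro allI impI conjI)
    fix n assume n: "n0 \<le> n"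
    show "turan_number r n (minimal_cycles r 4) = (n choose r) - ((n - 1) choose r) + (n - 1) div r"
      using main n by blast
    fix H :: "nat set set"
    assume H: "r_graph r {1..n} H \<and> family_free (minimal_cycles r 4) H \<and>
        card H = (n choose r) - ((n - 1) choose r) + (n - 1) div r"
    then obtain L where L: "L \<subseteq> {1..n}" "card L = 1" "S_graph L r n \<subseteq> H" "card {f \<in> H. f \<inter> L = {}} = (n - 1) div r"
        "pairwise disjnt {f \<in> H. f \<inter> L = {}}"
      using main n by blast
    have Hs: "H \<subseteq> nsets {1..n} r" using H unfolding r_graph_def by simp
    have dec: "H = S_graph L r n \<union> {f \<in> H. f \<inter> L = {}}" using L(3) Hs unfolding S_graph_def by auto
    have "{f \<in> H. f \<inter> L = {}} \<subseteq> nsets ({1..n} - L) r" using Hs unfolding nsets_def by auto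
    then show "\<exists>L\<subseteq>{1..n}. card L = 1 \<and>
              (\<exists>F\<subseteq>nsets ({1..n} - L) r. card F = (n - 1) div r \<and> pairwise disjnt F \<and>
                 H = S_graph L r n \<union> F)"
      using L dec by blast
  qed
qed

end
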